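(* Let $M$ be a compact connected manifold of dimension $d\ge 1$ and let $L(x,v)$ be a symmetrical Tonelli Lagrangian on $TM$, i.e. $L(x,v)=L(x,-v)$ for every $(x,v)\in TM$, such that the function $x\mapsto L(x,0)$ belongs to $C^r(M)$ with $r\ge 2d-2$. Then the quotient Aubry set $(\bar{\mathcal A}_{L,0},\bar\delta_0)$, corresponding to the zero cohomology class, is totally disconnected, i.e., every connected component consists of a single point.
   Context: $M$ is a compact connected smooth manifold without boundary, with a fixed Riemannian metric and induced norms $\|\cdot\|_x$ on $T_xM$. A Tonelli Lagrangian is a function $L:TM\to\mathbb{R}$ such that (i) $L\in C^2(TM)$; (ii) $\frac{\partial^2L}{\partial v^2}(x,v)$ is positive definite for all $(x,v)\in TM$; (iii) $\lim_{\|v\|_x\to\infty}L(x,v)/\|v\|_x=+\infty$ for each $x$. Quotient Aubry set. For a closed ($C^2$) $1$-form $\eta$ with class $c=[\eta]\in H^1(M;\mathbb{R})$, let $L_\eta(x,v)=L(x,v)-\langle\eta(x),v\rangle_x$. Mather's $\alpha$ function is $\alpha(c)=-\min_\mu\int L_\eta\,d\mu$, the minimum being over Borel probability measures on $TM$ invariant under the Euler-Lagrange flow of $L$. For $t>0$ let $h_{\eta,t}(x,y)=\inf\int_0^tL_\eta(\gamma(s),\dot\gamma(s))\,ds$ over piecewise $C^1$ paths $\gamma:[0,t]\to M$ with $\gamma(0)=x$, $\gamma(t)=y$, and let $h_\eta(x,y)=\liminf_{t\to+\infty}(h_{\eta,t}(x,y)+\alpha(c)t)$ (Peierls barrier). Let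 $\delta_c(x,y)=h_\eta(x,y)+h_\eta(y,x)$, which depends only on $c$. The Aubry set is $\mathcal{A}_{L,c}=\{x\in M:\delta_c(x,x)=0\}$; $\delta_c$ is a pseudometric on it. The quotient Aubry set $(\bar{\mathcal A}_{L,c},\bar\delta_c)$ is the metric space obtained from $(\mathcal A_{L,c},\delta_c)$ by identifying points at $\delta_c$-distance zero. Here $c=0$ (one may take $\eta=0$). *)

theory Defs
  imports "HOL-Analysis.Analysis"
begin

section \<open>Differentiability classes\<close>

text \<open>Meaningful for open \<open>S\<close>.\<close>

fun Ck_on :: "nat \<Rightarrow> ('e::real_normed_vector \<Rightarrow> 'f::real_normed_vector) \<Rightarrow> 'e set \<Rightarrow> bool" where
  "Ck_on 0 f S \<longleftrightarrow> continuous_on S f"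
| "Ck_on (Suc k) f S \<longleftrightarrow>
     (\<forall>x\<in>S. f differentiable (at x)) \<and> (\<forall>v. Ck_on k (\<lambda>x. frechet_derivative f (at x) v) S)"


section \<open>Smooth manifolds and their tangent bundles\<close>

text \<open>The manifold is the whole (Hausdorff) type \<open>'a\<close>; its dimension is that of the
  model space \<open>'e\<close>. Only the values of a chart map on the chart domain matter.\<close>

type_synonym ('a, 'e) chart = "'a set \<times> ('a \<Rightarrow> 'e)"

abbreviation chart_dom :: "('a, 'e) chart \<Rightarrow> 'a set" where "chart_dom \<equiv> fst"
abbreviation chart_map :: "('a, 'e) chart \<Rightarrow> 'a \<Rightarrow> 'e" where "chart_map \<equiv> snd"

definition chart_codom :: "('a, 'e) chart \<Rightarrow> 'e set" where
  "chart_codom c = chart_map c ` chart_dom c"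

definition chart_inv :: "('a, 'e) chart \<Rightarrow> 'e \<Rightarrow> 'a" where
  "chart_inv c = inv_into (chart_dom c) (chart_map c)"

definition smooth_atlas :: "('a::t2_space, 'e::euclidean_space) chart set \<Rightarrow> bool" where
  "smooth_atlas A \<longleftrightarrow>
     (\<forall>c\<in>A. open (chart_dom c) \<and> open (chart_codom c) \<and>
        homeomorphism (chart_dom c) (chart_codom c) (chart_map c) (chart_inv c)) \<and>
     (\<Union>c\<in>A. chart_dom c) = UNIV \<and>
     (\<forall>c\<in>A. \<forall>c'\<in>A. \<forall>k.
        Ck_on k (chart_map c' \<circ> chart_inv c) (chart_map c ` (chart_dom c \<inter> chart_dom c')))"

definition Ck_fun :: "('a::t2_space, 'e::euclidean_space) chart set \<Rightarrow> nat \<Rightarrow> ('a \<Rightarrow> real) \<Rightarrow> bool" where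
  "Ck_fun A k f \<longleftrightarrow> (\<forall>c\<in>A. Ck_on k (\<lambda>p. f (chart_inv c p)) (chart_codom c))"

text \<open>A tangent vector at \<open>x\<close> is the family of its coordinate vectors with respect to all
  charts around \<open>x\<close>, related by the derivatives of the transition maps; the entries at all
  other indices are set to \<open>0\<close>. Vector space operations are pointwise.\<close>

type_synonym ('a, 'e) tvec = "('a, 'e) chart \<Rightarrow> 'e"

definition tangent_space ::
  "('a::t2_space, 'e::euclidean_space) chart set \<Rightarrow> 'a \<Rightarrow> ('a, 'e) tvec set" where
  "tangent_space A x = {v.
     (\<forall>c\<in>A. \<forall>c'\<in>A. x \<in> chart_dom c \<inter> chart_dom c' \<longrightarrow>
        v c' = frechet_derivative (chart_map c' \<circ> chart_inv c) (at (chart_map c x)) (v c)) \<and>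
     (\<forall>c. c \<notin> A \<or> x \<notin> chart_dom c \<longrightarrow> v c = 0)}"

definition tangent_bundle ::
  "('a::t2_space, 'e::euclidean_space) chart set \<Rightarrow> ('a \<times> ('a, 'e) tvec) set" where
  "tangent_bundle A = Sigma UNIV (tangent_space A)"

text \<open>The tangent vector at \<open>x\<close> whose coordinate vector in the chart \<open>c\<close> is \<open>u\<close>.\<close>

definition tvec_of ::
  "('a::t2_space, 'e::euclidean_space) chart set \<Rightarrow> ('a, 'e) chart \<Rightarrow> 'a \<Rightarrow> 'e \<Rightarrow> ('a, 'e) tvec" where
  "tvec_of A c x u = (\<lambda>c'. if c' \<in> A \<and> x \<in> chart_dom c'
     then frechet_derivative (chart_map c' \<circ> chart_inv c) (at (chart_map c x)) u else 0)"

text \<open>The local representative on \<open>chart_codom c \<times> UNIV\<close> of a function on the tangent bundle.\<close>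

definition TM_point ::
  "('a::t2_space, 'e::euclidean_space) chart set \<Rightarrow> ('a, 'e) chart \<Rightarrow> 'e \<times> 'e \<Rightarrow> 'a \<times> ('a, 'e) tvec" where
  "TM_point A c = (\<lambda>(p, w). (chart_inv c p, tvec_of A c (chart_inv c p) w))"

definition local_rep ::
  "('a::t2_space, 'e::euclidean_space) chart set \<Rightarrow> ('a \<times> ('a, 'e) tvec \<Rightarrow> real) \<Rightarrow>
     ('a, 'e) chart \<Rightarrow> 'e \<times> 'e \<Rightarrow> real" where
  "local_rep A L c = L \<circ> TM_point A c"

definition TM_borel ::
  "('a::t2_space, 'e::euclidean_space) chart set \<Rightarrow> ('a \<times> ('a, 'e) tvec) measure" where
  "TM_borel A = sigma (tangent_bundle A)
     {W. W \<subseteq> tangent_bundle A \<and>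
         (\<forall>c\<in>A. open {z \<in> chart_codom c \<times> UNIV. TM_point A c z \<in> W})}"

definition riemannian_metric ::
  "('a::t2_space, 'e::euclidean_space) chart set \<Rightarrow>
     ('a \<Rightarrow> ('a, 'e) tvec \<Rightarrow> ('a, 'e) tvec \<Rightarrow> real) \<Rightarrow> bool" where
  "riemannian_metric A g \<longleftrightarrow>
     (\<forall>c\<in>A. \<forall>x\<in>chart_dom c.
        bilinear (\<lambda>u w. g x (tvec_of A c x u) (tvec_of A c x w))) \<and>
     (\<forall>x. \<forall>v\<in>tangent_space A x. \<forall>w\<in>tangent_space A x. g x v w = g x w v) \<and>
     (\<forall>x. \<forall>v\<in>tangent_space A x. v \<noteq> (\<lambda>_. 0) \<longrightarrow> g x v v > 0) \<and>
     (\<forall>c\<in>A. \<forall>u w k. Ck_on k (\<lambda>p. g (chart_inv c p)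
        (tvec_of A c (chart_inv c p) u) (tvec_of A c (chart_inv c p) w)) (chart_codom c))"

definition riemannian_norm ::
  "('a \<Rightarrow> ('a, 'e) tvec \<Rightarrow> ('a, 'e) tvec \<Rightarrow> real) \<Rightarrow> 'a \<Rightarrow> ('a, 'e) tvec \<Rightarrow> real" where
  "riemannian_norm g x v = sqrt (g x v v)"


section \<open>Tonelli Lagrangians\<close>

text \<open>Derivatives of a Lagrangian, in the coordinates of the chart \<open>c\<close>, with respect to position
  and velocity at \<open>(p, w)\<close> in direction \<open>u\<close>.\<close>

definition L_x ::
  "('a::t2_space, 'e::euclidean_space) chart set \<Rightarrow> ('a \<times> ('a, 'e) tvec \<Rightarrow> real) \<Rightarrow>
     ('a, 'e) chart \<Rightarrow> 'e \<Rightarrow> 'e \<Rightarrow> 'e \<Rightarrow> real" where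
  "L_x A L c p w u = frechet_derivative (\<lambda>p'. local_rep A L c (p', w)) (at p) u"

definition L_v ::
  "('a::t2_space, 'e::euclidean_space) chart set \<Rightarrow> ('a \<times> ('a, 'e) tvec \<Rightarrow> real) \<Rightarrow>
     ('a, 'e) chart \<Rightarrow> 'e \<Rightarrow> 'e \<Rightarrow> 'e \<Rightarrow> real" where
  "L_v A L c p w u = frechet_derivative (\<lambda>w'. local_rep A L c (p, w')) (at w) u"

definition tonelli_lagrangian ::
  "('a::t2_space, 'e::euclidean_space) chart set \<Rightarrow>
     ('a \<Rightarrow> ('a, 'e) tvec \<Rightarrow> ('a, 'e) tvec \<Rightarrow> real) \<Rightarrow> ('a \<times> ('a, 'e) tvec \<Rightarrow> real) \<Rightarrow> bool" where
  "tonelli_lagrangian A g L \<longleftrightarrow>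
     (\<forall>c\<in>A. Ck_on 2 (local_rep A L c) (chart_codom c \<times> UNIV)) \<and>
     (\<forall>c\<in>A. \<forall>p\<in>chart_codom c. \<forall>w u. u \<noteq> 0 \<longrightarrow>
        frechet_derivative (\<lambda>w'. L_v A L c p w' u) (at w) u > 0) \<and>
     (\<forall>x. filterlim (\<lambda>v. L (x, v) / riemannian_norm g x v) at_top
        (inf (filtercomap (riemannian_norm g x) at_top) (principal (tangent_space A x))))"

definition symmetrical_lagrangian ::
  "('a::t2_space, 'e::euclidean_space) chart set \<Rightarrow> ('a \<times> ('a, 'e) tvec \<Rightarrow> real) \<Rightarrow> bool" where
  "symmetrical_lagrangian A L \<longleftrightarrow> (\<forall>(x, v)\<in>tangent_bundle A. L (x, v) = L (x, - v))"


section \<open>Curves and the Euler--Lagrange flow\<close>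

text \<open>\<open>I\<close> is a nondegenerate interval; at its end points the derivatives are one-sided.\<close>

definition C1_curve_on ::
  "('a::t2_space, 'e::euclidean_space) chart set \<Rightarrow> (real \<Rightarrow> 'a) \<Rightarrow> real set \<Rightarrow> bool" where
  "C1_curve_on A \<gamma> I \<longleftrightarrow> continuous_on I \<gamma> \<and>
     (\<forall>c\<in>A.
        (\<forall>s\<in>I. \<gamma> s \<in> chart_dom c \<longrightarrow> (chart_map c \<circ> \<gamma>) differentiable (at s within I)) \<and>
        continuous_on {s\<in>I. \<gamma> s \<in> chart_dom c}
          (\<lambda>s. vector_derivative (chart_map c \<circ> \<gamma>) (at s within I)))"

text \<open>Unlike \<open>piecewise_C1_differentiable_on\<close>, this requires the derivative to have one-sided
  limits at the break points.\<close>

definition piecewise_C1_path ::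
  "('a::t2_space, 'e::euclidean_space) chart set \<Rightarrow> real \<Rightarrow> real \<Rightarrow> (real \<Rightarrow> 'a) \<Rightarrow> bool" where
  "piecewise_C1_path A a b \<gamma> \<longleftrightarrow>
     (\<exists>(n::nat) p. p 0 = a \<and> p n = b \<and>
        (\<forall>i<n. p i < p (Suc i) \<and> C1_curve_on A \<gamma> {p i..p (Suc i)}))"

definition tangent_lift ::
  "('a::t2_space, 'e::euclidean_space) chart set \<Rightarrow> (real \<Rightarrow> 'a) \<Rightarrow> real \<Rightarrow> 'a \<times> ('a, 'e) tvec" where
  "tangent_lift A \<gamma> s = (\<gamma> s, \<lambda>c. if c \<in> A \<and> \<gamma> s \<in> chart_dom c
     then vector_derivative (chart_map c \<circ> \<gamma>) (at s) else 0)"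

text \<open>The Euler--Lagrange equation in the form \<open>(d/dt) L_v = L_x\<close>, tested against every
  constant coordinate vector \<open>u\<close>.\<close>

definition euler_lagrange_curve ::
  "('a::t2_space, 'e::euclidean_space) chart set \<Rightarrow> ('a \<times> ('a, 'e) tvec \<Rightarrow> real) \<Rightarrow>
     (real \<Rightarrow> 'a) \<Rightarrow> bool" where
  "euler_lagrange_curve A L \<gamma> \<longleftrightarrow> C1_curve_on A \<gamma> UNIV \<and>
     (\<forall>c\<in>A. \<forall>t. \<gamma> t \<in> chart_dom c \<longrightarrow>
        (let q = chart_map c \<circ> \<gamma>; q' = (\<lambda>s. vector_derivative q (at s)) in
         \<forall>u. ((\<lambda>s. L_v A L c (q s) (q' s) u) has_real_derivative L_x A L c (q t) (q' t) u) (at t)))"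

text \<open>For a Tonelli Lagrangian on a compact manifold the flow is complete, so the description
  applies to every \<open>t\<close> and every \<open>\<theta>\<close> in the tangent bundle.\<close>

definition euler_lagrange_flow ::
  "('a::t2_space, 'e::euclidean_space) chart set \<Rightarrow> ('a \<times> ('a, 'e) tvec \<Rightarrow> real) \<Rightarrow>
     real \<Rightarrow> 'a \<times> ('a, 'e) tvec \<Rightarrow> 'a \<times> ('a, 'e) tvec" where
  "euler_lagrange_flow A L t \<theta> = (THE \<theta>'. \<exists>\<gamma>. euler_lagrange_curve A L \<gamma> \<and>
     tangent_lift A \<gamma> 0 = \<theta> \<and> tangent_lift A \<gamma> t = \<theta>')"

text \<open>Measurability of the flow maps is stated for the completed measure. As the flow maps of a
  Tonelli Lagrangian are continuous, hence Borel, this is the usual invariance under the flow.\<close>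

definition flow_invariant_prob ::
  "('a::t2_space, 'e::euclidean_space) chart set \<Rightarrow> ('a \<times> ('a, 'e) tvec \<Rightarrow> real) \<Rightarrow>
     ('a \<times> ('a, 'e) tvec) measure \<Rightarrow> bool" where
  "flow_invariant_prob A L \<mu> \<longleftrightarrow>
     sets \<mu> = sets (TM_borel A) \<and> emeasure \<mu> (space \<mu>) = 1 \<and>
     (\<forall>t. euler_lagrange_flow A L t \<in> measurable (completion \<mu>) \<mu> \<and>
          distr (completion \<mu>) \<mu> (euler_lagrange_flow A L t) = \<mu>)"


section \<open>The quotient Aubry set\<close>

text \<open>In this section \<open>\<eta>\<close> is a closed one-form, viewed as the function \<open>(x, v) \<mapsto> \<langle>\<eta>(x), v\<rangle>\<close>
  on the tangent bundle.\<close>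

definition L_minus ::
  "('a \<times> ('a, 'e) tvec \<Rightarrow> real) \<Rightarrow> ('a \<times> ('a, 'e) tvec \<Rightarrow> real) \<Rightarrow> 'a \<times> ('a, 'e) tvec \<Rightarrow> real" where
  "L_minus L \<eta> \<theta> = L \<theta> - \<eta> \<theta>"

text \<open>\<open>L_minus L \<eta>\<close> is bounded below, so a measure for which it is not integrable has infinite
  action and does not contribute to the minimum. The least element is the minimum of the
  context; it exists for Tonelli \<open>L\<close>.\<close>

definition mather_alpha ::
  "('a::t2_space, 'e::euclidean_space) chart set \<Rightarrow> ('a \<times> ('a, 'e) tvec \<Rightarrow> real) \<Rightarrow>
     ('a \<times> ('a, 'e) tvec \<Rightarrow> real) \<Rightarrow> real" where
  "mather_alpha A L \<eta> = - (LEAST a. \<exists>\<mu>. flow_invariant_prob A L \<mu> \<and>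
     integrable \<mu> (L_minus L \<eta>) \<and> a = integral\<^sup>L \<mu> (L_minus L \<eta>))"

definition min_action ::
  "('a::t2_space, 'e::euclidean_space) chart set \<Rightarrow> ('a \<times> ('a, 'e) tvec \<Rightarrow> real) \<Rightarrow>
     ('a \<times> ('a, 'e) tvec \<Rightarrow> real) \<Rightarrow> real \<Rightarrow> 'a \<Rightarrow> 'a \<Rightarrow> ereal" where
  "min_action A L \<eta> t x y =
     (INF \<gamma>\<in>{\<gamma>. piecewise_C1_path A 0 t \<gamma> \<and> \<gamma> 0 = x \<and> \<gamma> t = y}.
        ereal (integral {0..t} (\<lambda>s. L_minus L \<eta> (tangent_lift A \<gamma> s))))"

definition peierls_barrier ::
  "('a::t2_space, 'e::euclidean_space) chart set \<Rightarrow> ('a \<times> ('a, 'e) tvec \<Rightarrow> real) \<Rightarrow>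
     ('a \<times> ('a, 'e) tvec \<Rightarrow> real) \<Rightarrow> 'a \<Rightarrow> 'a \<Rightarrow> ereal" where
  "peierls_barrier A L \<eta> x y =
     Liminf at_top (\<lambda>t. min_action A L \<eta> t x y + ereal (mather_alpha A L \<eta> * t))"

definition aubry_delta ::
  "('a::t2_space, 'e::euclidean_space) chart set \<Rightarrow> ('a \<times> ('a, 'e) tvec \<Rightarrow> real) \<Rightarrow>
     ('a \<times> ('a, 'e) tvec \<Rightarrow> real) \<Rightarrow> 'a \<Rightarrow> 'a \<Rightarrow> ereal" where
  "aubry_delta A L \<eta> x y = peierls_barrier A L \<eta> x y + peierls_barrier A L \<eta> y x"

definition aubry_set ::
  "('a::t2_space, 'e::euclidean_space) chart set \<Rightarrow> ('a \<times> ('a, 'e) tvec \<Rightarrow> real) \<Rightarrow>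
     ('a \<times> ('a, 'e) tvec \<Rightarrow> real) \<Rightarrow> 'a set" where
  "aubry_set A L \<eta> = {x. aubry_delta A L \<eta> x x = 0}"

definition quotient_aubry_set ::
  "('a::t2_space, 'e::euclidean_space) chart set \<Rightarrow> ('a \<times> ('a, 'e) tvec \<Rightarrow> real) \<Rightarrow>
     ('a \<times> ('a, 'e) tvec \<Rightarrow> real) \<Rightarrow> 'a set set" where
  "quotient_aubry_set A L \<eta> =
     aubry_set A L \<eta> // {(x, y) \<in> aubry_set A L \<eta> \<times> aubry_set A L \<eta>. aubry_delta A L \<eta> x y = 0}"

text \<open>The distance of two classes, independent of the representatives. The Peierls barrier is
  finite, so nothing is lost in passing to real numbers.\<close>

definition quotient_aubry_dist ::
  "('a::t2_space, 'e::euclidean_space) chart set \<Rightarrow> ('a \<times> ('a, 'e) tvec \<Rightarrow> real) \<Rightarrow>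
     ('a \<times> ('a, 'e) tvec \<Rightarrow> real) \<Rightarrow> 'a set \<Rightarrow> 'a set \<Rightarrow> real" where
  "quotient_aubry_dist A L \<eta> X Y =
     real_of_ereal (aubry_delta A L \<eta> (SOME x. x \<in> X) (SOME y. y \<in> Y))"

definition quotient_aubry_topology ::
  "('a::t2_space, 'e::euclidean_space) chart set \<Rightarrow> ('a \<times> ('a, 'e) tvec \<Rightarrow> real) \<Rightarrow>
     ('a \<times> ('a, 'e) tvec \<Rightarrow> real) \<Rightarrow> 'a set topology" where
  "quotient_aubry_topology A L \<eta> =
     Metric_space.mtopology (quotient_aubry_set A L \<eta>) (quotient_aubry_dist A L \<eta>)"

definition zero_form :: "'a \<times> ('a, 'e) tvec \<Rightarrow> real" where
  "zero_form = (\<lambda>_. 0)"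

definition totally_disconnected :: "'b topology \<Rightarrow> bool" where
  "totally_disconnected X \<longleftrightarrow> (\<forall>C\<in>connected_components_of X. \<exists>a. C = {a})"

end

theory Submission
  imports Defs
begin

text \<open>Let \<open>m\<close> be the minimum of \<open>L(x, 0)\<close>. By symmetry and convexity
  \<open>L(x, v) \<ge> L(x, 0) \<ge> m\<close>. The Peierls barrier is identically \<open>\<infinity>\<close> or \<open>-\<infinity>\<close> unless
  \<open>\<alpha>(0) = -m\<close>, so on a nonempty Aubry set \<open>\<alpha>(0) = -m\<close> comes for free and no invariant measure has to be
  produced. The Aubry set is then contained in the zero set of the potential \<open>U(x) = L(x, 0) - m\<close>, and
  \<open>u(y) = \<delta>(x, y)\<close> changes by at most a constant times \<open>e l\<close> along a curve of length at most \<open>l\<close> on which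
  \<open>U \<le> e\<^sup>2\<close> (traverse it at speed \<open>e\<close>). Morse's vanishing lemma splits the zero set of the
  \<open>C\<^sup>r\<close> function \<open>U\<close>, \<open>r = 2 d - 2\<close>, into countably many pieces lying on patches on which
  \<open>U\<close> is \<open>o(|x - y|\<^sup>r)\<close>; hence \<open>u\<close> oscillates by \<open>o(|x - y|\<^sup>d)\<close> on each piece, and \<open>u\<close> maps the
  Aubry set to a null set of reals. On a connected subset of the quotient with two distinct points, however,
  the continuous function \<open>\<delta>(x, \<cdot>)\<close> takes all values of an interval.\<close>

section \<open>Calculus of \<open>C\<^sup>k\<close> maps\<close>

text \<open>The barrier is not known to be differentiable, so Sard's theorem cannot be applied to
  it; the flatness of \<open>U\<close> supplies a modulus of continuity instead. A piece is covered
  by about \<eta>^(-d) balls of radius \<eta>, each with an image of length o(\<eta>^d); with O in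
  place of o the total length would only be bounded. The order 2 d - 2 comes from the same count: a
  potential of size o(h^(2d-2)) permits speed o(h^(d-1)) over a distance h, at cost o(h^d). The
  small o enters at the bottom of Morse's induction, as uniform continuity, and every further order
  of vanishing contributes one factor h. A path between two points of a piece in general leaves the
  zero set, so flatness has to hold on the whole patch around the piece, not just on the
  piece.\<close>

lemma Ck_on_subset: "Ck_on k f S \<Longrightarrow> T \<subseteq> S \<Longrightarrow> Ck_on k f T"
proof (induction k arbitrary: f)
  case 0 then show ?case by (auto intro: continuous_on_subset)
next
  case (Suc k) then show ?case by (simp add: subset_iff) 
qed

lemma frechet_derivative_cong_open:
  assumes "open S" "x \<in> S" "\<And>y. y \<in> S \<Longrightarrow> f y = g y"
  shows "frechet_derivative f (at x) = frechet_derivative g (at x)"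
proof -
  have "(f has_derivative D) (at x) \<longleftrightarrow> (g has_derivative D) (at x)" for D
    using has_derivative_transform_within_open[OF _ assms(1,2), of f D UNIV g]
      has_derivative_transform_within_open[OF _ assms(1,2), of g D UNIV f] assms(3) by auto
  then show ?thesis unfolding frechet_derivative_def by simp
qed

lemma Ck_on_cong:
  assumes "open S" "\<And>y. y \<in> S \<Longrightarrow> f y = g y"
  shows "Ck_on k f S \<longleftrightarrow> Ck_on k g S"
  using assms(2)
proof (induction k arbitrary: f g)
  case 0 then show ?case by (auto cong: continuous_on_cong)
next
  case (Suc k)
  have d: "f differentiable (at x) \<longleftrightarrow> g differentiable (at x)" if "x \<in> S" for x
    unfolding differentiable_def
    using has_derivative_transform_within_open[OF _ assms(1) that, of f _ UNIV g]
      has_derivative_transform_within_open[OF _ assms(1) that, of g _ UNIV f] Suc.prems by metis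
  have "Ck_on k (\<lambda>x. frechet_derivative f (at x) v) S
      \<longleftrightarrow> Ck_on k (\<lambda>x. frechet_derivative g (at x) v) S" for v
    by (rule Suc.IH) (use frechet_derivative_cong_open[OF assms(1)] Suc.prems in metis)
  then show ?case using d by auto
qed

lemma Ck_on_imp_continuous: "Ck_on k f S \<Longrightarrow> continuous_on S f"
proof (cases k)
  case (Suc j)
  assume "Ck_on k f S"
  then have "\<forall>x\<in>S. isCont f x" using Suc by (simp add: differentiable_imp_continuous_within)
  then show ?thesis by (rule continuous_at_imp_continuous_on)
qed auto

lemma Ck_on_SucD: "Ck_on (Suc k) f S \<Longrightarrow> Ck_on k f S"
proof (induction k arbitrary: f)
  case 0 then show ?case using Ck_on_imp_continuous[OF 0] by simp
next
  case (Suc k) then show ?case by (metis Ck_on.simps(2))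
qed

lemma Ck_on_mono: "Ck_on k f S \<Longrightarrow> j \<le> k \<Longrightarrow> Ck_on j f S"
  by (induction k) (use Ck_on_SucD le_Suc_eq in \<open>blast+\<close>)

text \<open>The closure properties below climb one order through this rule: an explicit
  \<open>f'\<close> stands in for the choice operator \<open>frechet_derivative\<close>. Openness of
  \<open>S\<close> allows the exchange under \<open>Ck_on\<close>.\<close>

lemma Ck_on_SucI:
  assumes "open S" "\<And>x. x \<in> S \<Longrightarrow> (f has_derivative f' x) (at x)" "\<And>v. Ck_on k (\<lambda>x. f' x v) S"
  shows "Ck_on (Suc k) f S"
proof -
  have "Ck_on k (\<lambda>x. frechet_derivative f (at x) v) S" for v
    using assms(3)[of v] Ck_on_cong[OF assms(1), of "\<lambda>x. frechet_derivative f (at x) v" "\<lambda>x. f' x v"]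
      frechet_derivative_at[OF assms(2)] by metis
  then show ?thesis using assms(2) by (auto simp: differentiable_def)
qed

lemma Ck_on_has_derivative:
  "Ck_on (Suc k) f S \<Longrightarrow> x \<in> S \<Longrightarrow> (f has_derivative frechet_derivative f (at x)) (at x)"
  by (simp add: frechet_derivative_works)

lemma Ck_on_const: "open S \<Longrightarrow> Ck_on k (\<lambda>x. c) S"
proof (induction k arbitrary: c)
  case (Suc k)
  show ?case by (rule Ck_on_SucI[where f'="\<lambda>x v. 0"]) (use Suc in auto)
qed auto

lemma Ck_on_bounded_linear_compose:
  assumes "open S" "bounded_linear h"
  shows "Ck_on k f S \<Longrightarrow> Ck_on k (\<lambda>x. h (f x)) S"
proof (induction k arbitrary: f)
  case 0 then show ?case using assms by (auto intro: bounded_linear.continuous_on)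
next
  case (Suc k)
  show ?case
    by (rule Ck_on_SucI[where f'="\<lambda>x v. h (frechet_derivative f (at x) v)"])
      (use Suc assms in \<open>auto intro!: bounded_linear.has_derivative[OF assms(2)] simp: frechet_derivative_works\<close>)
qed

lemma Ck_on_bounded_linear:
  assumes "open S" "bounded_linear h" shows "Ck_on k h S"
proof (cases k)
  case 0 then show ?thesis using assms linear_continuous_on by auto
next
  case (Suc j)
  show ?thesis unfolding Suc
    by (rule Ck_on_SucI[where f'="\<lambda>x. h"])
     (use assms Ck_on_const bounded_linear_imp_has_derivative in auto)
qed

lemma Ck_on_add:
  assumes "open S"
  shows "Ck_on k f S \<Longrightarrow> Ck_on k g S \<Longrightarrow> Ck_on k (\<lambda>x. f x + g x) S"
proof (induction k arbitrary: f g)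
  case 0 then show ?case by (auto intro: continuous_intros)
next
  case (Suc k)
  show ?case
    by (rule Ck_on_SucI[where f'="\<lambda>x v. frechet_derivative f (at x) v + frechet_derivative g (at x) v"])
      (use Suc assms in \<open>auto intro!: has_derivative_add simp: frechet_derivative_works\<close>)
qed

lemma Ck_on_sum:
  assumes "open S"
  shows "(\<And>i. i \<in> I \<Longrightarrow> Ck_on k (f i) S) \<Longrightarrow> Ck_on k (\<lambda>x. \<Sum>i\<in>I. f i x) S"
proof (induction I rule: infinite_finite_induct)
  case (insert i I)
  then show ?case using Ck_on_add[OF assms, of k "f i" "\<lambda>x. \<Sum>i\<in>I. f i x"] by simp
qed (auto intro: Ck_on_const assms)

lemma Ck_on_scaleR:
  assumes "open S"
  shows "Ck_on k f S \<Longrightarrow> Ck_on k g S \<Longrightarrow> Ck_on k (\<lambda>x. f x *\<^sub>R g x) S"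
proof (induction k arbitrary: f g)
  case 0 then show ?case by (auto intro: continuous_intros)
next
  case (Suc k)
  show ?case
  proof (rule Ck_on_SucI[where f'="\<lambda>x v. f x *\<^sub>R frechet_derivative g (at x) v + frechet_derivative f (at x) v *\<^sub>R g x"])
    fix x assume "x \<in> S"
    then show "((\<lambda>x. f x *\<^sub>R g x) has_derivative
       (\<lambda>v. f x *\<^sub>R frechet_derivative g (at x) v + frechet_derivative f (at x) v *\<^sub>R g x)) (at x)"
      using Suc.prems by (intro has_derivative_scaleR Ck_on_has_derivative)
  next
    fix v
    show "Ck_on k (\<lambda>x. f x *\<^sub>R frechet_derivative g (at x) v + frechet_derivative f (at x) v *\<^sub>R g x) S"
      using Suc.prems Ck_on_SucD[OF Suc.prems(1)] Ck_on_SucD[OF Suc.prems(2)]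
      by (intro Ck_on_add assms Suc.IH) auto
  qed (rule assms)
qed

text \<open>\<open>Ck_on\<close> controls derivatives in fixed directions only. The expansion
  reduces a direction that varies with the point to finitely many partial derivatives.\<close>

lemma frechet_derivative_basis_expansion:
  fixes f :: "'e::euclidean_space \<Rightarrow> 'f::real_normed_vector"
  assumes "f differentiable (at x)"
  shows "frechet_derivative f (at x) w = (\<Sum>b\<in>Basis. (w \<bullet> b) *\<^sub>R frechet_derivative f (at x) b)"
proof -
  have "linear (frechet_derivative f (at x))"
    using assms by (simp add: linear_frechet_derivative)
  then have "frechet_derivative f (at x) (\<Sum>b\<in>Basis. (w \<bullet> b) *\<^sub>R b)
      = (\<Sum>b\<in>Basis. (w \<bullet> b) *\<^sub>R frechet_derivative f (at x) b)"
    by (simp add: linear_sum linear_cmul)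
  then show ?thesis by (simp add: euclidean_representation)
qed

text \<open>The chain rule differentiates \<open>f\<close> at \<open>g x\<close> in a direction that
  moves with \<open>x\<close>. Expanded in a basis, this is a sum of components of the derivative of
  \<open>g\<close> times partial derivatives of \<open>f\<close> composed with the same
  \<open>g\<close>, so the induction generalises over \<open>f\<close> alone.\<close>

lemma Ck_on_compose:
  fixes g :: "'a::real_normed_vector \<Rightarrow> 'b::euclidean_space" and f :: "'b \<Rightarrow> 'c::real_normed_vector"
  assumes "open S"
  shows "Ck_on k f T \<Longrightarrow> Ck_on k g S \<Longrightarrow> g ` S \<subseteq> T \<Longrightarrow> Ck_on k (\<lambda>x. f (g x)) S"
proof (induction k arbitrary: f)
  case 0 then show ?case by (auto intro: continuous_on_compose2)
next
  case (Suc k)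
  let ?D = "\<lambda>x v. \<Sum>b\<in>Basis. (frechet_derivative g (at x) v \<bullet> b) *\<^sub>R frechet_derivative f (at (g x)) b"
  show ?case
  proof (rule Ck_on_SucI[where f'="?D"])
    fix x assume x: "x \<in> S"
    then have gx: "g x \<in> T" using Suc.prems by auto
    have "((f \<circ> g) has_derivative (frechet_derivative f (at (g x)) \<circ> frechet_derivative g (at x))) (at x)"
      by (rule diff_chain_at) (use x gx Suc.prems Ck_on_has_derivative in blast)+
    moreover have "frechet_derivative f (at (g x)) \<circ> frechet_derivative g (at x) = ?D x"
    proof
      fix v
      have "f differentiable (at (g x))" using Suc.prems gx by auto
      from frechet_derivative_basis_expansion[OF this, of "frechet_derivative g (at x) v"]
      show "(frechet_derivative f (at (g x)) \<circ> frechet_derivative g (at x)) v = ?D x v" by simp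
    qed
    ultimately show "((\<lambda>x. f (g x)) has_derivative ?D x) (at x)" by (simp add: o_def)
  next
    fix v
    have "Ck_on k g S" using Suc.prems Ck_on_SucD by blast
    then show "Ck_on k (\<lambda>x. ?D x v) S"
      using Suc.prems
      by (intro Ck_on_sum Ck_on_scaleR assms Suc.IH
        Ck_on_bounded_linear_compose[OF assms bounded_linear_inner_left]) auto
  qed (rule assms)
qed

lemma Ck_on_inverse: "Ck_on k (inverse :: real \<Rightarrow> real) (-{0})"
proof (induction k)
  case 0 then show ?case by (auto intro!: continuous_intros)
next
  case (Suc k)
  have o: "open (-{0::real})" by (rule open_Compl) simp
  show ?case
  proof (rule Ck_on_SucI[where f'="\<lambda>x v. - (inverse x *\<^sub>R (inverse x *\<^sub>R v))"])
    fix v :: real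
    show "Ck_on k (\<lambda>x. - (inverse x *\<^sub>R inverse x *\<^sub>R v)) (- {0})"
      by (intro Ck_on_bounded_linear_compose[OF o bounded_linear_minus[OF bounded_linear_ident]]
          Ck_on_scaleR o Suc Ck_on_const)
  qed (use o in \<open>auto intro!: derivative_eq_intros simp: fun_eq_iff\<close>)
qed

text \<open>Finitely many partial derivatives, each bounded on the compact set, give a uniform
  operator bound. The constant is made strictly positive because it becomes a factor of the length
  \<open>l > 0\<close> in \<open>negligible_image_zero_set\<close>.\<close>

lemma Ck_on_bounded_derivative:
  fixes f :: "'e::euclidean_space \<Rightarrow> 'f::real_normed_vector"
  assumes "Ck_on 1 f S" "compact Q" "Q \<subseteq> S"
  obtains K where "K > 0" "\<And>x v. x \<in> Q \<Longrightarrow> norm (frechet_derivative f (at x) v) \<le> K * norm v"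
proof -
  have "\<exists>K. \<forall>x\<in>Q. norm (frechet_derivative f (at x) b) \<le> K" for b
  proof -
    have "continuous_on Q (\<lambda>x. frechet_derivative f (at x) b)"
      using assms by (auto intro: continuous_on_subset simp: One_nat_def)
    then have "bounded ((\<lambda>x. frechet_derivative f (at x) b) ` Q)"
      by (intro compact_imp_bounded compact_continuous_image assms)
    then show ?thesis by (auto simp: bounded_iff)
  qed
  then obtain K where K: "\<And>b x. x \<in> Q \<Longrightarrow> norm (frechet_derivative f (at x) b) \<le> K b" by metis
  show ?thesis
  proof
    show "(\<Sum>b\<in>Basis. \<bar>K b\<bar>) + 1 > 0" by (simp add: add_nonneg_pos sum_nonneg)
    fix x v assume x: "x \<in> Q"
    have "f differentiable (at x)" using assms x by (auto simp: One_nat_def)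
    then have "norm (frechet_derivative f (at x) v)
        = norm (\<Sum>b\<in>Basis. (v \<bullet> b) *\<^sub>R frechet_derivative f (at x) b)"
      using frechet_derivative_basis_expansion by metis
    also have "\<dots> \<le> (\<Sum>b\<in>Basis. norm v * \<bar>K b\<bar>)"
    proof (rule sum_norm_le)
      fix b :: 'e assume b: "b \<in> Basis"
      have "\<bar>v \<bullet> b\<bar> \<le> norm v" using Basis_le_norm[OF b] by simp
      moreover have "norm (frechet_derivative f (at x) b) \<le> \<bar>K b\<bar>" using K[OF x, of b] by linarith
      ultimately show "norm ((v \<bullet> b) *\<^sub>R frechet_derivative f (at x) b) \<le> norm v * \<bar>K b\<bar>"
        by (simp add: mult_mono)
    qed
    also have "\<dots> \<le> ((\<Sum>b\<in>Basis. \<bar>K b\<bar>) + 1) * norm v"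
      by (simp add: sum_distrib_left[symmetric] algebra_simps)
    finally show "norm (frechet_derivative f (at x) v) \<le> ((\<Sum>b\<in>Basis. \<bar>K b\<bar>) + 1) * norm v" .
  qed
qed

lemma has_real_derivative_ray:
  fixes w :: "'e::real_normed_vector" and f :: "'e \<Rightarrow> real"
  assumes "(f has_derivative D) (at (s *\<^sub>R w))"
  shows "((\<lambda>s. f (s *\<^sub>R w)) has_real_derivative D w) (at s)"
proof -
  have "((\<lambda>s. s *\<^sub>R w) has_derivative (\<lambda>t. t *\<^sub>R w)) (at s)" by (auto intro!: derivative_eq_intros)
  from diff_chain_at[OF this assms] have "((\<lambda>s. f (s *\<^sub>R w)) has_derivative (\<lambda>t. D (t *\<^sub>R w))) (at s)"
    by (simp add: o_def)
  moreover have "D (t *\<^sub>R w) = D w * t" for t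
    using has_derivative_linear[OF assms] by (simp add: linear_cmul)
  ultimately show ?thesis by (simp add: has_field_derivative_def)
qed

text \<open>Squaring the positive part removes its corner at 0. The bump function in
  \<open>action_loop_ge\<close> owes its differentiability across the boundary of its support to
  this.\<close>

lemma has_real_derivative_pos_part_square:
  "((\<lambda>t::real. (max 0 t)\<^sup>2) has_real_derivative 2 * max 0 t) (at t)"
proof (cases "t = 0")
  case False
  show ?thesis
  proof (cases "t > 0")
    case True
    have "((\<lambda>t. t\<^sup>2) has_real_derivative 2 * max 0 t) (at t)"
      using True by (auto intro!: derivative_eq_intros)
    then show ?thesis
      by (rule has_field_derivative_transform_within_open[of _ _ _ "{0<..}"]) (use True in auto)
  next
    case False
    then have "t < 0" using \<open>t \<noteq> 0\<close> by simp
    have "((\<lambda>t. 0) has_real_derivative 2 * max 0 t) (at t)" using \<open>t < 0\<close> by simp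
    then show ?thesis
      by (rule has_field_derivative_transform_within_open[of _ _ _ "{..<0}"]) (use \<open>t < 0\<close> in auto)
  qed
next
  case True
  have "((\<lambda>h. (max 0 h)\<^sup>2 / h) \<longlongrightarrow> 0) (at (0::real))"
  proof (rule Lim_null_comparison)
    show "\<forall>\<^sub>F h in at 0. norm ((max 0 h)\<^sup>2 / h) \<le> \<bar>h\<bar>"
      by (intro always_eventually allI) (auto simp: max_def power2_eq_square)
    show "((\<lambda>h::real. \<bar>h\<bar>) \<longlongrightarrow> 0) (at 0)" by (auto intro!: tendsto_eq_intros)
  qed
  then show ?thesis using True by (simp add: DERIV_def)
qed

text \<open>The map \<open>\<Phi>\<close> replaces the \<open>b\<close>-coordinate by \<open>f\<close>; it flattens the zero set of \<open>f\<close> to the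
  hyperplane \<open>x \<bullet> b = 0\<close>.\<close>

lemma straightening:
  fixes f :: "'e::euclidean_space \<Rightarrow> real"
  defines "\<Phi> \<equiv> \<lambda>x b. x + (f x - x \<bullet> b) *\<^sub>R b"
  assumes \<Omega>: "open \<Omega>" and f: "Ck_on (Suc r) f \<Omega>" and b: "b \<in> Basis" and x0: "x0 \<in> \<Omega>"
    and nz: "frechet_derivative f (at x0) b \<noteq> 0"
  obtains N N' G where "open N" "x0 \<in> N" "N \<subseteq> \<Omega>" "open N'"
    "homeomorphism N N' (\<lambda>x. \<Phi> x b) G" "Ck_on (Suc r) G N'"
proof -
  define F where "F v x = frechet_derivative f (at x) v" for v x
  define U where "U = {x \<in> \<Omega>. F b x \<noteq> 0}"
  have cF: "continuous_on \<Omega> (F v)" for v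
    using f Ck_on_imp_continuous unfolding F_def by (metis Ck_on.simps(2))
  have U: "open U" "x0 \<in> U" "U \<subseteq> \<Omega>"
    using x0 nz continuous_open_preimage[OF cF[of b] \<Omega>, of "-{0}"] 
    by (auto simp: U_def F_def vimage_def Int_def)
  have df: "(f has_derivative (\<lambda>v. F v x)) (at x)" if "x \<in> U" for x
    using Ck_on_has_derivative[OF f] U that unfolding F_def by blast
  have lin: "linear (\<lambda>v. F v x)" if "x \<in> U" for x
    using df[OF that] has_derivative_linear by blast
  define D where "D x = (\<lambda>v. v + (F v x - v \<bullet> b) *\<^sub>R b)" for x
  have dD: "((\<lambda>x. \<Phi> x b) has_derivative D x) (at x)" if "x \<in> U" for x
    unfolding \<Phi>_def D_def by (rule derivative_eq_intros df[OF that] refl | simp)+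
  have bD: "bounded_linear (D x)" if "x \<in> U" for x using dD[OF that] has_derivative_bounded_linear by blast
  define D' where "D' x = Blinfun (D x)" for x
  have D': "blinfun_apply (D' x) = D x" if "x \<in> U" for x
    using bD[OF that] by (simp add: D'_def bounded_linear_Blinfun_apply)
  \<comment> \<open>The explicit inverse of \<open>D x\<close>, which replaces the
    \<open>b\<close>-coordinate of \<open>v\<close> by \<open>F v x\<close>. The multiple of
    \<open>b\<close> is chosen so that \<open>F (I x v) x = v \<bullet> b\<close>.\<close>
  define I where "I x = (\<lambda>v. v + ((v \<bullet> b - F v x) / F b x) *\<^sub>R b)" for x
  have Fs: "F (v + m *\<^sub>R b) x = F v x + m * F b x" if "x \<in> U" for v m x
    using linear_add[OF lin[OF that], of v "m *\<^sub>R b"] linear_cmul[OF lin[OF that], of m b] by simp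
  have DI: "D x (I x v) = v" if "x \<in> U" for x v
  proof -
    have "F b x \<noteq> 0" using that by (simp add: U_def)
    then show ?thesis using b
      by (simp add: D_def I_def Fs[OF that] algebra_simps) (simp add: field_simps flip: scaleR_add_left scaleR_diff_left)
  qed
  have ID: "I x (D x v) = v" if "x \<in> U" for x v
  proof -
    define m where "m = F v x - v \<bullet> b"
    have "F b x \<noteq> 0" using that by (simp add: U_def)
    moreover have "D x v = v + m *\<^sub>R b" by (simp add: D_def m_def)
    moreover have "(v + m *\<^sub>R b) \<bullet> b - F (v + m *\<^sub>R b) x = - (m * F b x)"
      using b by (simp add: Fs[OF that] inner_add_left) (simp add: m_def)
    ultimately show ?thesis by (simp add: I_def)
  qed
  have bI: "bounded_linear (I x0)"
  proof -
    have "bounded_linear (\<lambda>v. F v x0)" using df[OF U(2)] has_derivative_bounded_linear by blast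
    then show ?thesis unfolding I_def
      by (intro bounded_linear_add bounded_linear_ident bounded_linear_scaleR_const 
           bounded_linear_divide[THEN bounded_linear_compose, unfolded o_def] 
           bounded_linear_sub bounded_linear_inner_left)
  qed
  have inv0: "Blinfun (I x0) o\<^sub>L D' x0 = id_blinfun"
    by (rule blinfun_eqI) (simp add: bounded_linear_Blinfun_apply[OF bI] D'[OF U(2)] ID[OF U(2)])
  have cD': "continuous_on U D'"
  proof (rule continuous_on_blinfun_componentwise)
    fix i :: 'e
    have "continuous_on U (\<lambda>x. D x i)" unfolding D_def
      by (intro continuous_intros continuous_on_subset[OF cF]) (use U in auto)
    then show "continuous_on U (\<lambda>x. blinfun_apply (D' x) i)"
      by (rule continuous_on_eq) (simp add: D')
  qed
  obtain N V g g' where N: "open N" "N \<subseteq> U" "x0 \<in> N" "open V" "homeomorphism N V (\<lambda>x. \<Phi> x b) g"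
    and dg: "\<And>y. y \<in> V \<Longrightarrow> (g has_derivative (g' y)) (at y)"
    and g': "\<And>y. y \<in> V \<Longrightarrow> g' y = inv (blinfun_apply (D' (g y)))"
    using inverse_function_theorem[of U "\<lambda>x. \<Phi> x b" D' x0 "Blinfun (I x0)"] U dD D' cD' inv0 by metis
  have gV: "g y \<in> U" if "y \<in> V" for y using N that by (auto simp: homeomorphism_def)
  have g'I: "g' y = I (g y)" if "y \<in> V" for y
    unfolding g'[OF that] D'[OF gV[OF that]]
    by (rule inv_unique_comp) (use DI ID gV[OF that] in \<open>auto simp: fun_eq_iff\<close>)
  \<comment> \<open>Bootstrapping: the derivative of \<open>g\<close> is \<open>I (g y)\<close>, a
    rational expression in the first partial derivatives of \<open>f\<close> at \<open>g y\<close>.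
    Those are C^r, so as long as k does not exceed r, C^k regularity of \<open>g\<close> passes to
    its derivative; \<open>g\<close> ends with the full order of \<open>f\<close>.\<close>
  have "Ck_on k g V" if "k \<le> Suc r" for k
    using that
  proof (induction k)
    case 0 then show ?case using N by (simp add: homeomorphism_def)
  next
    case (Suc k)
    have Fk: "Ck_on k (\<lambda>y. F v (g y)) V" for v
    proof (rule Ck_on_compose[where f="F v" and g=g and T=U, OF N(4)])
      have "Ck_on r (F v) \<Omega>" using f by (simp add: F_def[abs_def])
      then have "Ck_on r (F v) U" using U(3) by (rule Ck_on_subset)
      then show "Ck_on k (F v) U" using Suc.prems by (auto intro: Ck_on_mono)
      show "Ck_on k g V" using Suc by simp
      show "g ` V \<subseteq> U" using gV by auto
    qed
    show ?case
    proof (rule Ck_on_SucI[where f'="\<lambda>y. I (g y)"])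
      fix v
      have *: "I (g y) v = v + ((v \<bullet> b) *\<^sub>R inverse (F b (g y))) *\<^sub>R b
           + (((-1) *\<^sub>R F v (g y)) *\<^sub>R inverse (F b (g y))) *\<^sub>R b" for y
        by (simp add: I_def divide_inverse algebra_simps)
      have "Ck_on k (\<lambda>y. inverse (F b (g y))) V"
        by (rule Ck_on_compose[OF N(4) Ck_on_inverse Fk]) (use gV in \<open>auto simp: U_def\<close>)
      then show "Ck_on k (\<lambda>y. I (g y) v) V" unfolding *
        by (intro Ck_on_add Ck_on_scaleR Ck_on_const N(4) Fk)
    qed (use N dg g'I in auto)
  qed
  then have "Ck_on (Suc r) g V" by blast
  then show ?thesis using N U by (intro that[of N V g]) (auto simp del: Ck_on.simps)
qed

section \<open>A Sard-type lemma\<close>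

text \<open>The balls of radius \<open>\<eta> / 2\<close> about the points of \<open>F\<close> are
  disjoint and, as \<open>\<eta> \<le> 1\<close>, lie in the ball of radius \<open>R + 1\<close>.
  When volumes are compared, \<open>unit_ball_vol\<close> cancels.\<close>

lemma card_separated_le:
  fixes F :: "'e::euclidean_space set"
  assumes "finite F" "F \<subseteq> ball 0 R" "0 < \<eta>" "\<eta> \<le> 1"
    and "0 < R" and sep: "\<And>x y. x \<in> F \<Longrightarrow> y \<in> F \<Longrightarrow> x \<noteq> y \<Longrightarrow> \<eta> \<le> dist x y"
  shows "card F * (\<eta> / 2) ^ DIM('e) \<le> (R + 1) ^ DIM('e)"
proof (cases "F = {}")
  case False
  have R: "R > 0" by fact
  let ?\<omega> = "unit_ball_vol (real DIM('e))"
  have dj: "disjnt (ball x (\<eta>/2)) (ball y (\<eta>/2))" if "x \<in> F" "y \<in> F" "x \<noteq> y" for x y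
  proof -
    have "False" if "dist x z < \<eta>/2" "dist y z < \<eta>/2" for z
      using sep[OF \<open>x \<in> F\<close> \<open>y \<in> F\<close> \<open>x \<noteq> y\<close>] dist_triangle2[of x y z] that by linarith
    then show ?thesis by (auto simp: disjnt_iff)
  qed
  have "measure lebesgue (\<Union>x\<in>F. ball x (\<eta>/2)) = (\<Sum>x\<in>F. measure lebesgue (ball x (\<eta>/2)))"
    by (rule measure_UNION') (use assms dj in \<open>auto simp: pairwise_def\<close>)
  also have "\<dots> = card F * (?\<omega> * (\<eta>/2) ^ DIM('e))" using assms by (simp add: content_ball)
  finally have m: "measure lebesgue (\<Union>x\<in>F. ball x (\<eta>/2)) = card F * (?\<omega> * (\<eta>/2) ^ DIM('e))" .
  have "(\<Union>x\<in>F. ball x (\<eta>/2)) \<subseteq> ball 0 (R+1)"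
  proof
    fix z assume "z \<in> (\<Union>x\<in>F. ball x (\<eta>/2))"
    then obtain x where x: "x \<in> F" "dist x z < \<eta>/2" by auto
    have "norm x < R" using x assms(2) by auto
    then have "norm z < R + 1" using x(2) \<open>\<eta> \<le> 1\<close> norm_triangle_sub[of z x] by (simp add: dist_norm norm_minus_commute)
    then show "z \<in> ball 0 (R+1)" by simp
  qed
  then have "measure lebesgue (\<Union>x\<in>F. ball x (\<eta>/2)) \<le> measure lebesgue (ball (0::'e) (R+1))"
    by (rule measure_mono_fmeasurable) (use assms in \<open>auto intro!: sets.finite_UN\<close>)
  also have "\<dots> = ?\<omega> * (R+1) ^ DIM('e)" using R by (simp add: content_ball)
  finally have "?\<omega> * (card F * (\<eta>/2) ^ DIM('e)) \<le> ?\<omega> * (R+1) ^ DIM('e)"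
    unfolding m by (simp add: algebra_simps)
  moreover have "?\<omega> > 0" by simp
  ultimately show ?thesis by (metis mult_le_cancel_left_pos)
qed (use assms in \<open>auto intro!: zero_le_power\<close>)

text \<open>The volume bound caps the cardinality of separated subsets, so one of maximal
  cardinality exists; maximality forces every point of \<open>X\<close> to be closer than
  \<open>\<eta>\<close> to it.\<close>

lemma finite_separated_net:
  fixes X :: "'e::euclidean_space set"
  assumes "X \<subseteq> ball 0 R" "0 < \<eta>" "\<eta> \<le> 1" "R > 0"
  obtains F where "finite F" "F \<subseteq> X" "card F * (\<eta> / 2) ^ DIM('e) \<le> (R + 1) ^ DIM('e)"
    "\<And>x. x \<in> X \<Longrightarrow> \<exists>y\<in>F. dist x y < \<eta>"
proof -
  define P where "P F \<longleftrightarrow> finite F \<and> F \<subseteq> X \<and> (\<forall>x\<in>F. \<forall>y\<in>F. x \<noteq> y \<longrightarrow> \<eta> \<le> dist x y)" for F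
  have b: "card F * (\<eta> / 2) ^ DIM('e) \<le> (R + 1) ^ DIM('e)" if "P F" for F
    by (rule card_separated_le) (use that assms in \<open>auto simp: P_def\<close>)
  define N where "N = nat \<lceil>(R + 1) ^ DIM('e) / (\<eta> / 2) ^ DIM('e)\<rceil>"
  have "card F \<le> N" if "P F" for F
  proof -
    have "real (card F) \<le> (R + 1) ^ DIM('e) / (\<eta> / 2) ^ DIM('e)"
      using b[OF that] assms by (simp add: pos_le_divide_eq)
    then show ?thesis unfolding N_def by linarith
  qed
  moreover have "P {}" by (simp add: P_def)
  ultimately obtain F where F: "P F" "\<And>G. P G \<Longrightarrow> card G \<le> card F"
    using ex_has_greatest_nat[of P "{}" card "Suc N"] by (auto simp: less_Suc_eq_le)
  have "\<exists>y\<in>F. dist x y < \<eta>" if x: "x \<in> X" for x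
  proof (rule ccontr)
    assume c: "\<not> ?thesis"
    then have "x \<notin> F" using assms by force
    moreover have "P (insert x F)" using c F(1) x unfolding P_def by (auto simp: dist_commute not_less)
    ultimately show False using F(1) F(2)[of "insert x F"] by (simp add: P_def)
  qed
  then show ?thesis using F(1) b[OF F(1)] that by (auto simp: P_def)
qed

text \<open>A net of mesh \<eta> has at most a constant times \<eta>^(-d) points, and near each of
  them the image lies in an interval of length 2 \<epsilon> \<eta>^d. The powers of \<eta> cancel
  and a constant times \<epsilon> remains.\<close>

lemma flat_image_negligible:
  fixes v :: "'e::euclidean_space \<Rightarrow> real"
  assumes "bounded X"
    and flat: "\<And>\<epsilon>. \<epsilon> > 0 \<Longrightarrow> \<exists>\<delta>>0. \<forall>x\<in>X. \<forall>y\<in>X. dist x y < \<delta> \<longrightarrow> \<bar>v x - v y\<bar> \<le> \<epsilon> * dist x y ^ DIM('e)"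
  shows "negligible (v ` X)"
  unfolding negligible_outer
proof (intro allI impI)
  fix e :: real assume e: "e > 0"
  obtain R where R: "R > 0" "X \<subseteq> ball 0 R" using assms(1) bounded_subset_ballD by blast
  \<comment> \<open>Chosen so that the final bound
    \<open>2 * \<epsilon> * (2 * (R+1)) ^ DIM('e)\<close> equals \<open>e / 2\<close>.\<close>
  define \<epsilon> where "\<epsilon> = e / (4 * (2 * (R+1)) ^ DIM('e))"
  have \<epsilon>: "\<epsilon> > 0" using e R by (simp add: \<epsilon>_def)
  then obtain \<delta> where \<delta>: "\<delta> > 0" "\<And>x y. x \<in> X \<Longrightarrow> y \<in> X \<Longrightarrow> dist x y < \<delta> \<Longrightarrow> \<bar>v x - v y\<bar> \<le> \<epsilon> * dist x y ^ DIM('e)"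
    using flat by metis
  define \<eta> where "\<eta> = min \<delta> 1"
  have \<eta>: "0 < \<eta>" "\<eta> \<le> 1" "\<eta> \<le> \<delta>" using \<delta> by (auto simp: \<eta>_def)
  obtain F where F: "finite F" "F \<subseteq> X" "card F * (\<eta> / 2) ^ DIM('e) \<le> (R + 1) ^ DIM('e)"
    "\<And>x. x \<in> X \<Longrightarrow> \<exists>y\<in>F. dist x y < \<eta>"
    using finite_separated_net[OF R(2) \<eta>(1,2) R(1)] by blast
  let ?T = "\<Union>y\<in>F. cball (v y) (\<epsilon> * \<eta> ^ DIM('e))"
  have "measure lebesgue ?T \<le> (\<Sum>y\<in>F. measure lebesgue (cball (v y) (\<epsilon> * \<eta> ^ DIM('e))))"
    by (rule measure_UNION_le) (use F in auto)
  also have "\<dots> = card F * (2 * (\<epsilon> * \<eta> ^ DIM('e)))"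
    using \<epsilon> \<eta> by (simp add: cball_eq_atLeastAtMost)
  also have "\<dots> = (2 * \<epsilon> * 2 ^ DIM('e)) * (card F * (\<eta> / 2) ^ DIM('e))"
    by (simp add: power_divide field_simps)
  also have "\<dots> \<le> (2 * \<epsilon> * 2 ^ DIM('e)) * (R+1) ^ DIM('e)"
    using F(3) \<epsilon> by (intro mult_left_mono) auto
  also have "\<dots> = 2 * \<epsilon> * (2 * (R+1)) ^ DIM('e)" by (simp only: power_mult_distrib mult.assoc)
  also have "\<dots> = e / 2" using R by (simp add: \<epsilon>_def)
  also have "\<dots> < e" using e by simp
  finally have "measure lebesgue ?T < e" .
  moreover have "v ` X \<subseteq> ?T"
  proof clarify
    fix x assume x: "x \<in> X"
    then obtain y where y: "y \<in> F" "dist x y < \<eta>" using F by blast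
    have "\<bar>v x - v y\<bar> \<le> \<epsilon> * dist x y ^ DIM('e)" using y x F \<eta> by (intro \<delta>) auto
    also have "\<dots> \<le> \<epsilon> * \<eta> ^ DIM('e)" using \<epsilon> y by (intro mult_left_mono power_mono) auto
    finally show "v x \<in> ?T" using y by (auto simp: dist_real_def abs_minus_commute)
  qed
  moreover have "?T \<in> lmeasurable" using F by (intro fmeasurable.finite_UN) auto
  ultimately show "\<exists>T. v ` X \<subseteq> T \<and> T \<in> lmeasurable \<and> measure lebesgue T < e" by blast
qed

text \<open>Coordinate subspaces carry the induction on the dimension: the ambient type stays fixed
  and only the set \<open>B\<close> of free directions shrinks, starting from \<open>Basis\<close>,
  the whole space.\<close>

definition coord_space :: "'e::euclidean_space set \<Rightarrow> 'e set" where
  "coord_space B = {x. \<forall>b\<in>Basis - B. x \<bullet> b = 0}"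

lemma convex_coord_space: "convex (coord_space B)"
  by (auto simp: convex_def coord_space_def inner_add_left)

text \<open>A piece \<open>Y\<close> of \<open>Z\<close> as in A. P. Morse's vanishing lemma, with \<open>o\<close> in place of \<open>O\<close>.
  Only \<open>\<psi>\<close> of class \<open>C\<^sup>1\<close> is retained, as the induction below never differentiates \<open>f \<circ> \<psi>\<close> more
  than once.\<close>

definition flat_patch ::
  "'e::euclidean_space set \<Rightarrow> nat \<Rightarrow> 'e set \<Rightarrow> 'e set \<Rightarrow> 'e set \<Rightarrow>
     ('e \<Rightarrow> 'e) \<Rightarrow> 'e set \<Rightarrow> 'e set \<Rightarrow> 'e set \<Rightarrow> real \<Rightarrow> bool" where
  "flat_patch B r \<Omega> Z Y \<psi> W V Q K \<longleftrightarrow> Y \<subseteq> Z \<and>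
     open W \<and> Ck_on 1 \<psi> W \<and> V \<subseteq> W \<and> convex V \<and> bounded V \<and> compact Q \<and> Q \<subseteq> \<Omega> \<and>
     \<psi> ` V \<subseteq> Q \<inter> coord_space B \<and> Y \<subseteq> \<psi> ` V \<and> 0 < K \<and>
     (\<forall>z\<in>V. \<forall>w. norm (frechet_derivative \<psi> (at z) w) \<le> K * norm w) \<and>
     (\<forall>f::'e\<Rightarrow>real. Ck_on r f \<Omega> \<longrightarrow> (\<forall>z\<in>Z. f z = 0) \<longrightarrow> (\<forall>\<epsilon>>0. \<exists>\<delta>>0. \<forall>x\<in>V. \<forall>y\<in>V.
        \<psi> x \<in> Y \<longrightarrow> dist x y < \<delta> \<longrightarrow> \<bar>f (\<psi> y)\<bar> \<le> \<epsilon> * dist x y ^ r))"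

definition flat_piece ::
  "'e::euclidean_space set \<Rightarrow> nat \<Rightarrow> 'e set \<Rightarrow> 'e set \<Rightarrow> 'e set \<Rightarrow> bool" where
  "flat_piece B r \<Omega> Z Y \<longleftrightarrow> (\<exists>\<psi> W V Q K. flat_patch B r \<Omega> Z Y \<psi> W V Q K)"

lemma flat_pieceI:
  fixes \<psi> :: "'e::euclidean_space \<Rightarrow> 'e"
  assumes "Y \<subseteq> Z" "open W" "Ck_on 1 \<psi> W" "V \<subseteq> W" "convex V" "bounded V" "compact Q" "Q \<subseteq> \<Omega>"
    "\<psi> ` V \<subseteq> Q \<inter> coord_space B" "Y \<subseteq> \<psi> ` V" "0 < K"
    "\<And>z w. z \<in> V \<Longrightarrow> norm (frechet_derivative \<psi> (at z) w) \<le> K * norm w"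
    "\<And>(f :: _ \<Rightarrow> real) \<epsilon>. Ck_on r f \<Omega> \<Longrightarrow> (\<forall>z\<in>Z. f z = 0) \<Longrightarrow> \<epsilon> > 0 \<Longrightarrow> \<exists>\<delta>>0. \<forall>x\<in>V. \<forall>y\<in>V.
        \<psi> x \<in> Y \<longrightarrow> dist x y < \<delta> \<longrightarrow> \<bar>f (\<psi> y)\<bar> \<le> \<epsilon> * dist x y ^ r"
  shows "flat_piece B r \<Omega> Z Y"
proof -
  have "flat_patch B r \<Omega> Z Y \<psi> W V Q K"
    unfolding flat_patch_def using assms(12,13) by (intro conjI assms(1-11)) blast+
  then show ?thesis unfolding flat_piece_def by blast
qed

lemma flat_patchD:
  assumes "flat_patch B r \<Omega> Z Y \<psi> W V Q K"
  shows "Y \<subseteq> Z" "open W" "Ck_on 1 \<psi> W" "V \<subseteq> W" "convex V" "bounded V" "compact Q" "Q \<subseteq> \<Omega>"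
    "\<psi> ` V \<subseteq> Q \<inter> coord_space B" "Y \<subseteq> \<psi> ` V" "0 < K"
    "z \<in> V \<Longrightarrow> norm (frechet_derivative \<psi> (at z) w) \<le> K * norm w"
    "Ck_on r f \<Omega> \<Longrightarrow> (\<forall>z\<in>Z. f z = 0) \<Longrightarrow> \<epsilon> > 0 \<Longrightarrow> \<exists>\<delta>>0. \<forall>x\<in>V. \<forall>y\<in>V.
        \<psi> x \<in> Y \<longrightarrow> dist x y < \<delta> \<longrightarrow> \<bar>f (\<psi> y)\<bar> \<le> \<epsilon> * dist x y ^ r"
  using assms unfolding flat_patch_def by simp_all

text \<open>A test function for \<open>\<Omega>\<close> and \<open>Z'\<close> is also one for
  \<open>N\<close> and \<open>Z\<close>, so pieces found for a localised zero set remain pieces for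
  the whole one.\<close>

lemma flat_piece_mono:
  assumes "flat_piece B r N Z Y" "N \<subseteq> \<Omega>" "Z \<subseteq> Z'"
  shows "flat_piece B r \<Omega> Z' Y"
proof -
  obtain \<psi> W V Q K where P: "flat_patch B r N Z Y \<psi> W V Q K"
    using assms(1) unfolding flat_piece_def by blast
  show ?thesis
  proof (rule flat_pieceI[OF _ flat_patchD(2-7)[OF P] _ flat_patchD(9-12)[OF P]])
    fix f :: "'a \<Rightarrow> real" and \<epsilon> :: real
    assume f: "Ck_on r f \<Omega>" "\<forall>z\<in>Z'. f z = 0" and "\<epsilon> > 0"
    show "\<exists>\<delta>>0. \<forall>x\<in>V. \<forall>y\<in>V. \<psi> x \<in> Y \<longrightarrow> dist x y < \<delta> \<longrightarrow> \<bar>f (\<psi> y)\<bar> \<le> \<epsilon> * dist x y ^ r"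
      by (rule flat_patchD(13)[OF P Ck_on_subset[OF f(1) assms(2)] _ \<open>\<epsilon> > 0\<close>]) (use f(2) assms(3) in blast)
  qed (use flat_patchD(1,8)[OF P] assms in auto)
qed

text \<open>A Lindelof argument, which lets pieces be produced near one point at a time.\<close>

lemma countable_cover_locally:
  fixes Z :: "'e::second_countable_topology set"
  assumes "\<And>z. z \<in> Z \<Longrightarrow> \<exists>N \<Y>. open N \<and> z \<in> N \<and> countable \<Y> \<and> Z \<inter> N \<subseteq> \<Union>\<Y> \<and> (\<forall>Y\<in>\<Y>. P Y)"
  shows "\<exists>\<Y>. countable \<Y> \<and> Z \<subseteq> \<Union>\<Y> \<and> (\<forall>Y\<in>\<Y>. P Y)"
proof -
  obtain N \<Y> where N: "\<And>z. z \<in> Z \<Longrightarrow> open (N z) \<and> z \<in> N z \<and> countable (\<Y> z) \<and> Z \<inter> N z \<subseteq> \<Union>(\<Y> z) \<and> (\<forall>Y\<in>\<Y> z. P Y)"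
    using assms by metis
  obtain \<F> where \<F>: "\<F> \<subseteq> N ` Z" "countable \<F>" "\<Union>\<F> = \<Union>(N ` Z)"
    using Lindelof[of "N ` Z"] N by (metis imageE)
  obtain Z0 where Z0: "Z0 \<subseteq> Z" "countable Z0" "\<F> = N ` Z0"
    using countable_subset_image[of \<F> N Z] \<F> by auto
  show ?thesis
  proof (intro exI[of _ "\<Union>(\<Y> ` Z0)"] conjI ballI)
    show "countable (\<Union> (\<Y> ` Z0))" using Z0 N by blast
    show "Z \<subseteq> \<Union> (\<Union> (\<Y> ` Z0))"
    proof
      fix z assume z: "z \<in> Z"
      then have "z \<in> \<Union>(N ` Z)" using N by blast
      then have "z \<in> \<Union>(N ` Z0)" using \<F>(3) Z0(3) by simp
      then obtain z0 where "z0 \<in> Z0" "z \<in> N z0" by auto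
      then show "z \<in> \<Union> (\<Union> (\<Y> ` Z0))" using N[of z0] z Z0 by blast
    qed
  qed (use N Z0 in blast)
qed

text \<open>At order 0 flatness only asks that \<open>f\<close> be uniformly small near its zeros.
  The patch is the slice of a ball by the coordinate subspace, parametrised by the identity.\<close>

lemma flat_pieces_0:
  assumes "open \<Omega>" "Z \<subseteq> \<Omega> \<inter> coord_space B"
  shows "\<exists>\<Y>. countable \<Y> \<and> Z \<subseteq> \<Union>\<Y> \<and> (\<forall>Y\<in>\<Y>. flat_piece B 0 \<Omega> Z Y)"
proof (rule countable_cover_locally)
  fix z assume "z \<in> Z"
  then obtain \<rho> where \<rho>: "\<rho> > 0" "cball z \<rho> \<subseteq> \<Omega>" using assms open_contains_cball by blast
  let ?V = "ball z \<rho> \<inter> coord_space B" and ?Y = "Z \<inter> ball z \<rho>"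
  have "flat_piece B 0 \<Omega> Z ?Y"
  proof (rule flat_pieceI)
    show "Ck_on 1 (\<lambda>x. x) (UNIV::'a set)" by (rule Ck_on_bounded_linear) auto
    show "compact (cball z \<rho>)" "cball z \<rho> \<subseteq> \<Omega>" using \<rho> by auto
    show "(\<lambda>x. x) ` ?V \<subseteq> cball z \<rho> \<inter> coord_space B" by auto
    show "?Y \<subseteq> (\<lambda>x. x) ` ?V" using assms by auto
    show "convex ?V" by (intro convex_Int convex_coord_space) auto
    show "bounded ?V" by (simp add: bounded_Int)
    {
      fix f :: "'a \<Rightarrow> real" and \<epsilon> :: real
      assume f: "Ck_on 0 f \<Omega>" "\<forall>z\<in>Z. f z = 0" and \<epsilon>: "\<epsilon> > 0"
      have "uniformly_continuous_on (cball z \<rho>) f"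
        using f \<rho> by (intro compact_uniformly_continuous) (auto intro: continuous_on_subset)
      then obtain \<delta> where \<delta>: "\<delta> > 0" "\<And>x y. x \<in> cball z \<rho> \<Longrightarrow> y \<in> cball z \<rho> \<Longrightarrow> dist x y < \<delta> \<Longrightarrow> dist (f x) (f y) < \<epsilon>"
        using \<epsilon> unfolding uniformly_continuous_on_def by metis
      show "\<exists>\<delta>>0. \<forall>x\<in>?V. \<forall>y\<in>?V. x \<in> ?Y \<longrightarrow> dist x y < \<delta> \<longrightarrow> \<bar>f y\<bar> \<le> \<epsilon> * dist x y ^ 0"
      proof (intro exI conjI ballI impI)
        fix x y assume "x \<in> ?V" "y \<in> ?V" "x \<in> ?Y" "dist x y < \<delta>"
        then have "f x = 0" "dist (f x) (f y) < \<epsilon>" using f(2) \<delta>(2)[of x y] by auto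
        then show "\<bar>f y\<bar> \<le> \<epsilon> * dist x y ^ 0" by simp
      qed (rule \<delta>)
    }
    show "norm (frechet_derivative (\<lambda>x. x) (at z) w) \<le> 1 * norm w" for z w :: 'a
      by simp
  qed auto
  then show "\<exists>N \<Y>. open N \<and> z \<in> N \<and> countable \<Y> \<and> Z \<inter> N \<subseteq> \<Union>\<Y> \<and> (\<forall>Y\<in>\<Y>. flat_piece B 0 \<Omega> Z Y)"
    using \<rho> by (intro exI[of _ "ball z \<rho>"] exI[of _ "{?Y}"]) auto
qed

text \<open>The partial derivatives of \<open>f\<close> along \<open>B\<close> vanish on
  \<open>Z2\<close>, hence are flat of order \<open>r\<close> on the piece; the mean value theorem
  on a segment that starts over \<open>Y\<close> gains one factor of the distance. Two sets occur
  because \<open>f\<close> vanishes on \<open>Z\<close> but its derivatives only on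
  \<open>Z2\<close>.\<close>

lemma flat_piece_Suc:
  fixes B :: "'e::euclidean_space set"
  assumes \<Omega>: "open \<Omega>" and B: "B \<subseteq> Basis" and fp: "flat_piece B r \<Omega> Z2 Y" and Z2: "Z2 \<subseteq> Z"
    and crit: "\<And>(f::'e\<Rightarrow>real) z b. Ck_on (Suc r) f \<Omega> \<Longrightarrow> (\<forall>z\<in>Z. f z = 0) \<Longrightarrow> z \<in> Z2 \<Longrightarrow> b \<in> B
      \<Longrightarrow> frechet_derivative f (at z) b = 0"
  shows "flat_piece B (Suc r) \<Omega> Z Y"
proof -
  obtain \<psi> W V Q K where P: "flat_patch B r \<Omega> Z2 Y \<psi> W V Q K"
    using fp unfolding flat_piece_def by blast
  note Y = flat_patchD(1)[OF P] and W = flat_patchD(2-10)[OF P] and K = flat_patchD(11,12)[OF P]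
    and fl = flat_patchD(13)[OF P]
  have finB: "finite B" using B by (rule finite_subset) simp
  have main: "\<exists>\<delta>>0. \<forall>x\<in>V. \<forall>y\<in>V. \<psi> x \<in> Y \<longrightarrow> dist x y < \<delta> \<longrightarrow> \<bar>f (\<psi> y)\<bar> \<le> \<epsilon> * dist x y ^ Suc r"
    if f: "Ck_on (Suc r) f \<Omega>" "\<forall>z\<in>Z. f z = 0" and \<epsilon>: "\<epsilon> > 0" for f :: "'e \<Rightarrow> real" and \<epsilon>
  proof -
    \<comment> \<open>The sum over \<open>B\<close> and the speed of \<open>\<psi>\<close>
      contribute the factor \<open>card B * K\<close>; adding 1 keeps the denominator positive when
      \<open>B\<close> is empty.\<close>
    define \<epsilon>' where "\<epsilon>' = \<epsilon> / (card B * K + 1)"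
    have \<epsilon>': "\<epsilon>' > 0" "card B * K * \<epsilon>' \<le> \<epsilon>"
      using \<epsilon> K by (auto simp: \<epsilon>'_def field_simps add_pos_nonneg)
    \<comment> \<open>The partial derivative in direction \<open>b\<close> is an admissible test
      function of order \<open>r\<close>: by \<open>crit\<close> it vanishes on
      \<open>Z2\<close>.\<close>
    have "\<exists>\<delta>>0. \<forall>x\<in>V. \<forall>y\<in>V. \<psi> x \<in> Y \<longrightarrow> dist x y < \<delta> \<longrightarrow> \<bar>frechet_derivative f (at (\<psi> y)) b\<bar> \<le> \<epsilon>' * dist x y ^ r"
      if "b \<in> B" for b
      by (rule fl) (use f crit that \<epsilon>' in auto)
    then obtain \<Delta> where \<Delta>: "\<And>b. b \<in> B \<Longrightarrow> \<Delta> b > 0" "\<And>b x y. b \<in> B \<Longrightarrow> x \<in> V \<Longrightarrow> y \<in> V \<Longrightarrow> \<psi> x \<in> Y \<Longrightarrow>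
        dist x y < \<Delta> b \<Longrightarrow> \<bar>frechet_derivative f (at (\<psi> y)) b\<bar> \<le> \<epsilon>' * dist x y ^ r"
      by metis
    define \<delta> where "\<delta> = Min (insert 1 (\<Delta> ` B))"
    have \<delta>: "\<delta> > 0" "\<And>b. b \<in> B \<Longrightarrow> \<delta> \<le> \<Delta> b" using finB \<Delta> by (auto simp: \<delta>_def)
    have "\<bar>f (\<psi> y)\<bar> \<le> \<epsilon> * dist x y ^ Suc r"
      if xy: "x \<in> V" "y \<in> V" "\<psi> x \<in> Y" "dist x y < \<delta>" for x y
    proof -
      define p where "p s = x + s *\<^sub>R (y - x)" for s
      define w where "w s = frechet_derivative \<psi> (at (p s)) (y - x)" for s
      have pV: "p s \<in> V" if "0 \<le> s" "s \<le> 1" for s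
      proof -
        have "p s = (1 - s) *\<^sub>R x + s *\<^sub>R y" by (simp add: p_def algebra_simps)
        then show ?thesis using convexD[OF W(4) xy(1,2), of "1-s" s] that by simp
      qed
      have d\<psi>: "((\<lambda>s. \<psi> (p s)) has_derivative (\<lambda>t. t *\<^sub>R w s)) (at s)" if "0 \<le> s" "s \<le> 1" for s
      proof -
        have "(p has_derivative (\<lambda>t. t *\<^sub>R (y - x))) (at s)"
          unfolding p_def by (auto intro!: derivative_eq_intros)
        moreover have \<psi>': "(\<psi> has_derivative frechet_derivative \<psi> (at (p s))) (at (p s))"
          using W pV[OF that] Ck_on_has_derivative[of 0 \<psi> W] by auto
        ultimately have "(\<psi> \<circ> p has_derivative (frechet_derivative \<psi> (at (p s)) \<circ> (\<lambda>t. t *\<^sub>R (y - x)))) (at s)"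
          by (rule diff_chain_at)
        moreover have "frechet_derivative \<psi> (at (p s)) \<circ> (\<lambda>t. t *\<^sub>R (y - x)) = (\<lambda>t. t *\<^sub>R w s)"
          using linear_cmul[OF has_derivative_linear[OF \<psi>']] by (auto simp: w_def)
        ultimately show ?thesis by (simp add: o_def)
      qed
      have df: "((\<lambda>s. f (\<psi> (p s))) has_real_derivative frechet_derivative f (at (\<psi> (p s))) (w s)) (at s)"
        if "0 \<le> s" "s \<le> 1" for s
      proof -
        have "\<psi> (p s) \<in> \<Omega>" using pV[OF that] W by auto
        then have f': "(f has_derivative frechet_derivative f (at (\<psi> (p s)))) (at (\<psi> (p s)))"
          using f Ck_on_has_derivative by blast
        have "((f \<circ> (\<lambda>s. \<psi> (p s))) has_derivative (frechet_derivative f (at (\<psi> (p s))) \<circ> (\<lambda>t. t *\<^sub>R w s))) (at s)"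
          by (rule diff_chain_at[OF d\<psi>[OF that] f'])
        moreover have "frechet_derivative f (at (\<psi> (p s))) \<circ> (\<lambda>t. t *\<^sub>R w s) = (\<lambda>t. frechet_derivative f (at (\<psi> (p s))) (w s) * t)"
          using linear_cmul[OF has_derivative_linear[OF f']] by (auto simp: mult.commute)
        ultimately show ?thesis by (simp add: o_def has_field_derivative_def)
      qed
      obtain s where s: "0 < s" "s < 1" "f (\<psi> (p 1)) - f (\<psi> (p 0)) = (1 - 0) * frechet_derivative f (at (\<psi> (p s))) (w s)"
        using MVT2[of 0 1 "\<lambda>s. f (\<psi> (p s))", OF zero_less_one df] by blast
      have ps: "p s \<in> V" using pV s by simp
      \<comment> \<open>The patch stays in \<open>coord_space B\<close>, so its velocity has no
        component outside \<open>B\<close> and only derivatives covered by \<open>crit\<close>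
        enter.\<close>
      have w0: "w s \<bullet> b = 0" if "b \<in> Basis - B" for b
      proof -
        have "((\<lambda>s. \<psi> (p s) \<bullet> b) has_derivative (\<lambda>t. t *\<^sub>R w s \<bullet> b)) (at s)"
          by (rule has_derivative_inner_left[OF d\<psi>]) (use s in auto)
        moreover have "((\<lambda>s. \<psi> (p s) \<bullet> b) has_derivative (\<lambda>t. 0)) (at s)"
        proof (rule has_derivative_transform_within_open[of "\<lambda>_. 0" _ _ _ "{0<..<1}"])
          fix t :: real assume "t \<in> {0<..<1}"
          then have "\<psi> (p t) \<in> coord_space B" using pV W by auto
          then show "0 = \<psi> (p t) \<bullet> b" using that by (simp add: coord_space_def)
        qed (use s in auto)
        ultimately have "(\<lambda>t. t *\<^sub>R w s \<bullet> b) = (\<lambda>t. 0)" by (rule has_derivative_unique)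
        from fun_cong[OF this, of 1] show ?thesis by simp
      qed
      have dps: "dist x (p s) \<le> dist x y"
        using s by (simp add: p_def dist_norm norm_minus_commute mult_left_le_one_le)
      have wn: "norm (w s) \<le> K * dist x y"
        using K(2)[OF ps, of "y - x"] by (simp add: w_def dist_norm norm_minus_commute)
      have fd: "f differentiable (at (\<psi> (p s)))"
      proof -
        have "\<psi> (p s) \<in> \<Omega>" using ps W(7,8) by blast
        then show ?thesis using f(1) by simp
      qed
      have "f (\<psi> y) = frechet_derivative f (at (\<psi> (p s))) (w s)"
        using s(3) f(2) xy(3) Y Z2 by (auto simp: p_def)
      also have "\<dots> = (\<Sum>b\<in>Basis. (w s \<bullet> b) * frechet_derivative f (at (\<psi> (p s))) b)"
        using frechet_derivative_basis_expansion[OF fd, of "w s"] by simp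
      also have "\<dots> = (\<Sum>b\<in>B. (w s \<bullet> b) * frechet_derivative f (at (\<psi> (p s))) b)"
        by (rule sum.mono_neutral_right) (use B w0 in auto)
      finally have "\<bar>f (\<psi> y)\<bar> = norm (\<Sum>b\<in>B. (w s \<bullet> b) * frechet_derivative f (at (\<psi> (p s))) b)" by simp
      also have "\<dots> \<le> (\<Sum>b\<in>B. (K * dist x y) * (\<epsilon>' * dist x y ^ r))"
      proof (rule sum_norm_le)
        fix b assume b: "b \<in> B"
        have "\<bar>w s \<bullet> b\<bar> \<le> K * dist x y" using wn Basis_le_norm[of b "w s"] b B by fastforce
        moreover have "\<bar>frechet_derivative f (at (\<psi> (p s))) b\<bar> \<le> \<epsilon>' * dist x (p s) ^ r"
          by (rule \<Delta>) (use b xy ps dps \<delta>(2)[OF b] in auto)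
        moreover have "\<epsilon>' * dist x (p s) ^ r \<le> \<epsilon>' * dist x y ^ r"
          using dps \<epsilon>' by (intro mult_left_mono power_mono) auto
        ultimately show "norm ((w s \<bullet> b) * frechet_derivative f (at (\<psi> (p s))) b) \<le> (K * dist x y) * (\<epsilon>' * dist x y ^ r)"
          using K unfolding real_norm_def abs_mult by (intro mult_mono) auto
      qed
      also have "\<dots> = (card B * K * \<epsilon>') * dist x y ^ Suc r" by simp
      also have "\<dots> \<le> \<epsilon> * dist x y ^ Suc r" using \<epsilon>' by (intro mult_right_mono) auto
      finally show ?thesis .
    qed
    then show ?thesis using \<delta> by blast
  qed
  show ?thesis by (rule flat_pieceI[OF _ W K main]) (use Y Z2 in auto)
qed

text \<open>Pieces found after straightening are carried back by \<open>G\<close>. A test function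
  \<open>f\<close> on \<open>N\<close> becomes \<open>f \<circ> G\<close> on \<open>N'\<close>,
  which keeps the order \<open>Suc r\<close> because \<open>G\<close> has it; the new
  parametrisation \<open>G \<circ> \<psi>\<close> has just to be C^1.\<close>

lemma flat_piece_transport:
  fixes G :: "'e::euclidean_space \<Rightarrow> 'e"
  assumes N: "open N" "open N'" and hom: "homeomorphism N N' \<Phi> G" and G: "Ck_on (Suc r) G N'"
    and GB: "\<And>y. y \<in> N' \<inter> coord_space B' \<Longrightarrow> G y \<in> coord_space B"
    and Z: "Z \<subseteq> N" and fp: "flat_piece B' (Suc r) N' (\<Phi> ` Z) Y"
  shows "flat_piece B (Suc r) N Z (G ` Y)"
proof -
  obtain \<psi> W V Q K where P: "flat_patch B' (Suc r) N' (\<Phi> ` Z) Y \<psi> W V Q K"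
    using fp unfolding flat_piece_def by blast
  note Y = flat_patchD(1)[OF P] and W = flat_patchD(2-10)[OF P] and K = flat_patchD(11,12)[OF P]
    and fl = flat_patchD(13)[OF P]
  have G\<Phi>: "G (\<Phi> z) = z" if "z \<in> N" for z using hom that by (simp add: homeomorphism_def)
  have \<Phi>G: "\<Phi> (G z) = z" if "z \<in> N'" for z using hom that by (simp add: homeomorphism_def)
  have GN: "G ` N' = N" "\<Phi> ` N = N'" using hom by (auto simp: homeomorphism_def)
  have G1: "Ck_on 1 G N'" using G Ck_on_mono by (metis Suc_leI One_nat_def zero_less_Suc)
  obtain KG where KG: "KG > 0" "\<And>x v. x \<in> Q \<Longrightarrow> norm (frechet_derivative G (at x) v) \<le> KG * norm v"
    using Ck_on_bounded_derivative[OF G1 W(6,7)] by blast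
  \<comment> \<open>Only \<open>V\<close> is known to be mapped into \<open>N'\<close> by
    \<open>\<psi>\<close>; \<open>W'\<close> is the open part of \<open>W\<close> on which
    \<open>G \<circ> \<psi>\<close> makes sense.\<close>
  define W' where "W' = {x \<in> W. \<psi> x \<in> N'}"
  have c\<psi>: "continuous_on W \<psi>" using W(2) Ck_on_imp_continuous by blast
  have W'o: "open W'" using continuous_open_preimage[OF c\<psi> W(1) N(2)] by (simp add: W'_def vimage_def Int_def)
  have W'W: "W' \<subseteq> W" "\<psi> ` W' \<subseteq> N'" by (auto simp: W'_def)
  have VW': "V \<subseteq> W'" using W by (auto simp: W'_def)
  have C: "Ck_on 1 (\<lambda>x. G (\<psi> x)) W'"
    by (rule Ck_on_compose[OF W'o G1 Ck_on_subset[OF W(2)]]) (use W'W in auto)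
  have dK: "norm (frechet_derivative (\<lambda>x. G (\<psi> x)) (at z) w) \<le> (KG * K) * norm w" if z: "z \<in> V" for z w
  proof -
    have 1: "(\<psi> has_derivative frechet_derivative \<psi> (at z)) (at z)"
      using Ck_on_has_derivative[of 0 \<psi> W] W z by auto
    have pz: "\<psi> z \<in> Q" using W z by auto
    have 2: "(G has_derivative frechet_derivative G (at (\<psi> z))) (at (\<psi> z))"
      using Ck_on_has_derivative[OF G] W pz by auto
    have "(\<lambda>x. G (\<psi> x)) = G \<circ> \<psi>" by (simp add: o_def)
    then have "frechet_derivative (\<lambda>x. G (\<psi> x)) (at z) = frechet_derivative G (at (\<psi> z)) \<circ> frechet_derivative \<psi> (at z)"
      using frechet_derivative_at[OF diff_chain_at[OF 1 2]] by simp
    then have "norm (frechet_derivative (\<lambda>x. G (\<psi> x)) (at z) w) \<le> KG * norm (frechet_derivative \<psi> (at z) w)"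
      using KG(2)[OF pz] by simp
    also have "\<dots> \<le> KG * (K * norm w)" using KG(1) K(2)[OF z] by (intro mult_left_mono) auto
    finally show ?thesis by simp
  qed
  have main: "\<exists>\<delta>>0. \<forall>x\<in>V. \<forall>y\<in>V. G (\<psi> x) \<in> G ` Y \<longrightarrow> dist x y < \<delta> \<longrightarrow> \<bar>f (G (\<psi> y))\<bar> \<le> \<epsilon> * dist x y ^ Suc r"
    if f: "Ck_on (Suc r) f N" "\<forall>z\<in>Z. f z = 0" and \<epsilon>: "\<epsilon> > 0" for f :: "'e \<Rightarrow> real" and \<epsilon>
  proof -
    have "Ck_on (Suc r) (\<lambda>y. f (G y)) N'"
      by (rule Ck_on_compose[OF N(2) f(1) G]) (use GN in auto)
    moreover have "\<forall>z\<in>\<Phi> ` Z. f (G z) = 0" using G\<Phi> Z f by auto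
    ultimately have ex: "\<exists>\<delta>>0. \<forall>x\<in>V. \<forall>y\<in>V. \<psi> x \<in> Y \<longrightarrow> dist x y < \<delta> \<longrightarrow> \<bar>f (G (\<psi> y))\<bar> \<le> \<epsilon> * dist x y ^ Suc r"
      using fl[of "\<lambda>y. f (G y)"] \<epsilon> by blast
    \<comment> \<open>Injectivity of \<open>G\<close> on \<open>N'\<close> turns a point over the
      image of \<open>Y\<close> back into a point over \<open>Y\<close>.\<close>
    have "\<psi> x \<in> Y" if x: "x \<in> V" "G (\<psi> x) \<in> G ` Y" for x
    proof -
      obtain y where y: "y \<in> Y" "G (\<psi> x) = G y" using x by auto
      have "y \<in> N'" using y(1) Y Z GN(2) by blast
      moreover have "\<psi> x \<in> N'" using W(7,8) x(1) by blast
      ultimately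
      show ?thesis using y \<Phi>G by metis
    qed
    then show ?thesis using ex by blast
  qed
  have im: "(\<lambda>x. G (\<psi> x)) ` V \<subseteq> G ` Q \<inter> coord_space B" using W(7,8) GB by blast
  have cQ: "compact (G ` Q)"
    by (rule compact_continuous_image[OF continuous_on_subset[OF Ck_on_imp_continuous[OF G] W(7)] W(6)])
  show ?thesis
  proof (rule flat_pieceI[OF _ W'o C VW' W(4,5) cQ _ im _ _ dK main])
    have "G ` Y \<subseteq> G ` \<Phi> ` Z" using Y by (rule image_mono)
    also have "\<dots> = Z" using Z G\<Phi> by (force simp: image_iff)
    finally show "G ` Y \<subseteq> Z" .
    show "G ` Q \<subseteq> N" using W(7) GN by blast
    show "G ` Y \<subseteq> (\<lambda>x. G (\<psi> x)) ` V" using W(9) by blast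
    show "0 < KG * K" using K KG by simp
  qed
qed

text \<open>Induction on \<open>r\<close> and, inside it, on \<open>card B\<close>. Near a point of
  \<open>Z1\<close> the set \<open>Z\<close> lies in a regular level set, which straightening turns
  into a coordinate hyperplane: a direction of \<open>B\<close> is lost and the order stays. Off
  \<open>Z1\<close> all derivatives along \<open>B\<close> vanish, so the order can be lowered and
  then regained by \<open>flat_piece_Suc\<close>. Flatness is claimed for all \<open>f\<close> at
  once since derivatives of \<open>f\<close> and compositions with \<open>G\<close> become new test
  functions.\<close>

theorem Morse_vanishing:
  fixes B :: "'e::euclidean_space set"
  assumes "open \<Omega>" "Z \<subseteq> \<Omega> \<inter> coord_space B" "B \<subseteq> Basis"
  shows "\<exists>\<Y>. countable \<Y> \<and> Z \<subseteq> \<Union>\<Y> \<and> (\<forall>Y\<in>\<Y>. flat_piece B r \<Omega> Z Y)"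
  using assms
proof (induction r arbitrary: \<Omega> Z B)
  case 0 then show ?case by (intro flat_pieces_0)
next
  case (Suc r)
  from Suc.prems show ?case
  proof (induction "card B" arbitrary: B \<Omega> Z rule: less_induct)
    case less
    define Z1 where "Z1 = {z\<in>Z. \<exists>f::'e\<Rightarrow>real. Ck_on (Suc r) f \<Omega> \<and> (\<forall>z\<in>Z. f z = 0) \<and> (\<exists>b\<in>B. frechet_derivative f (at z) b \<noteq> 0)}"
    have "Z - Z1 \<subseteq> \<Omega> \<inter> coord_space B" using less.prems by auto
    from Suc.IH[OF less.prems(1) this less.prems(3)]
    obtain \<Y>2 where \<Y>2: "countable \<Y>2" "Z - Z1 \<subseteq> \<Union>\<Y>2" "\<And>Y. Y \<in> \<Y>2 \<Longrightarrow> flat_piece B r \<Omega> (Z - Z1) Y" by metis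
    have Y2: "flat_piece B (Suc r) \<Omega> Z Y" if "Y \<in> \<Y>2" for Y
      by (rule flat_piece_Suc[OF less.prems(1,3) \<Y>2(3)[OF that]]) (auto simp: Z1_def)
    have "\<exists>\<Y>. countable \<Y> \<and> Z1 \<subseteq> \<Union>\<Y> \<and> (\<forall>Y\<in>\<Y>. flat_piece B (Suc r) \<Omega> Z Y)"
    proof (rule countable_cover_locally)
      fix z assume "z \<in> Z1"
      then obtain f b where f: "Ck_on (Suc r) f \<Omega>" "\<forall>z\<in>Z. f z = (0::real)" and b: "b \<in> B" "frechet_derivative f (at z) b \<noteq> 0" and z: "z \<in> Z"
        by (auto simp: Z1_def)
      have bB: "b \<in> Basis" using b less.prems by auto
      let ?\<Phi> = "\<lambda>x. x + (f x - x \<bullet> b) *\<^sub>R b"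
      obtain N N' G where N: "open N" "z \<in> N" "N \<subseteq> \<Omega>" "open N'" "homeomorphism N N' ?\<Phi> G" "Ck_on (Suc r) G N'"
        using straightening[OF less.prems(1) f(1) bB _ b(2)] z less.prems by blast
      \<comment> \<open>\<open>?\<Phi>\<close> changes only the coordinate \<open>b\<close>, which
        is free in \<open>B\<close>; all other coordinates of \<open>G y\<close> are those of
        \<open>y\<close>.\<close>
      have GB: "G y \<in> coord_space B" if y: "y \<in> N' \<inter> coord_space (B - {b})" for y
      proof -
        have "y = ?\<Phi> (G y)" using N(5) y by (simp add: homeomorphism_def)
        then have "y \<bullet> i = G y \<bullet> i" if "i \<in> Basis" "i \<noteq> b" for i
          using that bB by (metis inner_add_left inner_scaleR_left inner_not_same_Basis mult_zero_right add.right_neutral)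
        then have "G y \<bullet> i = 0" if "i \<in> Basis - B" for i
          using that y b by (fastforce simp: coord_space_def)
        then show ?thesis by (simp add: coord_space_def)
      qed
      \<comment> \<open>As \<open>f\<close> vanishes on \<open>Z\<close>, the new
        \<open>b\<close>-coordinate is 0 there, so \<open>b\<close> leaves the set of free
        directions.\<close>
      have Z': "?\<Phi> ` (Z \<inter> N) \<subseteq> N' \<inter> coord_space (B - {b})"
      proof -
        have "?\<Phi> z \<bullet> i = 0" if "z \<in> Z" "i \<in> Basis - (B - {b})" for z i
        proof (cases "i = b")
          case True then show ?thesis using f that bB by (simp add: inner_add_left inner_diff_left)
        next
          case False
          then have "z \<bullet> i = 0" using that less.prems by (auto simp: coord_space_def)
          then show ?thesis using that False bB by (simp add: inner_add_left inner_not_same_Basis)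
        qed
        moreover have "?\<Phi> ` N = N'" using N by (simp add: homeomorphism_def)
        ultimately show ?thesis by (auto simp: coord_space_def)
      qed
      have "card (B - {b}) < card B"
        using b(1) finite_subset[OF less.prems(3) finite_Basis] by (intro card_Diff1_less)
      from less.hyps[OF this N(4) Z' subset_trans[OF Diff_subset less.prems(3)]]
      obtain \<Y> where \<Y>: "countable \<Y>" "?\<Phi> ` (Z \<inter> N) \<subseteq> \<Union>\<Y>" "\<And>Y. Y \<in> \<Y> \<Longrightarrow> flat_piece (B - {b}) (Suc r) N' (?\<Phi> ` (Z \<inter> N)) Y"
        by blast
      have "flat_piece B (Suc r) \<Omega> Z (G ` Y)" if "Y \<in> \<Y>" for Y
        by (rule flat_piece_mono[OF flat_piece_transport[OF N(1,4,5,6) GB _ \<Y>(3)[OF that]] N(3)]) auto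
      moreover have "Z1 \<inter> N \<subseteq> \<Union>((`) G ` \<Y>)"
      proof
        fix x assume x: "x \<in> Z1 \<inter> N"
        then have "x \<in> Z \<inter> N" by (auto simp: Z1_def)
        then obtain Y where "Y \<in> \<Y>" "?\<Phi> x \<in> Y" using \<Y> by blast
        moreover have "G (?\<Phi> x) = x" using x N(5) by (simp add: homeomorphism_def)
        ultimately show "x \<in> \<Union>((`) G ` \<Y>)" by (metis UN_iff imageI)
      qed
      ultimately show "\<exists>N \<Y>. open N \<and> z \<in> N \<and> countable \<Y> \<and> Z1 \<inter> N \<subseteq> \<Union>\<Y> \<and> (\<forall>Y\<in>\<Y>. flat_piece B (Suc r) \<Omega> Z Y)"
        using N \<Y>(1) by (intro exI[of _ N] exI[of _ "(`) G ` \<Y>"]) auto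
    qed
    then obtain \<Y>1 where "countable \<Y>1" "Z1 \<subseteq> \<Union>\<Y>1" "\<forall>Y\<in>\<Y>1. flat_piece B (Suc r) \<Omega> Z Y" by blast
    then show ?case using \<Y>2(1,2) Y2 by (intro exI[of _ "\<Y>1 \<union> \<Y>2"]) auto
  qed
qed

text \<open>The hypothesis \<open>curves\<close> isolates what the variational problem has to
  deliver. The image under \<open>\<psi>\<close> of a segment of length h has length at most K h,
  and on it \<open>U\<close> is at most e^2 with e = \<epsilon>' h^(d-1), the square root of the
  flatness bound; the cost C e l is then C K \<epsilon>' h^d.\<close>

theorem negligible_image_zero_set:
  fixes \<Omega> :: "'e::euclidean_space set" and U u :: "'e \<Rightarrow> real"
  assumes \<Omega>: "open \<Omega>" and U: "Ck_on (2 * DIM('e) - 2) U \<Omega>"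
    and curves: "\<And>Q. compact Q \<Longrightarrow> Q \<subseteq> \<Omega> \<Longrightarrow> \<exists>C\<ge>0. \<forall>c c' l e. 0 < l \<longrightarrow> 0 < e \<longrightarrow> e \<le> 1 \<longrightarrow>
        (\<forall>s\<in>{0..1}. (c has_vector_derivative c' s) (at s within {0..1}) \<and> c s \<in> Q \<and> norm (c' s) \<le> l \<and> U (c s) \<le> e\<^sup>2) \<longrightarrow>
        continuous_on {0..1} c' \<longrightarrow> \<bar>u (c 1) - u (c 0)\<bar> \<le> C * e * l"
  shows "negligible (u ` {p \<in> \<Omega>. U p = 0})"
proof -
  let ?d = "DIM('e)" let ?Z = "{p \<in> \<Omega>. U p = 0}"
  have d1: "?d \<ge> 1" by (simp add: Suc_leI)
  have "?Z \<subseteq> \<Omega> \<inter> coord_space Basis" by (auto simp: coord_space_def)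
  from Morse_vanishing[OF \<Omega> this, of "2 * ?d - 2"]
  obtain \<Y> where \<Y>: "countable \<Y>" "?Z \<subseteq> \<Union>\<Y>" "\<And>Y. Y \<in> \<Y> \<Longrightarrow> flat_piece Basis (2 * ?d - 2) \<Omega> ?Z Y"
    by blast
  have "negligible (u ` Y)" if Yin: "Y \<in> \<Y>" for Y
  proof -
  obtain \<psi> W V Q K where P: "flat_patch Basis (2*?d-2) \<Omega> ?Z Y \<psi> W V Q K"
    using \<Y>(3)[OF Yin] unfolding flat_piece_def by blast
  note Y = flat_patchD(1)[OF P] and W = flat_patchD(2-10)[OF P] and K = flat_patchD(11,12)[OF P]
    and fl = flat_patchD(13)[OF P]
    obtain C where C: "C \<ge> 0" "\<And>c c' l e. 0 < l \<Longrightarrow> 0 < e \<Longrightarrow> e \<le> 1 \<Longrightarrow>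
        (\<forall>s\<in>{0..1}. (c has_vector_derivative c' s) (at s within {0..1}) \<and> c s \<in> Q \<and> norm (c' s) \<le> l \<and> U (c s) \<le> e\<^sup>2) \<Longrightarrow>
        continuous_on {0..1} c' \<Longrightarrow> \<bar>u (c 1) - u (c 0)\<bar> \<le> C * e * l"
      using curves[OF W(6,7)] by metis
    let ?X = "{x \<in> V. \<psi> x \<in> Y}"
    have "negligible ((\<lambda>x. u (\<psi> x)) ` ?X)"
    proof (rule flat_image_negligible)
      show "bounded ?X" using W(5) by (rule bounded_subset) auto
      fix \<epsilon> :: real assume \<epsilon>: "\<epsilon> > 0"
      \<comment> \<open>The cap 1, together with distances below 1, ensures \<open>e \<le> 1\<close>
        further down; the other entry gives
        \<open>C * K * \<epsilon>' \<le> \<epsilon>\<close>.\<close>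
      define \<epsilon>' where "\<epsilon>' = min 1 (\<epsilon> / (C * K + 1))"
      have CK: "C * K + 1 > 0" using C K by (simp add: add_nonneg_pos)
      have \<epsilon>': "0 < \<epsilon>'" "\<epsilon>' \<le> 1" using \<epsilon> CK by (auto simp: \<epsilon>'_def)
      have "\<epsilon>' \<le> \<epsilon> / (C * K + 1)" by (simp add: \<epsilon>'_def)
      then have "\<epsilon>' * (C * K + 1) \<le> \<epsilon>" using CK by (simp add: pos_le_divide_eq)
      then have \<epsilon>'2: "C * K * \<epsilon>' \<le> \<epsilon>" using \<epsilon>' by (simp add: algebra_simps)
      obtain \<delta> where \<delta>: "\<delta> > 0" "\<And>x y. x \<in> V \<Longrightarrow> y \<in> V \<Longrightarrow> \<psi> x \<in> Y \<Longrightarrow> dist x y < \<delta> \<Longrightarrow> \<bar>U (\<psi> y)\<bar> \<le> \<epsilon>'\<^sup>2 * dist x y ^ (2*?d-2)"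
        using fl[OF U, of "\<epsilon>'\<^sup>2"] \<epsilon>' by auto
      have "\<bar>u (\<psi> x) - u (\<psi> y)\<bar> \<le> \<epsilon> * dist x y ^ ?d"
        if xy: "x \<in> ?X" "y \<in> ?X" "dist x y < min \<delta> 1" for x y
      proof (cases "x = y")
        case False
        define p where "p s = x + s *\<^sub>R (y - x)" for s
        define e where "e = \<epsilon>' * dist x y ^ (?d - 1)"
        define l where "l = K * dist x y"
        have pos: "0 < dist x y" using False by simp
        have e: "0 < e" "e \<le> 1" using \<epsilon>' pos xy by (auto simp: e_def intro!: mult_le_one power_le_one)
        have pV: "p s \<in> V" if "s \<in> {0..1}" for s
        proof -
          have "p s = (1 - s) *\<^sub>R x + s *\<^sub>R y" by (simp add: p_def algebra_simps)
          then show ?thesis using convexD[OF W(4), of x y "1-s" s] that xy by simp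
        qed
        have cp: "continuous_on {0..1} p" unfolding p_def by (intro continuous_intros)
        have *: "((\<lambda>s. \<psi> (p s)) has_vector_derivative frechet_derivative \<psi> (at (p s)) (y - x)) (at s within {0..1}) \<and>
           \<psi> (p s) \<in> Q \<and> norm (frechet_derivative \<psi> (at (p s)) (y - x)) \<le> l \<and> U (\<psi> (p s)) \<le> e\<^sup>2" if s: "s \<in> {0..1}" for s
        proof (intro conjI)
          have "(p has_vector_derivative (y - x)) (at s within {0..1})"
            unfolding p_def by (auto intro!: derivative_eq_intros)
          moreover have "(\<psi> has_derivative frechet_derivative \<psi> (at (p s))) (at (p s) within p ` {0..1})"
            by (rule has_derivative_at_withinI, rule Ck_on_has_derivative[of 0 _ W])
              (use W(2) subsetD[OF W(3) pV[OF s]] in \<open>simp_all add: One_nat_def\<close>)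
          ultimately have "((\<psi> \<circ> p) has_vector_derivative frechet_derivative \<psi> (at (p s)) (y - x)) (at s within {0..1})"
            by (rule vector_derivative_diff_chain_within)
          then show "((\<lambda>s. \<psi> (p s)) has_vector_derivative frechet_derivative \<psi> (at (p s)) (y - x)) (at s within {0..1})"
            by (simp add: o_def)
          show "\<psi> (p s) \<in> Q" using W pV[OF s] by auto
          show "norm (frechet_derivative \<psi> (at (p s)) (y - x)) \<le> l"
            using K(2)[OF pV[OF s], of "y - x"] by (simp add: l_def dist_norm norm_minus_commute)
          have dps: "dist x (p s) \<le> dist x y"
            using s by (simp add: p_def dist_norm norm_minus_commute mult_left_le_one_le)
          have "\<bar>U (\<psi> (p s))\<bar> \<le> \<epsilon>'\<^sup>2 * dist x (p s) ^ (2*?d-2)"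
            by (rule \<delta>) (use xy pV[OF s] dps in auto)
          also have "\<dots> \<le> \<epsilon>'\<^sup>2 * dist x y ^ (2*?d-2)"
            using dps by (intro mult_left_mono power_mono) auto
          also have "\<dots> = e\<^sup>2"
          proof -
            have "2 * ?d - 2 = (?d - 1) * 2" by (simp add: diff_mult_distrib)
            then show ?thesis by (simp only: e_def power_mult_distrib power_mult)
          qed
          finally show "U (\<psi> (p s)) \<le> e\<^sup>2" by simp
        qed
        have cont: "continuous_on {0..1} (\<lambda>s. frechet_derivative \<psi> (at (p s)) (y - x))"
        proof (rule continuous_on_compose2[OF _ cp])
          show "continuous_on W (\<lambda>z. frechet_derivative \<psi> (at z) (y - x))" using W(2) by (simp add: One_nat_def)
        qed (use pV W in auto)
        have "\<bar>u (\<psi> (p 1)) - u (\<psi> (p 0))\<bar> \<le> C * e * l"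
          by (rule C(2)[where c="\<lambda>s. \<psi> (p s)"]) (use pos K e * cont in \<open>auto simp: l_def\<close>)
        also have "C * e * l = (C * K * \<epsilon>') * (dist x y ^ (?d - 1) * dist x y)"
          by (simp add: e_def l_def)
        also have "dist x y ^ (?d - 1) * dist x y = dist x y ^ ?d"
          using d1 by (metis power_minus_mult less_le_trans zero_less_one)
        also have "(C * K * \<epsilon>') * dist x y ^ ?d \<le> \<epsilon> * dist x y ^ ?d"
          using \<epsilon>'2 by (intro mult_right_mono) auto
        finally show ?thesis by (simp add: p_def abs_minus_commute)
      qed (use \<epsilon> in simp)
      then show "\<exists>\<delta>>0. \<forall>x\<in>?X. \<forall>y\<in>?X. dist x y < \<delta> \<longrightarrow> \<bar>u (\<psi> x) - u (\<psi> y)\<bar> \<le> \<epsilon> * dist x y ^ ?d"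
        using \<delta> by (intro exI[of _ "min \<delta> 1"]) auto
    qed
    moreover have "u ` Y \<subseteq> (\<lambda>x. u (\<psi> x)) ` ?X" using W(9) by auto
    ultimately show ?thesis using negligible_subset by blast
  qed
  then have "negligible (\<Union>((`) u ` \<Y>))" by (intro negligible_countable_Union) (use \<Y> in auto)
  moreover have "u ` ?Z \<subseteq> \<Union>((`) u ` \<Y>)" using \<Y>(2) by blast
  ultimately show ?thesis using negligible_subset by blast
qed

section \<open>Charts, tangent vectors and curves\<close>

locale manifold =
  fixes A :: "('a::t2_space, 'e::euclidean_space) chart set"
  assumes atlas: "smooth_atlas A"
begin

abbreviation transition :: "('a, 'e) chart \<Rightarrow> ('a, 'e) chart \<Rightarrow> 'e \<Rightarrow> 'e" where
  "transition c c' \<equiv> chart_map c' \<circ> chart_inv c"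

abbreviation trans_dom :: "('a, 'e) chart \<Rightarrow> ('a, 'e) chart \<Rightarrow> 'e set" where
  "trans_dom c c' \<equiv> chart_map c ` (chart_dom c \<inter> chart_dom c')"

lemma open_chart_dom: "c \<in> A \<Longrightarrow> open (chart_dom c)"
  and open_chart_codom: "c \<in> A \<Longrightarrow> open (chart_codom c)"
  and chart_homeomorphism:
    "c \<in> A \<Longrightarrow> homeomorphism (chart_dom c) (chart_codom c) (chart_map c) (chart_inv c)"
  using atlas unfolding smooth_atlas_def by auto

lemma chart_exists: obtains c where "c \<in> A" "x \<in> chart_dom c"
  using atlas unfolding smooth_atlas_def by (metis UNIV_I UN_iff)

lemma chart_inv_map: "c \<in> A \<Longrightarrow> x \<in> chart_dom c \<Longrightarrow> chart_inv c (chart_map c x) = x"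
  and chart_map_inv: "c \<in> A \<Longrightarrow> p \<in> chart_codom c \<Longrightarrow> chart_map c (chart_inv c p) = p"
  and chart_inv_in_dom: "c \<in> A \<Longrightarrow> p \<in> chart_codom c \<Longrightarrow> chart_inv c p \<in> chart_dom c"
  and chart_map_in_codom: "c \<in> A \<Longrightarrow> x \<in> chart_dom c \<Longrightarrow> chart_map c x \<in> chart_codom c"
  and continuous_on_chart_map: "c \<in> A \<Longrightarrow> continuous_on (chart_dom c) (chart_map c)"
  and continuous_on_chart_inv: "c \<in> A \<Longrightarrow> continuous_on (chart_codom c) (chart_inv c)"
  using chart_homeomorphism[of c] unfolding homeomorphism_def by blast+

lemma open_chart_inv_image:
  assumes "c \<in> A" "open S" "S \<subseteq> chart_codom c" shows "open (chart_inv c ` S)"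
proof -
  have "chart_inv c ` S = chart_dom c \<inter> chart_map c -` S"
  proof safe
    fix x assume "x \<in> chart_dom c" "chart_map c x \<in> S"
    then show "x \<in> chart_inv c ` S"
      using assms chart_inv_map[of c x] by (intro image_eqI[of _ _ "chart_map c x"]) simp_all
  next
    fix p assume p: "p \<in> S"
    then have "p \<in> chart_codom c" using assms by blast
    then show "chart_inv c p \<in> chart_dom c" "chart_inv c p \<in> chart_map c -` S"
      using assms p by (simp_all add: chart_inv_in_dom chart_map_inv)
  qed
  then show ?thesis
    using continuous_open_preimage[OF continuous_on_chart_map open_chart_dom assms(2)] assms by simp
qed

lemma open_trans_dom: assumes "c \<in> A" "c' \<in> A" shows "open (trans_dom c c')"
proof -
  have "trans_dom c c' = chart_codom c \<inter> chart_inv c -` chart_dom c'"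
  proof safe
    fix p assume "p \<in> chart_codom c" "chart_inv c p \<in> chart_dom c'"
    then show "p \<in> trans_dom c c'"
      using assms by (intro image_eqI[of _ _ "chart_inv c p"]) (simp_all add: chart_map_inv chart_inv_in_dom)
  qed (use assms in \<open>simp_all add: chart_map_in_codom chart_inv_map\<close>)
  then show ?thesis
    using continuous_open_preimage[OF continuous_on_chart_inv open_chart_codom open_chart_dom] assms by simp
qed

lemma trans_Ck: "c \<in> A \<Longrightarrow> c' \<in> A \<Longrightarrow> Ck_on k (transition c c') (trans_dom c c')"
  using atlas unfolding smooth_atlas_def by blast

definition Jac :: "('a, 'e) chart \<Rightarrow> ('a, 'e) chart \<Rightarrow> 'a \<Rightarrow> 'e \<Rightarrow> 'e" where
  "Jac c c' x = frechet_derivative (transition c c') (at (chart_map c x))"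

lemma trans_has_derivative:
  assumes "c \<in> A" "c' \<in> A" "x \<in> chart_dom c" "x \<in> chart_dom c'"
  shows "(transition c c' has_derivative Jac c c' x) (at (chart_map c x))"
  unfolding Jac_def by (rule Ck_on_has_derivative[OF trans_Ck[OF assms(1,2)]]) (use assms in blast)

lemma linear_Jac:
  assumes "c \<in> A" "c' \<in> A" "x \<in> chart_dom c" "x \<in> chart_dom c'" shows "linear (Jac c c' x)"
  using trans_has_derivative[OF assms] has_derivative_linear by blast

text \<open>Near the point the transition from \<open>c\<close> to \<open>c''\<close> factors
  through \<open>c'\<close>. The chain rule then gives the cocycle identity that
  \<open>tangent_space\<close> demands of \<open>tvec_of\<close>.\<close>

lemma Jac_compose:
  assumes A: "c \<in> A" "c' \<in> A" "c'' \<in> A" and x: "x \<in> chart_dom c" "x \<in> chart_dom c'" "x \<in> chart_dom c''"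
  shows "Jac c' c'' x (Jac c c' x w) = Jac c c'' x w"
proof -
  have e: "transition c c' (chart_map c x) = chart_map c' x" using A x by (simp add: chart_inv_map)
  have "(transition c' c'' \<circ> transition c c' has_derivative Jac c' c'' x \<circ> Jac c c' x) (at (chart_map c x))"
    by (rule diff_chain_at[OF trans_has_derivative[OF A(1,2) x(1,2)]])
      (use trans_has_derivative[OF A(2,3) x(2,3)] e in simp)
  then have "(transition c c'' has_derivative Jac c' c'' x \<circ> Jac c c' x) (at (chart_map c x))"
    by (rule has_derivative_transform_within_open[OF _ open_trans_dom[of c c']])
      (use A x in \<open>auto simp: chart_inv_map\<close>)
  then have "Jac c' c'' x \<circ> Jac c c' x = Jac c c'' x"
    using trans_has_derivative[of c c'' x] A x has_derivative_unique by blast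
  then show ?thesis by (metis comp_apply)
qed

lemma tvec_of_eq: "tvec_of A c x w = (\<lambda>c'. if c' \<in> A \<and> x \<in> chart_dom c' then Jac c c' x w else 0)"
  by (simp add: tvec_of_def Jac_def fun_eq_iff)

lemma tvec_of_in_tangent_space:
  "c \<in> A \<Longrightarrow> x \<in> chart_dom c \<Longrightarrow> tvec_of A c x w \<in> tangent_space A x"
  by (auto simp: tangent_space_def tvec_of_eq Jac_compose simp flip: Jac_def)

lemma tvec_of_0: "c \<in> A \<Longrightarrow> x \<in> chart_dom c \<Longrightarrow> tvec_of A c x 0 = (\<lambda>_. 0)"
  by (auto simp: tvec_of_eq linear_Jac linear_0)

lemma tvec_of_minus: "c \<in> A \<Longrightarrow> x \<in> chart_dom c \<Longrightarrow> tvec_of A c x (- w) = - tvec_of A c x w"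
  by (auto simp: tvec_of_eq linear_Jac linear_neg fun_eq_iff)

lemma local_rep_eq: "local_rep A L c (p, w) = L (chart_inv c p, tvec_of A c (chart_inv c p) w)"
  by (simp add: local_rep_def TM_point_def)

lemma local_rep_chart_map:
  "c \<in> A \<Longrightarrow> x \<in> chart_dom c \<Longrightarrow> local_rep A L c (chart_map c x, w) = L (x, tvec_of A c x w)"
  by (simp add: local_rep_eq chart_inv_map)

section \<open>Velocities of curves in different charts\<close>

lemma eventually_in_chart_dom:
  assumes "c \<in> A" "continuous (at s within S) \<gamma>" "\<gamma> s \<in> chart_dom c"
  shows "\<forall>\<^sub>F t in at s within S. \<gamma> t \<in> chart_dom c"
  using assms open_chart_dom topological_tendstoD unfolding continuous_within by metis

text \<open>Continuity within \<open>S\<close> keeps the curve in the domain of \<open>c\<close> for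
  parameters near \<open>s\<close>, where the transition map relates the two coordinate expressions.
  The derivative is taken within \<open>S\<close> to cover one-sided velocities at end
  points.\<close>

lemma has_vector_derivative_change_chart:
  assumes A: "c \<in> A" "c' \<in> A" and x: "\<gamma> s \<in> chart_dom c" "\<gamma> s \<in> chart_dom c'" and s: "s \<in> S"
    and cont: "continuous (at s within S) \<gamma>"
    and d: "(chart_map c \<circ> \<gamma> has_vector_derivative w) (at s within S)"
  shows "(chart_map c' \<circ> \<gamma> has_vector_derivative Jac c c' (\<gamma> s) w) (at s within S)"
proof -
  have "(chart_map c \<circ> \<gamma>) s = chart_map c (\<gamma> s)" by simp
  then have "(transition c c' has_derivative Jac c c' (\<gamma> s)) (at ((chart_map c \<circ> \<gamma>) s))"
    using trans_has_derivative[OF A x] by metis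
  then have "(transition c c' \<circ> (chart_map c \<circ> \<gamma>) has_vector_derivative Jac c c' (\<gamma> s) w) (at s within S)"
    by (intro vector_derivative_diff_chain_within[OF d has_derivative_at_withinI])
  moreover obtain d where d: "d > 0" "\<And>t. t \<in> S \<Longrightarrow> t \<noteq> s \<Longrightarrow> dist t s < d \<Longrightarrow> \<gamma> t \<in> chart_dom c"
    using eventually_in_chart_dom[OF A(1) cont x(1)] by (auto simp: eventually_at)
  moreover have "\<gamma> t \<in> chart_dom c" if "t \<in> S" "dist t s < d" for t
    using d(2)[OF that(1)] that x(1) by blast
  then have "(transition c c' \<circ> (chart_map c \<circ> \<gamma>)) t = (chart_map c' \<circ> \<gamma>) t" if "t \<in> S" "dist t s < d" for t
    using that chart_inv_map[OF A(1), of "\<gamma> t"] by simp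
  ultimately show ?thesis
    using d(1) s by (blast intro: has_vector_derivative_transform_within)
qed

text \<open>With \<open>S = UNIV\<close> the left side is the velocity in
  \<open>tangent_lift\<close>; with an interval it is the one-sided velocity, which also makes sense
  at break points.\<close>

lemma lift_within_eq:
  assumes c: "c \<in> A" "\<gamma> s \<in> chart_dom c" and s: "s \<in> S" "at s within S \<noteq> bot"
    and cont: "continuous (at s within S) \<gamma>"
    and d: "(chart_map c \<circ> \<gamma> has_vector_derivative w) (at s within S)"
  shows "(\<lambda>c'. if c' \<in> A \<and> \<gamma> s \<in> chart_dom c' then vector_derivative (chart_map c' \<circ> \<gamma>) (at s within S) else 0)
    = tvec_of A c (\<gamma> s) w"
  unfolding tvec_of_eq
  using vector_derivative_within[OF s(2) has_vector_derivative_change_chart[OF c(1) _ c(2) _ s(1) cont d]]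
  by (auto simp: fun_eq_iff)

lemma tangent_lift_eq:
  assumes "c \<in> A" "\<gamma> s \<in> chart_dom c" "isCont \<gamma> s"
    and "(chart_map c \<circ> \<gamma> has_vector_derivative w) (at s)"
  shows "tangent_lift A \<gamma> s = (\<gamma> s, tvec_of A c (\<gamma> s) w)"
  unfolding tangent_lift_def using lift_within_eq[of c \<gamma> s UNIV w] assms by simp

text \<open>Together with \<open>C1_curveD\<close> it trades \<open>vector_derivative\<close> for an
  explicit velocity in each chart. The bound \<open>a < b\<close> makes one-sided derivatives
  unique.\<close>

lemma C1_curveI:
  assumes ab: "a < b" and "continuous_on {a..b} \<gamma>"
    and v: "\<And>c s. c \<in> A \<Longrightarrow> s \<in> {a..b} \<Longrightarrow> \<gamma> s \<in> chart_dom c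
      \<Longrightarrow> (chart_map c \<circ> \<gamma> has_vector_derivative v c s) (at s within {a..b})"
    and cv: "\<And>c. c \<in> A \<Longrightarrow> continuous_on {s\<in>{a..b}. \<gamma> s \<in> chart_dom c} (v c)"
  shows "C1_curve_on A \<gamma> {a..b}"
  unfolding C1_curve_on_def
proof (intro conjI ballI impI)
  fix c assume c: "c \<in> A"
  show "continuous_on {s \<in> {a..b}. \<gamma> s \<in> chart_dom c} (\<lambda>s. vector_derivative (chart_map c \<circ> \<gamma>) (at s within {a..b}))"
    using vector_derivative_within_closed_interval[OF ab _ v[OF c]]
    by (intro continuous_on_eq[OF cv[OF c]]) auto
  show "chart_map c \<circ> \<gamma> differentiable at s within {a..b}" if "s \<in> {a..b}" "\<gamma> s \<in> chart_dom c" for s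
    using v[OF c that] by (auto simp: differentiable_def has_vector_derivative_def)
qed (fact assms(2))

lemma C1_curveD:
  assumes "C1_curve_on A \<gamma> {a..b}"
  shows "\<exists>v. continuous_on {a..b} \<gamma> \<and> (\<forall>c\<in>A.
      (\<forall>s\<in>{a..b}. \<gamma> s \<in> chart_dom c \<longrightarrow> (chart_map c \<circ> \<gamma> has_vector_derivative v c s) (at s within {a..b})) \<and>
      continuous_on {s\<in>{a..b}. \<gamma> s \<in> chart_dom c} (v c))"
  using assms unfolding C1_curve_on_def
  by (intro exI[of _ "\<lambda>c s. vector_derivative (chart_map c \<circ> \<gamma>) (at s within {a..b})"])
    (simp flip: vector_derivative_works)

lemma C1_curve_cong:
  assumes "C1_curve_on A \<gamma> {a..b}" "a < b" and eq: "\<And>s. s \<in> {a..b} \<Longrightarrow> \<gamma>' s = \<gamma> s"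
  shows "C1_curve_on A \<gamma>' {a..b}"
proof -
  obtain v where v: "continuous_on {a..b} \<gamma>"
    "\<And>c s. c \<in> A \<Longrightarrow> s \<in> {a..b} \<Longrightarrow> \<gamma> s \<in> chart_dom c
      \<Longrightarrow> (chart_map c \<circ> \<gamma> has_vector_derivative v c s) (at s within {a..b})"
    "\<And>c. c \<in> A \<Longrightarrow> continuous_on {s\<in>{a..b}. \<gamma> s \<in> chart_dom c} (v c)"
    using C1_curveD[OF assms(1)] by blast
  show ?thesis
  proof (rule C1_curveI[OF assms(2)])
    show "continuous_on {a..b} \<gamma>'" by (rule continuous_on_eq[OF v(1)]) (use eq in simp)
    fix c assume c: "c \<in> A"
    have "{s\<in>{a..b}. \<gamma>' s \<in> chart_dom c} = {s\<in>{a..b}. \<gamma> s \<in> chart_dom c}" using eq by auto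
    then show "continuous_on {s\<in>{a..b}. \<gamma>' s \<in> chart_dom c} (v c)" using v(3)[OF c] by simp
    show "(chart_map c \<circ> \<gamma>' has_vector_derivative v c s) (at s within {a..b})"
      if "s \<in> {a..b}" "\<gamma>' s \<in> chart_dom c" for s
      by (rule has_vector_derivative_transform[OF that(1) _ v(2)[OF c that(1)]]) (use that eq in auto)
  qed
qed

lemma C1_curve_shift:
  assumes "C1_curve_on A \<gamma> {a..b}" "a < b"
  shows "C1_curve_on A (\<lambda>s. \<gamma> (s - t)) {a+t..b+t}"
proof -
  obtain v where v: "continuous_on {a..b} \<gamma>"
    "\<And>c s. c \<in> A \<Longrightarrow> s \<in> {a..b} \<Longrightarrow> \<gamma> s \<in> chart_dom c
      \<Longrightarrow> (chart_map c \<circ> \<gamma> has_vector_derivative v c s) (at s within {a..b})"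
    "\<And>c. c \<in> A \<Longrightarrow> continuous_on {s\<in>{a..b}. \<gamma> s \<in> chart_dom c} (v c)"
    using C1_curveD[OF assms(1)] by blast
  have im: "(\<lambda>s. s - t) ` {a+t..b+t} = {a..b}" by auto
  show ?thesis
  proof (rule C1_curveI)
    show "continuous_on {a+t..b+t} (\<lambda>s. \<gamma> (s - t))"
      by (rule continuous_on_compose2[OF v(1)]) (auto intro!: continuous_intros)
    fix c assume c: "c \<in> A"
    show "continuous_on {s\<in>{a+t..b+t}. \<gamma> (s - t) \<in> chart_dom c} (\<lambda>s. v c (s - t))"
      by (rule continuous_on_compose2[OF v(3)[OF c]]) (auto intro!: continuous_intros)
    show "(chart_map c \<circ> (\<lambda>s. \<gamma> (s - t)) has_vector_derivative v c (s - t)) (at s within {a+t..b+t})"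
      if s: "s \<in> {a+t..b+t}" "\<gamma> (s - t) \<in> chart_dom c" for s
    proof -
      have "((\<lambda>s. s - t) has_vector_derivative 1) (at s within {a+t..b+t})"
        by (auto intro!: derivative_eq_intros)
      from vector_diff_chain_within[OF this, of "chart_map c \<circ> \<gamma>" "v c (s - t)"]
      show ?thesis using v(2)[OF c, of "s - t"] s im by (simp add: o_def)
    qed
  qed (use assms in simp)
qed

section \<open>Piecewise C^1 paths\<close>

lemma piecewise_refl: "piecewise_C1_path A a a \<gamma>"
  unfolding piecewise_C1_path_def by (intro exI[of _ 0] exI[of _ "\<lambda>_. a"]) simp

lemma piecewise_snoc:
  assumes "piecewise_C1_path A a b \<gamma>" "b < c" "C1_curve_on A \<gamma> {b..c}"
  shows "piecewise_C1_path A a c \<gamma>"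
proof -
  obtain n p where p: "p 0 = a" "p n = b" "\<And>i. i < n \<Longrightarrow> p i < p (Suc i) \<and> C1_curve_on A \<gamma> {p i..p (Suc i)}"
    using assms(1) unfolding piecewise_C1_path_def by blast
  show ?thesis unfolding piecewise_C1_path_def
    by (intro exI[of _ "Suc n"] exI[of _ "p(Suc n := c)"]) (use p assms in \<open>auto simp: less_Suc_eq\<close>)
qed

text \<open>Prefixes of the path replace the partition in \<open>piecewise_C1_path\<close>:
  \<open>Q b\<close> is meant as a claim about the path on \<open>{a..b}\<close>, and each step
  appends one C^1 arc.\<close>

lemma piecewise_induct [consumes 1, case_names refl snoc]:
  assumes "piecewise_C1_path A a z \<gamma>"
    and refl: "Q a"
    and snoc: "\<And>b c. piecewise_C1_path A a b \<gamma> \<Longrightarrow> a \<le> b \<Longrightarrow> b < c \<Longrightarrow> c \<le> z \<Longrightarrow> C1_curve_on A \<gamma> {b..c} \<Longrightarrow> Q b \<Longrightarrow> Q c"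
  shows "Q z"
proof -
  obtain n p where p: "p 0 = a" "p n = z" "\<And>i. i < n \<Longrightarrow> p i < p (Suc i) \<and> C1_curve_on A \<gamma> {p i..p (Suc i)}"
    using assms(1) unfolding piecewise_C1_path_def by blast
  have mono: "p i \<le> p j" if "i \<le> j" "j \<le> n" for i j
    using that
  proof (induction rule: dec_induct)
    case (step k) then show ?case using p(3)[of k] by force
  qed simp
  have "piecewise_C1_path A a (p k) \<gamma> \<and> Q (p k)" if "k \<le> n" for k
    using that
  proof (induction k)
    case 0 then show ?case using p refl piecewise_refl by simp
  next
    case (Suc k)
    then show ?case using p(3)[of k] mono[of 0 k] mono[of "Suc k" n] p(1,2)
      by (auto intro: piecewise_snoc snoc[of "p k"])
  qed
  then show ?thesis using p by blast
qed

lemma piecewise_single: "a < b \<Longrightarrow> C1_curve_on A \<gamma> {a..b} \<Longrightarrow> piecewise_C1_path A a b \<gamma>"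
  using piecewise_snoc[OF piecewise_refl] by blast

lemma piecewise_trans:
  assumes "piecewise_C1_path A b c \<gamma>" "piecewise_C1_path A a b \<gamma>"
  shows "piecewise_C1_path A a c \<gamma>"
  using assms by (induction rule: piecewise_induct) (auto intro: piecewise_snoc)

lemma piecewise_cong:
  assumes "piecewise_C1_path A a b \<gamma>" "\<And>s. s \<in> {a..b} \<Longrightarrow> \<gamma>' s = \<gamma> s"
  shows "piecewise_C1_path A a b \<gamma>'"
  using assms(1)
proof (induction rule: piecewise_induct)
  case (snoc b' c)
  then have "C1_curve_on A \<gamma>' {b'..c}" by (intro C1_curve_cong[OF snoc(5)]) (use assms(2) in auto)
  then show ?case using snoc piecewise_snoc by blast
qed (rule piecewise_refl)

lemma piecewise_shift:
  assumes "piecewise_C1_path A a b \<gamma>"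
  shows "piecewise_C1_path A (a+t) (b+t) (\<lambda>s. \<gamma> (s - t))"
  using assms
proof (induction rule: piecewise_induct)
  case (snoc b c)
  then show ?case by (intro piecewise_snoc[OF snoc(6)] C1_curve_shift) auto
qed (rule piecewise_refl)

lemma piecewise_continuous:
  assumes "piecewise_C1_path A a b \<gamma>" shows "continuous_on {a..b} \<gamma>"
  using assms
proof (induction rule: piecewise_induct)
  case (snoc b c)
  then have "continuous_on ({a..b} \<union> {b..c}) \<gamma>"
    by (intro continuous_on_closed_Un) (auto simp: C1_curve_on_def)
  moreover have "{a..b} \<union> {b..c} = {a..c}" using snoc by auto
  ultimately show ?case by simp
qed simp

lemma C1_curve_interior:
  assumes "C1_curve_on A \<gamma> {a..b}" "s \<in> {a<..<b}" "c \<in> A" "\<gamma> s \<in> chart_dom c"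
  obtains w where "isCont \<gamma> s" "(chart_map c \<circ> \<gamma> has_vector_derivative w) (at s)"
proof -
  have at: "at s within {a..b} = at s" using assms(2) by (simp add: at_within_Icc_at)
  obtain v where "continuous_on {a..b} \<gamma>" "(chart_map c \<circ> \<gamma> has_vector_derivative v c s) (at s within {a..b})"
    using C1_curveD[OF assms(1)] assms(2-4) by (metis atLeastAtMost_iff greaterThanLessThan_iff less_imp_le)
  then show ?thesis using at that assms(2) continuous_on_eq_continuous_within
    by (metis atLeastAtMost_iff greaterThanLessThan_iff less_imp_le)
qed

text \<open>The identity is claimed at every \<open>s\<close>, also where no derivative exists and
  \<open>vector_derivative\<close> is an arbitrary value. Both sides admit the same derivatives, so
  the choice agrees.\<close>

lemma tangent_lift_shift: "tangent_lift A (\<lambda>s. \<gamma> (s - t)) s = tangent_lift A \<gamma> (s - t)"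
proof -
  have 1: "(f \<circ> (\<lambda>s. s - t) has_vector_derivative w) (at s)" if "(f has_vector_derivative w) (at (s - t))"
    for f :: "real \<Rightarrow> 'e" and w s t
  proof -
    have "((\<lambda>s. s - t) has_vector_derivative 1) (at s)" by (auto intro!: derivative_eq_intros)
    from vector_diff_chain_at[OF this that] show ?thesis by simp
  qed
  have "(f \<circ> (\<lambda>s. s - t) has_vector_derivative w) (at s) \<longleftrightarrow> (f has_vector_derivative w) (at (s - t))"
    for f :: "real \<Rightarrow> 'e" and w
    using 1[of "f \<circ> (\<lambda>s. s - t)" w "s - t" "- t"] 1[of f w s t] by (auto simp: o_def)
  then have "vector_derivative (f \<circ> (\<lambda>s. s - t)) (at s) = vector_derivative f (at (s - t))" for f :: "real \<Rightarrow> 'e"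
    unfolding vector_derivative_def by simp
  from this[of "chart_map _ \<circ> \<gamma>"] show ?thesis by (simp add: tangent_lift_def o_def cong: if_cong)
qed

lemma tangent_lift_cong_open:
  assumes "open S" "s \<in> S" "\<And>t. t \<in> S \<Longrightarrow> \<gamma>' t = \<gamma> t"
  shows "tangent_lift A \<gamma>' s = tangent_lift A \<gamma> s"
proof -
  have "(chart_map c \<circ> \<gamma>' has_vector_derivative w) (at s) \<longleftrightarrow> (chart_map c \<circ> \<gamma> has_vector_derivative w) (at s)"
    for c :: "('a, 'e) chart" and w
    using has_vector_derivative_transform_within_open[OF _ assms(1,2), of "chart_map c \<circ> \<gamma>'" w "chart_map c \<circ> \<gamma>"]
      has_vector_derivative_transform_within_open[OF _ assms(1,2), of "chart_map c \<circ> \<gamma>" w "chart_map c \<circ> \<gamma>'"] assms(3)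
    by auto
  then show ?thesis using assms by (simp add: tangent_lift_def vector_derivative_def cong: if_cong)
qed

text \<open>Paths for upper bounds on the action come from a curve \<open>q\<close> in one chart. In
  another chart the velocity is a Jacobian applied to \<open>q'\<close>, with base point and
  direction both varying; the basis expansion separates the two for continuity.\<close>

lemma C1_curve_in_chart:
  assumes c: "c \<in> A" and ab: "a < b" and q: "\<And>s. s \<in> {a..b} \<Longrightarrow> q s \<in> chart_codom c"
    "\<And>s. s \<in> {a..b} \<Longrightarrow> (q has_vector_derivative q' s) (at s within {a..b})" "continuous_on {a..b} q'"
  shows "C1_curve_on A (\<lambda>s. chart_inv c (q s)) {a..b}"
proof -
  let ?\<gamma> = "\<lambda>s. chart_inv c (q s)"
  have cq: "continuous_on {a..b} q"
    using q(2) by (meson continuous_on_vector_derivative)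
  have c\<gamma>: "continuous_on {a..b} ?\<gamma>"
    by (rule continuous_on_compose2[OF continuous_on_chart_inv[OF c] cq]) (use q in auto)
  have qd: "(chart_map c \<circ> ?\<gamma> has_vector_derivative q' s) (at s within {a..b})" if "s \<in> {a..b}" for s
    by (rule has_vector_derivative_transform[OF that _ q(2)[OF that]]) (use q c chart_map_inv in auto)
  have dom: "?\<gamma> s \<in> chart_dom c" if "s \<in> {a..b}" for s
    by (rule chart_inv_in_dom[OF c q(1)[OF that]])
  show ?thesis
  proof (rule C1_curveI[OF ab c\<gamma>])
    fix c' assume c': "c' \<in> A"
    show "(chart_map c' \<circ> ?\<gamma> has_vector_derivative Jac c c' (?\<gamma> s) (q' s)) (at s within {a..b})"
      if "s \<in> {a..b}" "?\<gamma> s \<in> chart_dom c'" for s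
      using that c\<gamma> by (intro has_vector_derivative_change_chart[OF c c' dom _ _ _ qd])
        (auto simp: continuous_on_eq_continuous_within)
    let ?S = "{s\<in>{a..b}. ?\<gamma> s \<in> chart_dom c'}"
    let ?D = "\<lambda>i p. frechet_derivative (transition c c') (at p) i"
    have qT: "q ` ?S \<subseteq> trans_dom c c'"
    proof clarify
      fix s assume "s \<in> {a..b}" "?\<gamma> s \<in> chart_dom c'"
      then show "q s \<in> trans_dom c c'"
        using q(1)[of s] c dom[of s] by (intro image_eqI[of _ _ "?\<gamma> s"]) (auto simp: chart_map_inv)
    qed
    have cS: "continuous_on ?S q" "continuous_on ?S q'"
      by (rule continuous_on_subset[OF cq] continuous_on_subset[OF q(3)]; auto)+
    have "continuous_on (trans_dom c c') (?D i)" for i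
      using trans_Ck[OF c c', of 1] by (simp add: One_nat_def)
    from continuous_on_compose2[OF this cS(1) qT]
    have "continuous_on ?S (\<lambda>s. \<Sum>i\<in>Basis. (q' s \<bullet> i) *\<^sub>R ?D i (q s))"
      by (intro continuous_intros cS)
    then show "continuous_on ?S (\<lambda>s. Jac c c' (?\<gamma> s) (q' s))"
    proof (rule continuous_on_eq)
      fix s assume s: "s \<in> ?S"
      have "transition c c' differentiable (at (q s))"
        using trans_Ck[OF c c', of 1] qT s by (auto simp: One_nat_def)
      moreover have "chart_map c (?\<gamma> s) = q s" using s q c chart_map_inv by auto
      ultimately show "(\<Sum>i\<in>Basis. (q' s \<bullet> i) *\<^sub>R ?D i (q s)) = Jac c c' (?\<gamma> s) (q' s)"
        unfolding Jac_def by (subst frechet_derivative_basis_expansion) auto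
    qed
  qed
qed

lemma tangent_lift_in_chart:
  assumes c: "c \<in> A" and s: "s \<in> {a<..<b}" and q: "\<And>s. s \<in> {a..b} \<Longrightarrow> q s \<in> chart_codom c"
    "\<And>s. s \<in> {a..b} \<Longrightarrow> (q has_vector_derivative q' s) (at s within {a..b})"
  shows "tangent_lift A (\<lambda>s. chart_inv c (q s)) s = TM_point A c (q s, q' s)"
proof -
  let ?\<gamma> = "\<lambda>s. chart_inv c (q s)"
  have at: "at s within {a..b} = at s" using s by (simp add: at_within_Icc_at)
  have cq: "continuous_on {a..b} q"
    using q(2) by (meson continuous_on_vector_derivative)
  have c\<gamma>: "continuous_on {a..b} ?\<gamma>"
    by (rule continuous_on_compose2[OF continuous_on_chart_inv[OF c] cq]) (use q in auto)
  have s': "s \<in> {a..b}" using s by simp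
  have "(chart_map c \<circ> ?\<gamma> has_vector_derivative q' s) (at s within {a..b})"
    by (rule has_vector_derivative_transform[OF s' _ q(2)[OF s']]) (use q c chart_map_inv in auto)
  moreover have "isCont ?\<gamma> s" using c\<gamma> s' at by (metis continuous_on_eq_continuous_within)
  ultimately have "tangent_lift A ?\<gamma> s = (?\<gamma> s, tvec_of A c (?\<gamma> s) (q' s))"
    using c q(1)[OF s'] at by (intro tangent_lift_eq) (auto simp: chart_inv_in_dom)
  then show ?thesis by (simp add: TM_point_def)
qed

end

section \<open>Symmetric Tonelli Lagrangians\<close>

locale symmetric_lagrangian = manifold A
  for A :: "('a::t2_space, 'e::euclidean_space) chart set" +
  fixes g :: "'a \<Rightarrow> ('a, 'e) tvec \<Rightarrow> ('a, 'e) tvec \<Rightarrow> real"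
    and L :: "'a \<times> ('a, 'e) tvec \<Rightarrow> real"
  assumes tonelli: "tonelli_lagrangian A g L" and symm: "symmetrical_lagrangian A L"
begin

abbreviation lr :: "('a, 'e) chart \<Rightarrow> 'e \<times> 'e \<Rightarrow> real" where "lr \<equiv> local_rep A L"

text \<open>Taken from the joint derivative in position and velocity, so that C^1 dependence on both
  follows at once from the C^2 assumption; \<open>L_v_eq\<close> identifies it with
  \<open>L_v\<close>.\<close>

definition lr_v :: "('a, 'e) chart \<Rightarrow> 'e \<Rightarrow> 'e \<times> 'e \<Rightarrow> real" where
  "lr_v c u z = frechet_derivative (lr c) (at z) (0, u)"

lemma lr_C2: "c \<in> A \<Longrightarrow> Ck_on (Suc 1) (lr c) (chart_codom c \<times> UNIV)"
  using tonelli unfolding tonelli_lagrangian_def by (metis Suc_1)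

lemma lr_v_C1: "c \<in> A \<Longrightarrow> Ck_on 1 (lr_v c u) (chart_codom c \<times> UNIV)"
  using lr_C2[of c] unfolding lr_v_def[abs_def] by simp

lemma continuous_on_lr: "c \<in> A \<Longrightarrow> continuous_on (chart_codom c \<times> UNIV) (lr c)"
  using lr_C2 Ck_on_imp_continuous by blast

lemma lr_has_derivative:
  "c \<in> A \<Longrightarrow> p \<in> chart_codom c \<Longrightarrow> ((\<lambda>w. lr c (p, w)) has_derivative (\<lambda>u. lr_v c u (p, w))) (at w)"
proof -
  assume c: "c \<in> A" "p \<in> chart_codom c"
  have "((\<lambda>w. (p, w)) has_derivative (\<lambda>u. (0, u))) (at w)" by (auto intro!: derivative_eq_intros)
  moreover have "(lr c has_derivative frechet_derivative (lr c) (at (p, w))) (at (p, w))"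
    by (rule Ck_on_has_derivative[OF lr_C2[OF c(1)]]) (use c in simp)
  ultimately have "(lr c \<circ> (\<lambda>w. (p, w)) has_derivative frechet_derivative (lr c) (at (p, w)) \<circ> (\<lambda>u. (0, u))) (at w)"
    by (rule diff_chain_at)
  then show ?thesis by (simp add: o_def lr_v_def)
qed

lemma L_v_eq: "c \<in> A \<Longrightarrow> p \<in> chart_codom c \<Longrightarrow> L_v A L c p w u = lr_v c u (p, w)"
  unfolding L_v_def using frechet_derivative_at[OF lr_has_derivative] by metis

lemma lr_v_differentiable:
  assumes c: "c \<in> A" "p \<in> chart_codom c"
  shows "((\<lambda>w. lr_v c u (p, w)) has_derivative (\<lambda>v. frechet_derivative (lr_v c u) (at (p, w)) (0, v))) (at w)"
proof -
  have "((\<lambda>w. (p, w)) has_derivative (\<lambda>u. (0, u))) (at w)" by (auto intro!: derivative_eq_intros)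
  moreover have "(lr_v c u has_derivative frechet_derivative (lr_v c u) (at (p, w))) (at (p, w))"
    using lr_v_C1[OF c(1), of u] c by (intro Ck_on_has_derivative[of 0 _ "chart_codom c \<times> UNIV"]) (simp_all add: One_nat_def)
  ultimately have "(lr_v c u \<circ> (\<lambda>w. (p, w)) has_derivative frechet_derivative (lr_v c u) (at (p, w)) \<circ> (\<lambda>u. (0, u))) (at w)"
    by (rule diff_chain_at)
  then show ?thesis by (simp add: o_def)
qed

lemma lr_v_sum:
  assumes c: "c \<in> A" "p \<in> chart_codom c"
  shows "lr_v c u (p, w) = (\<Sum>b\<in>Basis. (u \<bullet> b) * lr_v c b (p, w))"
proof -
  have d: "(\<lambda>u. lr_v c u (p, w)) = frechet_derivative (\<lambda>w. lr c (p, w)) (at w)"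
    by (rule frechet_derivative_at[OF lr_has_derivative[OF c]])
  have "(\<lambda>w. lr c (p, w)) differentiable (at w)"
    using lr_has_derivative[OF c] by (auto simp: differentiable_def)
  from frechet_derivative_basis_expansion[OF this, of u] show ?thesis
    unfolding d[symmetric] by simp
qed

lemma lr_sym: assumes c: "c \<in> A" "p \<in> chart_codom c" shows "lr c (p, - w) = lr c (p, w)"
proof -
  let ?x = "chart_inv c p" and ?v = "tvec_of A c (chart_inv c p) w"
  have x: "?x \<in> chart_dom c" using c by (rule chart_inv_in_dom)
  have "(?x, ?v) \<in> tangent_bundle A"
    by (simp add: tangent_bundle_def tvec_of_in_tangent_space[OF c(1) x])
  then have "L (?x, ?v) = L (?x, - ?v)" using symm unfolding symmetrical_lagrangian_def by blast
  then show ?thesis by (simp add: local_rep_eq tvec_of_minus[OF c(1) x])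
qed

text \<open>On each line through 0 the Lagrangian is even, so its derivative at 0 vanishes. Symmetry
  enters the estimates through this identity.\<close>

lemma lr_v_0: assumes c: "c \<in> A" "p \<in> chart_codom c" shows "lr_v c u (p, 0) = 0"
proof -
  let ?h = "\<lambda>s. lr c (p, s *\<^sub>R u)"
  have 1: "(?h has_real_derivative lr_v c u (p, 0)) (at 0)"
    using has_real_derivative_ray[where s=0 and w=u, OF lr_has_derivative[OF c]] by simp
  have "((\<lambda>s. ?h (- s)) has_real_derivative - lr_v c u (p, 0)) (at 0)"
    using DERIV_mirror[where f="?h" and x=0 and y="lr_v c u (p, 0)"] 1 by simp
  moreover have "(\<lambda>s. ?h (- s)) = ?h" using lr_sym[OF c] by auto
  ultimately show ?thesis using 1 DERIV_unique by fastforce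
qed

lemma lr_ray:
  assumes c: "c \<in> A" "p \<in> chart_codom c" and w: "w \<noteq> 0"
  obtains h'' where
    "\<And>s. ((\<lambda>s. lr c (p, s *\<^sub>R w)) has_real_derivative lr_v c w (p, s *\<^sub>R w)) (at s)"
    "\<And>s. ((\<lambda>s. lr_v c w (p, s *\<^sub>R w)) has_real_derivative h'' s) (at s)"
    "\<And>s. h'' s > 0"
proof -
  have 1: "((\<lambda>s. lr c (p, s *\<^sub>R w)) has_real_derivative lr_v c w (p, s *\<^sub>R w)) (at s)" for s
    by (rule has_real_derivative_ray[OF lr_has_derivative[OF c]])
  have 2: "((\<lambda>s. lr_v c w (p, s *\<^sub>R w)) has_real_derivative
      frechet_derivative (\<lambda>w'. L_v A L c p w' w) (at (s *\<^sub>R w)) w) (at s)" for s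
  proof -
    have "((\<lambda>w'. lr_v c w (p, w')) has_derivative frechet_derivative (\<lambda>w'. L_v A L c p w' w) (at (s *\<^sub>R w))) (at (s *\<^sub>R w))"
      unfolding L_v_eq[OF c] using lr_v_differentiable[OF c] by (meson differentiableI frechet_derivative_works)
    then show ?thesis by (rule has_real_derivative_ray)
  qed
  have 3: "frechet_derivative (\<lambda>w'. L_v A L c p w' w) (at (s *\<^sub>R w)) w > 0" for s
    using tonelli c w unfolding tonelli_lagrangian_def by blast
  show ?thesis by (rule that[OF 1 2 3])
qed

text \<open>Along a ray the derivative starts at 0 and, the second derivative being positive,
  increases strictly.\<close>

lemma lr_gt: assumes c: "c \<in> A" "p \<in> chart_codom c" and w: "w \<noteq> 0" shows "lr c (p, 0) < lr c (p, w)"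
proof -
  obtain h'' where h: "\<And>s. ((\<lambda>s. lr c (p, s *\<^sub>R w)) has_real_derivative lr_v c w (p, s *\<^sub>R w)) (at s)"
    "\<And>s. ((\<lambda>s. lr_v c w (p, s *\<^sub>R w)) has_real_derivative h'' s) (at s)" "\<And>s. h'' s > 0"
    by (rule lr_ray[OF c w]) blast
  obtain s where s: "0 < s" "s < (1::real)" "lr c (p, 1 *\<^sub>R w) - lr c (p, 0 *\<^sub>R w) = (1 - 0) * lr_v c w (p, s *\<^sub>R w)"
    using MVT2[of 0 1 "\<lambda>s. lr c (p, s *\<^sub>R w)", OF zero_less_one h(1)] by blast
  have "lr_v c w (p, 0 *\<^sub>R w) < lr_v c w (p, s *\<^sub>R w)"
    by (rule DERIV_pos_imp_increasing[OF s(1)]) (use h in blast)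
  then show ?thesis using s(3) lr_v_0[OF c] by simp
qed

lemma lr_ge: "c \<in> A \<Longrightarrow> p \<in> chart_codom c \<Longrightarrow> lr c (p, 0) \<le> lr c (p, w)"
  using lr_gt[of c p w] by (cases "w = 0") auto

text \<open>Convexity at the point w / |w| of the segment from 0 to w: beyond the unit sphere growth
  is at least linear, with a slope read off on the sphere and hence controllable over compact sets
  of base points.\<close>

lemma lr_growth:
  assumes c: "c \<in> A" "p \<in> chart_codom c" and w: "norm w \<ge> 1"
  shows "norm w * (lr c (p, w /\<^sub>R norm w) - lr c (p, 0)) \<le> lr c (p, w) - lr c (p, 0)"
proof -
  have w0: "w \<noteq> 0" using w by auto
  obtain h'' where h: "\<And>s. ((\<lambda>s. lr c (p, s *\<^sub>R w)) has_real_derivative lr_v c w (p, s *\<^sub>R w)) (at s)"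
    "\<And>s. ((\<lambda>s. lr_v c w (p, s *\<^sub>R w)) has_real_derivative h'' s) (at s)" "\<And>s. h'' s > 0"
    by (rule lr_ray[OF c w0]) blast
  have "convex_on UNIV (\<lambda>s. lr c (p, s *\<^sub>R w))"
    by (rule f''_ge0_imp_convex[OF _ h(1,2)]) (use h(3) less_imp_le in auto)
  from convex_onD[OF this, of "1 / norm w" 0 1]
  have "lr c (p, w /\<^sub>R norm w) \<le> (1 - 1 / norm w) * lr c (p, 0) + (1 / norm w) * lr c (p, w)"
    using w inverse_le_1_iff[of "norm w"] by (simp add: divide_inverse)
  then have "norm w * lr c (p, w /\<^sub>R norm w) \<le> norm w * ((1 - 1 / norm w) * lr c (p, 0) + (1 / norm w) * lr c (p, w))"
    by (rule mult_left_mono) simp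
  also have "\<dots> = (norm w - 1) * lr c (p, 0) + lr c (p, w)"
    using w0 by (simp add: field_simps)
  finally show ?thesis by (simp add: algebra_simps)
qed

text \<open>Two regimes: inside the unit ball the gap \<open>c0\<close> of the potential alone is
  enough; outside, the slope is the least increase from zero velocity to the unit sphere, positive
  by compactness and strict minimality at 0.\<close>

lemma lr_coercive:
  assumes c: "c \<in> A" and Q: "compact Q" "Q \<subseteq> chart_codom c" and pos: "c0 > 0" "\<And>p. p \<in> Q \<Longrightarrow> m + c0 \<le> lr c (p, 0)"
  obtains a where "a > 0" "\<And>p w. p \<in> Q \<Longrightarrow> a * norm w \<le> lr c (p, w) - m"
proof -
  obtain b where b: "b > 0" "\<And>p w. p \<in> Q \<Longrightarrow> norm w = 1 \<Longrightarrow> b \<le> lr c (p, w) - lr c (p, 0)"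
  proof (cases "Q \<times> sphere (0::'e) 1 = {}")
    case True then show ?thesis using that[of 1] by auto
  next
    case False
    let ?f = "\<lambda>z. lr c z - lr c (fst z, 0)"
    have "continuous_on (Q \<times> sphere 0 1) ?f"
    proof (intro continuous_on_diff)
      show "continuous_on (Q \<times> sphere 0 1) (lr c)"
        by (rule continuous_on_subset[OF continuous_on_lr[OF c]]) (use Q in auto)
      show "continuous_on (Q \<times> sphere 0 1) (\<lambda>z. lr c (fst z, 0))"
        by (rule continuous_on_compose2[OF continuous_on_lr[OF c]]) (use Q in \<open>auto intro!: continuous_intros\<close>)
    qed
    then obtain z where z: "z \<in> Q \<times> sphere 0 1" "\<And>z'. z' \<in> Q \<times> sphere 0 1 \<Longrightarrow> ?f z \<le> ?f z'"
      using continuous_attains_inf[of "Q \<times> sphere 0 1" ?f] False compact_Times[OF Q(1) compact_sphere] by blast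
    obtain p w where pw: "z = (p, w)" "p \<in> Q" "norm w = 1" using z(1) by auto
    have "w \<noteq> 0" using pw(3) by auto
    then have "?f z > 0" using lr_gt[OF c subsetD[OF Q(2) pw(2)]] pw(1) by simp
    then show ?thesis
    proof (rule that)
      fix p w assume "p \<in> Q" "norm (w :: 'e) = 1"
      then show "?f z \<le> lr c (p, w) - lr c (p, 0)" using z(2)[of "(p, w)"] by simp
    qed
  qed
  show ?thesis
  proof
    show "min b c0 > 0" using b pos by simp
    fix p w :: 'e assume p: "p \<in> Q"
    have pc: "p \<in> chart_codom c" using p Q by blast
    show "min b c0 * norm w \<le> lr c (p, w) - m"
    proof (cases "norm w \<le> 1")
      case True
      have "min b c0 * norm w \<le> c0 * 1" using True b pos by (intro mult_mono) auto
      then show ?thesis using pos(2)[OF p] lr_ge[OF c pc, of w] by simp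
    next
      case False
      have "min b c0 * norm w \<le> b * norm w" by (intro mult_right_mono) auto
      also have "\<dots> \<le> norm w * (lr c (p, w /\<^sub>R norm w) - lr c (p, 0))"
      proof -
        have "w \<noteq> 0" using False by auto
        then have "b \<le> lr c (p, w /\<^sub>R norm w) - lr c (p, 0)" by (intro b(2)[OF p]) simp
        then show ?thesis by (subst mult.commute) (rule mult_left_mono, simp_all)
      qed
      also have "\<dots> \<le> lr c (p, w) - lr c (p, 0)" using lr_growth[OF c pc] False by simp
      finally show ?thesis using pos(2)[OF p] pos(1) by simp
    qed
  qed
qed

text \<open>The velocity derivative vanishes at velocity 0 and, by compactness, grows at most
  linearly in \<open>norm w\<close> uniformly over \<open>Q\<close>; a second use of the mean value
  theorem makes the bound quadratic. This is why slow curves have a small kinetic cost.\<close>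

lemma lr_quadratic_upper:
  assumes c: "c \<in> A" and Q: "compact Q" "Q \<subseteq> chart_codom c"
  obtains C where "C \<ge> 0" "\<And>p w. p \<in> Q \<Longrightarrow> norm w \<le> 1 \<Longrightarrow> lr c (p, w) \<le> lr c (p, 0) + C * (norm w)\<^sup>2"
proof -
  let ?K = "Q \<times> cball (0::'e) 1"
  have "\<exists>K>0. \<forall>z\<in>?K. \<forall>v. norm (frechet_derivative (lr_v c b) (at z) v) \<le> K * norm v" for b
    by (rule Ck_on_bounded_derivative[OF lr_v_C1[OF c, of b], of ?K])
      (use Q in \<open>auto intro!: compact_Times\<close>)
  then obtain K where K: "\<And>b. K b > 0"
    "\<And>b p w v. p \<in> Q \<Longrightarrow> norm w \<le> 1 \<Longrightarrow> norm (frechet_derivative (lr_v c b) (at (p, w)) v) \<le> K b * norm v"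
    by (metis mem_Sigma_iff mem_cball_0)
  have vb: "\<bar>lr_v c b (p, w)\<bar> \<le> K b * norm w" if pw: "p \<in> Q" "norm w \<le> 1" for b p w
  proof -
    have pc: "p \<in> chart_codom c" using pw Q by blast
    obtain s where s: "0 < s" "s < (1::real)" "lr_v c b (p, 1 *\<^sub>R w) - lr_v c b (p, 0 *\<^sub>R w)
        = (1 - 0) * frechet_derivative (lr_v c b) (at (p, s *\<^sub>R w)) (0, w)"
      using MVT2[of 0 1 "\<lambda>s. lr_v c b (p, s *\<^sub>R w)", OF zero_less_one has_real_derivative_ray[OF lr_v_differentiable[OF c pc]]]
      by blast
    have "norm (s *\<^sub>R w) \<le> 1" using s pw by (simp add: mult_le_one)
    from K(2)[OF pw(1) this, of b "(0, w)"] show ?thesis using s(3) lr_v_0[OF c pc] by simp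
  qed
  show ?thesis
  proof
    show "(\<Sum>b\<in>Basis. K b) \<ge> 0" using K(1) less_imp_le by (intro sum_nonneg) auto
    fix p w :: 'e assume pw: "p \<in> Q" "norm w \<le> 1"
    have pc: "p \<in> chart_codom c" using pw Q by blast
    obtain s where s: "0 < s" "s < (1::real)" "lr c (p, 1 *\<^sub>R w) - lr c (p, 0 *\<^sub>R w) = (1 - 0) * lr_v c w (p, s *\<^sub>R w)"
      using MVT2[of 0 1 "\<lambda>s. lr c (p, s *\<^sub>R w)", OF zero_less_one has_real_derivative_ray[OF lr_has_derivative[OF c pc]]]
      by blast
    have sw: "norm (s *\<^sub>R w) \<le> norm w" using s by (simp add: mult_left_le_one_le)
    have "lr c (p, w) - lr c (p, 0) = (\<Sum>b\<in>Basis. (w \<bullet> b) * lr_v c b (p, s *\<^sub>R w))"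
      using s(3) lr_v_sum[OF c pc, of w "s *\<^sub>R w"] by simp
    also have "\<dots> \<le> (\<Sum>b\<in>Basis. K b * (norm w)\<^sup>2)"
    proof (rule sum_mono)
      fix b :: 'e assume b: "b \<in> Basis"
      have "(w \<bullet> b) * lr_v c b (p, s *\<^sub>R w) \<le> \<bar>w \<bullet> b\<bar> * \<bar>lr_v c b (p, s *\<^sub>R w)\<bar>"
        by (metis abs_ge_self abs_mult)
      also have "\<dots> \<le> norm w * (K b * norm (s *\<^sub>R w))"
        using vb[OF pw(1), of "s *\<^sub>R w" b] sw pw Basis_le_norm[OF b, of w] by (intro mult_mono) auto
      also have "\<dots> \<le> norm w * (K b * norm w)"
        using sw K(1)[of b] by (intro mult_left_mono) auto
      finally show "(w \<bullet> b) * lr_v c b (p, s *\<^sub>R w) \<le> K b * (norm w)\<^sup>2"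
        by (simp add: power2_eq_square algebra_simps)
    qed
    finally show "lr c (p, w) \<le> lr c (p, 0) + (\<Sum>b\<in>Basis. K b) * (norm w)\<^sup>2"
      by (simp add: sum_distrib_right)
  qed
qed

lemma lr_0: "c \<in> A \<Longrightarrow> x \<in> chart_dom c \<Longrightarrow> lr c (chart_map c x, 0) = L (x, \<lambda>_. 0)"
  by (simp add: local_rep_chart_map tvec_of_0)

end

section \<open>Actions of paths\<close>

context symmetric_lagrangian
begin

text \<open>At break points the two-sided derivative in \<open>tangent_lift\<close> need not exist.
  \<open>F\<close> uses the one-sided velocity, is therefore continuous up to the end points, and
  can differ from the integrand only there; integrability follows.\<close>

lemma C1_curve_lagrangian:
  assumes \<gamma>: "C1_curve_on A \<gamma> {a..b}" and ab: "a < b"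
  shows "\<exists>F. continuous_on {a..b} F \<and> (\<forall>s\<in>{a<..<b}. F s = L (tangent_lift A \<gamma> s))"
proof -
  obtain v where v: "continuous_on {a..b} \<gamma>"
    "\<And>c s. c \<in> A \<Longrightarrow> s \<in> {a..b} \<Longrightarrow> \<gamma> s \<in> chart_dom c
      \<Longrightarrow> (chart_map c \<circ> \<gamma> has_vector_derivative v c s) (at s within {a..b})"
    "\<And>c. c \<in> A \<Longrightarrow> continuous_on {s\<in>{a..b}. \<gamma> s \<in> chart_dom c} (v c)"
    using C1_curveD[OF \<gamma>] by blast
  define F where "F s = L (\<gamma> s, \<lambda>c'. if c' \<in> A \<and> \<gamma> s \<in> chart_dom c'
     then vector_derivative (chart_map c' \<circ> \<gamma>) (at s within {a..b}) else 0)" for s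
  have F_eq: "F s = lr c (chart_map c (\<gamma> s), v c s)" if c: "c \<in> A" and s: "s \<in> {a..b}" "\<gamma> s \<in> chart_dom c" for c s
  proof -
    have "at s within {a..b} \<noteq> bot" using s ab by (simp add: trivial_limit_within islimpt_Icc)
    moreover have "continuous (at s within {a..b}) \<gamma>" using v(1) s by (simp add: continuous_on_eq_continuous_within)
    ultimately have "F s = L (\<gamma> s, tvec_of A c (\<gamma> s) (v c s))"
      unfolding F_def by (subst lift_within_eq[OF c s(2,1) _ _ v(2)[OF c s]]) auto
    then show ?thesis by (simp add: local_rep_chart_map[OF c s(2)])
  qed
  have "continuous_on {a..b} F"
    unfolding continuous_on_eq_continuous_within
  proof
    fix s assume s: "s \<in> {a..b}"
    obtain c where c: "c \<in> A" "\<gamma> s \<in> chart_dom c" by (rule chart_exists)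
    let ?J = "{s\<in>{a..b}. \<gamma> s \<in> chart_dom c}"
    have cm: "continuous_on ?J (\<lambda>s. (chart_map c (\<gamma> s), v c s))"
      by (intro continuous_on_Pair v(3)[OF c(1)] continuous_on_compose2[OF continuous_on_chart_map[OF c(1)] continuous_on_subset[OF v(1)]])
        auto
    have "continuous_on ?J (\<lambda>s. lr c (chart_map c (\<gamma> s), v c s))"
      by (rule continuous_on_compose2[OF continuous_on_lr[OF c(1)] cm])
        (use chart_map_in_codom[OF c(1)] in auto)
    then have "continuous_on ?J F" by (rule continuous_on_eq) (use F_eq[OF c(1)] in simp)
    then have "continuous (at s within ?J) F" using s c by (simp add: continuous_on_eq_continuous_within)
    moreover obtain T where T: "open T" "T \<inter> {a..b} = \<gamma> -` chart_dom c \<inter> {a..b}"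
      using v(1) open_chart_dom[OF c(1)] unfolding continuous_on_open_invariant by metis
    have "at s within ?J = at s within {a..b}"
    proof (rule at_within_nhd[of s T])
      show "open T" by fact
      have J: "?J = T \<inter> {a..b}" unfolding T(2) by auto
      have "s \<in> ?J" using s c by simp
      then show "s \<in> T" unfolding J by simp
      show "?J \<inter> T - {s} = {a..b} \<inter> T - {s}" unfolding J by auto
    qed
    ultimately show "continuous (at s within {a..b}) F" by (simp add: continuous_within)
  qed
  moreover have "F s = L (tangent_lift A \<gamma> s)" if "s \<in> {a<..<b}" for s
    unfolding F_def tangent_lift_def using that by (simp add: at_within_Icc_at cong: if_cong)
  ultimately show ?thesis by blast
qed

lemma piecewise_action_exists:
  assumes "piecewise_C1_path A a b \<gamma>"
  shows "(\<lambda>s. L (tangent_lift A \<gamma> s)) integrable_on {a..b}"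
  using assms
proof (induction rule: piecewise_induct)
  case refl show ?case using integrable_on_refl[of _ a] by simp
next
  case (snoc b c)
  obtain F where F: "continuous_on {b..c} F" "\<forall>s\<in>{b<..<c}. F s = L (tangent_lift A \<gamma> s)"
    using C1_curve_lagrangian[OF snoc(5,3)] by blast
  have "F integrable_on {b..c}" using F(1) integrable_continuous_interval by blast
  then have "(\<lambda>s. L (tangent_lift A \<gamma> s)) integrable_on {b..c}"
    by (rule integrable_spike_finite[of "{b, c}", rotated 2]) (use F(2) in auto)
  then show ?case by (rule Henstock_Kurzweil_Integration.integrable_combine[OF snoc(2) less_imp_le[OF snoc(3)] snoc(6)])
qed

text \<open>A comparison principle for subsolutions: if \<open>\<rho>\<close> grows no faster than
  the Lagrangian along the path, its increment bounds the action from below. \<open>X\<close>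
  absorbs kinks of \<open>\<rho>\<close>. The premise offers a velocity in every chart around the
  point, so each application can pick its chart.\<close>

lemma action_ge:
  assumes \<gamma>: "piecewise_C1_path A a b \<gamma>" and X: "finite X" and \<rho>: "continuous_on {a..b} \<rho>"
    and der: "\<And>s. s \<in> {a<..<b} \<Longrightarrow> s \<notin> X \<Longrightarrow> isCont \<gamma> s \<Longrightarrow>
      (\<And>c. c \<in> A \<Longrightarrow> \<gamma> s \<in> chart_dom c \<Longrightarrow> \<exists>w. (chart_map c \<circ> \<gamma> has_vector_derivative w) (at s) \<and>
         L (tangent_lift A \<gamma> s) = lr c (chart_map c (\<gamma> s), w)) \<Longrightarrow>
      \<exists>D. (\<rho> has_real_derivative D) (at s) \<and> D \<le> L (tangent_lift A \<gamma> s)"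
  shows "\<rho> b - \<rho> a \<le> integral {a..b} (\<lambda>s. L (tangent_lift A \<gamma> s))"
  using \<gamma>
proof (induction rule: piecewise_induct)
  case (snoc b' c)
  let ?F = "\<lambda>s. L (tangent_lift A \<gamma> s)"
  have int: "?F integrable_on {a..c}" "?F integrable_on {b'..c}"
    using piecewise_action_exists[OF piecewise_snoc[OF snoc(1,3,5)]] integrable_on_subinterval snoc(2)
      piecewise_action_exists[OF piecewise_single[OF snoc(3,5)]] by auto
  have "\<exists>D. (\<rho> has_real_derivative D) (at s) \<and> D \<le> ?F s" if s: "s \<in> {b'<..<c} - X" for s
  proof (rule der)
    obtain c0 where c0: "c0 \<in> A" "\<gamma> s \<in> chart_dom c0" by (rule chart_exists)
    show cont: "isCont \<gamma> s" by (rule C1_curve_interior[OF snoc(5) _ c0]) (use s in auto)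
    fix c1 assume c: "c1 \<in> A" "\<gamma> s \<in> chart_dom c1"
    obtain w where w: "(chart_map c1 \<circ> \<gamma> has_vector_derivative w) (at s)"
      by (rule C1_curve_interior[OF snoc(5) _ c]) (use s in auto)
    then show "\<exists>w. (chart_map c1 \<circ> \<gamma> has_vector_derivative w) (at s) \<and>
         L (tangent_lift A \<gamma> s) = lr c1 (chart_map c1 (\<gamma> s), w)"
      using tangent_lift_eq[OF c cont w] local_rep_chart_map[OF c] by metis
  qed (use s snoc in auto)
  then obtain D where D: "\<And>s. s \<in> {b'<..<c} - X \<Longrightarrow> (\<rho> has_real_derivative D s) (at s)"
    "\<And>s. s \<in> {b'<..<c} - X \<Longrightarrow> D s \<le> ?F s" by metis
  have Di: "(D has_integral (\<rho> c - \<rho> b')) {b'..c}"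
    by (rule fundamental_theorem_of_calculus_interior_strong[OF X])
      (use D(1) snoc \<rho> in \<open>auto simp: has_real_derivative_iff_has_vector_derivative intro: continuous_on_subset\<close>)
  \<comment> \<open>\<open>D\<close> is controlled only off \<open>X\<close> and the end points;
    resetting it to the Lagrangian on this finite set gives an inequality at every point and leaves
    the integral unchanged.\<close>
  let ?D = "\<lambda>s. if s \<in> X \<union> {b', c} then ?F s else D s"
  have "(?D has_integral (\<rho> c - \<rho> b')) {b'..c}"
    by (rule has_integral_spike_finite[OF _ _ Di, of "X \<union> {b', c}"]) (use X in auto)
  moreover have "(?F has_integral integral {b'..c} ?F) {b'..c}" using int by blast
  ultimately have "\<rho> c - \<rho> b' \<le> integral {b'..c} ?F"
    by (rule has_integral_le) (use D(2) in auto)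
  moreover have "integral {a..b'} ?F + integral {b'..c} ?F = integral {a..c} ?F"
    using snoc int by (intro Henstock_Kurzweil_Integration.integral_combine) auto
  ultimately show ?case using snoc(6) by linarith
qed simp

text \<open>A relation between times and attained values, so that arguments about infima and limits
  can work with numbers in place of paths.\<close>

definition action :: "real \<Rightarrow> 'a \<Rightarrow> 'a \<Rightarrow> real \<Rightarrow> bool" where
  "action T x y k \<longleftrightarrow> T > 0 \<and> (\<exists>\<gamma>. piecewise_C1_path A 0 T \<gamma> \<and> \<gamma> 0 = x \<and> \<gamma> T = y \<and>
     k = integral {0..T} (\<lambda>s. L (tangent_lift A \<gamma> s)))"

lemma min_action_eq:
  assumes "T > 0"
  shows "min_action A L zero_form T x y = (INF k\<in>{k. action T x y k}. ereal k)"
proof -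
  have "{k. action T x y k} = (\<lambda>\<gamma>. integral {0..T} (\<lambda>s. L (tangent_lift A \<gamma> s))) `
      {\<gamma>. piecewise_C1_path A 0 T \<gamma> \<and> \<gamma> 0 = x \<and> \<gamma> T = y}"
    using assms by (auto simp: action_def)
  then show ?thesis by (simp add: min_action_def L_minus_def zero_form_def image_image)
qed

lemma action_concat:
  assumes "action S x y j" "action T y z k" shows "action (S + T) x z (j + k)"
proof -
  obtain \<gamma>1 where 1: "S > 0" "piecewise_C1_path A 0 S \<gamma>1" "\<gamma>1 0 = x" "\<gamma>1 S = y"
    "j = integral {0..S} (\<lambda>s. L (tangent_lift A \<gamma>1 s))" using assms(1) by (auto simp: action_def)
  obtain \<gamma>2 where 2: "T > 0" "piecewise_C1_path A 0 T \<gamma>2" "\<gamma>2 0 = y" "\<gamma>2 T = z"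
    "k = integral {0..T} (\<lambda>s. L (tangent_lift A \<gamma>2 s))" using assms(2) by (auto simp: action_def)
  let ?\<gamma>2 = "\<lambda>s. \<gamma>2 (s - S)"
  define \<gamma> where "\<gamma> s = (if s \<le> S then \<gamma>1 s else ?\<gamma>2 s)" for s
  have p1: "piecewise_C1_path A 0 S \<gamma>" by (rule piecewise_cong[OF 1(2)]) (simp add: \<gamma>_def)
  have "piecewise_C1_path A S (S + T) ?\<gamma>2" using piecewise_shift[OF 2(2), of S] by (simp add: add.commute)
  then have p2: "piecewise_C1_path A S (S + T) \<gamma>"
    by (rule piecewise_cong) (use 1 2 in \<open>auto simp: \<gamma>_def\<close>)
  have p: "piecewise_C1_path A 0 (S + T) \<gamma>" by (rule piecewise_trans[OF p2 p1])
  have "((\<lambda>s. L (tangent_lift A \<gamma>1 s)) has_integral j) {0..S}"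
    using piecewise_action_exists[OF 1(2)] 1(5) by blast
  then have i1: "((\<lambda>s. L (tangent_lift A \<gamma> s)) has_integral j) {0..S}"
  proof (rule has_integral_spike_finite[of "{0, S}", rotated 2])
    fix s assume "s \<in> {0..S} - {0, S}"
    then have "tangent_lift A \<gamma> s = tangent_lift A \<gamma>1 s"
      by (intro tangent_lift_cong_open[of "{..<S}"]) (auto simp: \<gamma>_def)
    then show "L (tangent_lift A \<gamma> s) = L (tangent_lift A \<gamma>1 s)" by simp
  qed simp
  have "((\<lambda>s. L (tangent_lift A \<gamma>2 s)) has_integral k) {0..T}"
    using piecewise_action_exists[OF 2(2)] 2(5) by blast
  then have "((\<lambda>s. L (tangent_lift A \<gamma>2 (s - S))) has_integral k) {S..S + T}"
    using has_integral_shift_real_ivl[of "\<lambda>s. L (tangent_lift A \<gamma>2 s)" k 0 T "- S"] by (simp add: add.commute)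
  then have i2: "((\<lambda>s. L (tangent_lift A \<gamma> s)) has_integral k) {S..S + T}"
  proof (rule has_integral_spike_finite[of "{S, S + T}", rotated 2])
    fix s assume "s \<in> {S..S + T} - {S, S + T}"
    then have "tangent_lift A \<gamma> s = tangent_lift A ?\<gamma>2 s"
      by (intro tangent_lift_cong_open[of "{S<..}"]) (auto simp: \<gamma>_def)
    then show "L (tangent_lift A \<gamma> s) = L (tangent_lift A \<gamma>2 (s - S))" by (simp add: tangent_lift_shift)
  qed simp
  have "((\<lambda>s. L (tangent_lift A \<gamma> s)) has_integral (j + k)) {0..S + T}"
    by (rule has_integral_combine[OF _ _ i1 i2]) (use 1 2 in auto)
  moreover have "\<gamma> 0 = x" "\<gamma> (S + T) = z" using 1 2 by (auto simp: \<gamma>_def)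
  ultimately show ?thesis unfolding action_def using 1(1) 2(1) p by (metis add_pos_pos integral_unique)
qed

lemma action_in_chart:
  assumes c: "c \<in> A" and T: "T > 0" and q: "\<And>s. s \<in> {0..T} \<Longrightarrow> q s \<in> chart_codom c"
    "\<And>s. s \<in> {0..T} \<Longrightarrow> (q has_vector_derivative q' s) (at s within {0..T})" "continuous_on {0..T} q'"
    and M: "\<And>s. s \<in> {0..T} \<Longrightarrow> lr c (q s, q' s) \<le> M"
  obtains k where "action T (chart_inv c (q 0)) (chart_inv c (q T)) k" "k \<le> M * T"
proof
  let ?\<gamma> = "\<lambda>s. chart_inv c (q s)" and ?k = "integral {0..T} (\<lambda>s. L (tangent_lift A (\<lambda>s. chart_inv c (q s)) s))"
  have p: "piecewise_C1_path A 0 T ?\<gamma>"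
    by (rule piecewise_single[OF T C1_curve_in_chart[OF c T q]])
  then show "action T (?\<gamma> 0) (?\<gamma> T) ?k" using T unfolding action_def by blast
  \<comment> \<open>At 0 and \<open>T\<close> the two-sided derivative involves \<open>q\<close>
    outside the interval, so the integrals are compared over the open interval.\<close>
  have "L (tangent_lift A ?\<gamma> s) \<le> M" if s: "s \<in> {0<..<T}" for s
  proof -
    have "tangent_lift A ?\<gamma> s = TM_point A c (q s, q' s)" by (rule tangent_lift_in_chart[OF c s q(1,2)])
    then show ?thesis using M[of s] s by (simp add: local_rep_def)
  qed
  moreover have "(\<lambda>s. L (tangent_lift A ?\<gamma> s)) integrable_on {0<..<T}"
    using piecewise_action_exists[OF p] by (simp add: integrable_on_Icc_iff_Ioo)
  moreover have "(\<lambda>s. M) integrable_on {0<..<T}"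
    using integrable_const_ivl[of M 0 T] by (simp add: integrable_on_Icc_iff_Ioo)
  ultimately have "integral {0<..<T} (\<lambda>s. L (tangent_lift A ?\<gamma> s)) \<le> integral {0<..<T} (\<lambda>s. M)"
    by (intro integral_le) auto
  then show "?k \<le> M * T" using T by (simp add: mult.commute flip: integral_open_interval_real)
qed

text \<open>Waiting at a point prolongs a path to any prescribed longer time, as the limit of large
  times in the barrier requires.\<close>

lemma action_const:
  assumes T: "T > 0" obtains k where "action T x x k" "k \<le> L (x, \<lambda>_. 0) * T"
proof -
  obtain c where c: "c \<in> A" "x \<in> chart_dom c" by (rule chart_exists)
  obtain k where "action T (chart_inv c (chart_map c x)) (chart_inv c (chart_map c x)) k" "k \<le> L (x, \<lambda>_. 0) * T"
    by (rule action_in_chart[OF c(1) T, of "\<lambda>_. chart_map c x" "\<lambda>_. 0" "L (x, \<lambda>_. 0)"])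
      (use c in \<open>auto simp: chart_map_in_codom lr_0\<close>)
  then show ?thesis using that by (simp add: chart_inv_map[OF c])
qed

text \<open>The free predicate \<open>P\<close> absorbs the derivative clause, so the premise of
  \<open>action_ge\<close> can be passed on as it is.\<close>

lemma lagrangian_lift_ge:
  assumes "\<And>c. c \<in> A \<Longrightarrow> \<gamma> s \<in> chart_dom c \<Longrightarrow> \<exists>w. P c w \<and>
         L (tangent_lift A \<gamma> s) = lr c (chart_map c (\<gamma> s), w)"
  shows "L (\<gamma> s, \<lambda>_. 0) \<le> L (tangent_lift A \<gamma> s)"
proof -
  obtain c where c: "c \<in> A" "\<gamma> s \<in> chart_dom c" by (rule chart_exists)
  obtain w where "L (tangent_lift A \<gamma> s) = lr c (chart_map c (\<gamma> s), w)" using assms[OF c] by blast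
  then show ?thesis using lr_ge[OF c(1) chart_map_in_codom[OF c], of w] lr_0[OF c] by simp
qed

lemma action_ge_min:
  assumes "action T x y k" and m: "\<And>x. m \<le> L (x, \<lambda>_. 0)" shows "m * T \<le> k"
proof -
  obtain \<gamma> where \<gamma>: "T > 0" "piecewise_C1_path A 0 T \<gamma>"
    "k = integral {0..T} (\<lambda>s. L (tangent_lift A \<gamma> s))" using assms(1) by (auto simp: action_def)
  have "(\<lambda>s. m * s) T - (\<lambda>s. m * s) 0 \<le> integral {0..T} (\<lambda>s. L (tangent_lift A \<gamma> s))"
  proof (rule action_ge[OF \<gamma>(2), of "{}"])
    fix s assume "\<And>c. c \<in> A \<Longrightarrow> \<gamma> s \<in> chart_dom c \<Longrightarrow> \<exists>w. (chart_map c \<circ> \<gamma> has_vector_derivative w) (at s) \<and>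
         L (tangent_lift A \<gamma> s) = lr c (chart_map c (\<gamma> s), w)"
    then have "m \<le> L (tangent_lift A \<gamma> s)" using lagrangian_lift_ge m order_trans by meson
    moreover have "((\<lambda>s. m * s) has_real_derivative m) (at s)" by (auto intro!: derivative_eq_intros)
    ultimately show "\<exists>D. ((\<lambda>s. m * s) has_real_derivative D) (at s) \<and> D \<le> L (tangent_lift A \<gamma> s)" by blast
  qed (auto intro!: continuous_intros)
  then show ?thesis using \<gamma> by simp
qed

lemma action_locally_connected:
  obtains N where "open N" "x \<in> N" "\<And>y z. y \<in> N \<Longrightarrow> z \<in> N \<Longrightarrow> \<exists>T k. action T y z k"
proof -
  obtain c where c: "c \<in> A" "x \<in> chart_dom c" by (rule chart_exists)
  obtain \<rho> where \<rho>: "\<rho> > 0" "ball (chart_map c x) \<rho> \<subseteq> chart_codom c"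
    using open_chart_codom[OF c(1)] chart_map_in_codom[OF c] open_contains_ball by blast
  let ?B = "ball (chart_map c x) \<rho>"
  show ?thesis
  proof
    show "open (chart_inv c ` ?B)" by (rule open_chart_inv_image[OF c(1) open_ball \<rho>(2)])
    show "x \<in> chart_inv c ` ?B" using \<rho> chart_inv_map[OF c] by (intro image_eqI[of _ _ "chart_map c x"]) auto
    fix y z assume "y \<in> chart_inv c ` ?B" "z \<in> chart_inv c ` ?B"
    then obtain p p' where pp: "p \<in> ?B" "y = chart_inv c p" "p' \<in> ?B" "z = chart_inv c p'" by auto
    let ?q = "\<lambda>s. p + s *\<^sub>R (p' - p)"
    have qc: "?q s \<in> chart_codom c" if "s \<in> {0..1}" for s
    proof -
      have "?q s = (1 - s) *\<^sub>R p + s *\<^sub>R p'" by (simp add: algebra_simps)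
      then show ?thesis using convexD[OF convex_ball pp(1,3), of "1-s" s] that \<rho> by auto
    qed
    have "continuous_on {0..1} (\<lambda>s. lr c (?q s, p' - p))"
      by (rule continuous_on_compose2[OF continuous_on_lr[OF c(1)]]) (use qc in \<open>auto intro!: continuous_intros\<close>)
    then have "\<exists>M. \<forall>s\<in>{0..1}. lr c (?q s, p' - p) \<le> M"
      using continuous_attains_sup[of "{0..1::real}" "\<lambda>s. lr c (?q s, p' - p)"] by fastforce
    then obtain M where M: "\<And>s. s \<in> {0..1} \<Longrightarrow> lr c (?q s, p' - p) \<le> M" by blast
    obtain k where "action 1 (chart_inv c (?q 0)) (chart_inv c (?q 1)) k"
      by (rule action_in_chart[OF c(1) zero_less_one, of ?q "\<lambda>_. p' - p" M])
        (use qc M in \<open>auto intro!: derivative_eq_intros\<close>)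
    then show "\<exists>T k. action T y z k" using pp by auto
  qed
qed

text \<open>The points reachable from \<open>x\<close> form an open set, and so do the others,
  because in a neighbourhood from \<open>action_locally_connected\<close> any point reaches any
  other.\<close>

lemma action_connected:
  assumes "connected (UNIV :: 'a set)"
  obtains T k where "action T x y k"
proof -
  let ?R = "\<lambda>y. \<exists>T k. action T x y k"
  have trans: "?R z" if "?R y" "\<exists>T k. action T y z k" for y z using that action_concat by meson
  have o1: "open {y. ?R y}"
    unfolding open_subopen[of "{y. ?R y}"]
  proof clarify
    fix y T k assume y: "action T x y k"
    obtain N where N: "open N" "y \<in> N" "\<And>u v. u \<in> N \<Longrightarrow> v \<in> N \<Longrightarrow> \<exists>T k. action T u v k"
      using action_locally_connected[of y] by metis
    then have "N \<subseteq> {y. ?R y}" using y trans by blast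
    then show "\<exists>N. open N \<and> y \<in> N \<and> N \<subseteq> {y. ?R y}" using N by blast
  qed
  have o2: "open (- {y. ?R y})"
    unfolding open_subopen[of "- {y. ?R y}"]
  proof
    fix y assume y: "y \<in> - {y. ?R y}"
    obtain N where N: "open N" "y \<in> N" "\<And>u v. u \<in> N \<Longrightarrow> v \<in> N \<Longrightarrow> \<exists>T k. action T u v k"
      using action_locally_connected[of y] by metis
    then have "N \<subseteq> - {y. ?R y}" using y trans by blast
    then show "\<exists>N. open N \<and> y \<in> N \<and> N \<subseteq> - {y. ?R y}" using N by blast
  qed
  have "?R x"
  proof -
    obtain k where "action 1 x x k" by (rule action_const[OF zero_less_one])
    then show ?thesis by blast
  qed
  then have "?R y" using connectedD[OF assms o1 o2] by blast
  then show ?thesis using that by blast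
qed

text \<open>Traversing the curve in time \<open>l / e\<close>, i.e. at speed at most \<open>e\<close>, balances the
  potential part and the kinetic part of the action.\<close>

lemma action_slow_curve:
  assumes c: "c \<in> A" and Q: "compact Q" "Q \<subseteq> chart_codom c"
  obtains C where "C \<ge> 0"
    "\<And>q q' l e. 0 < l \<Longrightarrow> 0 < e \<Longrightarrow> e \<le> 1 \<Longrightarrow>
       (\<And>s. s \<in> {0..1} \<Longrightarrow> (q has_vector_derivative q' s) (at s within {0..1})) \<Longrightarrow>
       (\<And>s. s \<in> {0..1} \<Longrightarrow> q s \<in> Q \<and> norm (q' s) \<le> l \<and> lr c (q s, 0) - m \<le> e\<^sup>2) \<Longrightarrow>
       continuous_on {0..1} q' \<Longrightarrow>
       \<exists>T k. action T (chart_inv c (q 0)) (chart_inv c (q 1)) k \<and> k - m * T \<le> C * e * l"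
proof -
  obtain C where C: "C \<ge> 0" "\<And>p w. p \<in> Q \<Longrightarrow> norm w \<le> 1 \<Longrightarrow> lr c (p, w) \<le> lr c (p, 0) + C * (norm w)\<^sup>2"
    by (rule lr_quadratic_upper[OF c Q]) blast
  show ?thesis
  proof (rule that[of "1 + C"])
    fix q q' :: "real \<Rightarrow> 'e" and l e :: real
    assume le: "0 < l" "0 < e" "e \<le> 1"
      and d: "\<And>s. s \<in> {0..1} \<Longrightarrow> (q has_vector_derivative q' s) (at s within {0..1})"
      and q: "\<And>s. s \<in> {0..1} \<Longrightarrow> q s \<in> Q \<and> norm (q' s) \<le> l \<and> lr c (q s, 0) - m \<le> e\<^sup>2"
      and cont: "continuous_on {0..1} q'"
    define T where "T = l / e"
    have T: "T > 0" using le by (simp add: T_def)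
    have sT: "s / T \<in> {0..1}" if "s \<in> {0..T}" for s using that T by (simp add: divide_le_eq)
    let ?q = "\<lambda>s. q (s / T)" and ?q' = "\<lambda>s. (1 / T) *\<^sub>R q' (s / T)"
    have "\<exists>k. action T (chart_inv c (?q 0)) (chart_inv c (?q T)) k \<and> k \<le> (m + (1 + C) * e\<^sup>2) * T"
    \<comment> \<open>Per unit of time the excess over \<open>m\<close> is at most
      \<open>e\<^sup>2\<close> from the potential and \<open>C * e\<^sup>2\<close> from the
      velocity, whose norm is at most \<open>e \<le> 1\<close>, within the range of the quadratic
      bound.\<close>
    proof (rule action_in_chart[OF c T, of ?q ?q' "m + (1 + C) * e\<^sup>2"])
      fix s assume s: "s \<in> {0..T}"
      show "?q s \<in> chart_codom c" using q[OF sT[OF s]] Q by blast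
      have im: "(\<lambda>s. s / T) ` {0..T} \<subseteq> {0..1}" using sT by blast
      have "((\<lambda>s. s / T) has_vector_derivative (1 / T)) (at s within {0..T})"
        by (auto intro!: derivative_eq_intros simp: divide_inverse)
      from vector_diff_chain_within[OF this has_vector_derivative_within_subset[OF d[OF sT[OF s]] im]]
      show "(?q has_vector_derivative ?q' s) (at s within {0..T})" by (simp add: o_def)
      have "norm (?q' s) = norm (q' (s / T)) * (e / l)" using T le by (simp add: T_def)
      also have "\<dots> \<le> l * (e / l)" using q[OF sT[OF s]] le by (intro mult_right_mono) auto
      also have "\<dots> = e" using le by simp
      finally have n: "norm (?q' s) \<le> e" .
      then have "lr c (?q s, ?q' s) \<le> lr c (?q s, 0) + C * (norm (?q' s))\<^sup>2"
        using le q[OF sT[OF s]] by (intro C(2)) auto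
      also have "\<dots> \<le> (m + e\<^sup>2) + C * e\<^sup>2"
        using n q[OF sT[OF s]] C(1) by (intro add_mono mult_left_mono power_mono) auto
      finally show "lr c (?q s, ?q' s) \<le> m + (1 + C) * e\<^sup>2" by (simp add: algebra_simps)
    next
      show "continuous_on {0..T} ?q'"
        by (intro continuous_intros continuous_on_compose2[OF cont]) (use sT T in auto)
    qed blast
    then obtain k where k: "action T (chart_inv c (q 0)) (chart_inv c (q 1)) k" "k \<le> (m + (1 + C) * e\<^sup>2) * T"
      using T by auto
    have "(m + (1 + C) * e\<^sup>2) * T = m * T + (1 + C) * e * l"
      using le by (simp add: T_def power2_eq_square algebra_simps)
    then show "\<exists>T k. action T (chart_inv c (q 0)) (chart_inv c (q 1)) k \<and> k - m * T \<le> (1 + C) * e * l"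
      using k by (intro exI[of _ T] exI[of _ k]) simp
  qed (use C in simp)
qed

text \<open>A small bump function supported near \<open>x\<close> is a subsolution, so leaving its support costs at
  least its height, while staying inside costs at least \<open>c0\<close> per unit of time.\<close>

lemma action_loop_ge:
  assumes m: "\<And>y. m \<le> L (y, \<lambda>_. 0)" and x: "m < L (x, \<lambda>_. 0)"
  obtains \<kappa> where "\<kappa> > 0" "\<And>T k. T \<ge> 1 \<Longrightarrow> action T x x k \<Longrightarrow> m * T + \<kappa> \<le> k"
proof -
  obtain c where c: "c \<in> A" "x \<in> chart_dom c" by (rule chart_exists)
  define p0 where "p0 = chart_map c x"
  \<comment> \<open>Half the gap at \<open>x\<close>, so that it persists on a closed ball about
    \<open>p0\<close>.\<close>
  define c0 where "c0 = (L (x, \<lambda>_. 0) - m) / 2"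
  have c0: "c0 > 0" using x by (simp add: c0_def)
  have p0: "p0 \<in> chart_codom c" unfolding p0_def by (rule chart_map_in_codom[OF c])
  have "continuous_on (chart_codom c) (\<lambda>p. lr c (p, 0))"
    by (rule continuous_on_compose2[OF continuous_on_lr[OF c(1)]]) (auto intro!: continuous_intros)
  then have "open (chart_codom c \<inter> (\<lambda>p. lr c (p, 0)) -` {m + c0<..})"
    by (intro continuous_open_preimage open_chart_codom c) auto
  moreover have "p0 \<in> chart_codom c \<inter> (\<lambda>p. lr c (p, 0)) -` {m + c0<..}"
    using p0 x lr_0[OF c] by (simp add: p0_def c0_def field_simps)
  ultimately obtain \<rho> where \<rho>: "\<rho> > 0" "cball p0 \<rho> \<subseteq> chart_codom c \<inter> (\<lambda>p. lr c (p, 0)) -` {m + c0<..}"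
    using open_contains_cball by metis
  have \<rho>c: "cball p0 \<rho> \<subseteq> chart_codom c" and \<rho>0: "\<And>p. p \<in> cball p0 \<rho> \<Longrightarrow> m + c0 \<le> lr c (p, 0)"
    using \<rho>(2) by (auto simp: less_imp_le)
  obtain a where a: "a > 0" "\<And>p w. p \<in> cball p0 \<rho> \<Longrightarrow> a * norm w \<le> lr c (p, w) - m"
    using lr_coercive[OF c(1) compact_cball \<rho>c c0 \<rho>0] by metis
  \<comment> \<open>On the ball the gradient of \<open>\<beta>\<close> has norm at most
    \<open>4 * \<kappa> * \<rho> ^ 3\<close>; this choice makes the bound equal to the coercivity
    constant \<open>a\<close>, so \<open>\<phi>\<close> is a subsolution.\<close>
  define \<kappa> where "\<kappa> = a / (4 * \<rho> ^ 3)"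
  have \<kappa>: "\<kappa> > 0" "\<kappa> * (4 * \<rho> ^ 3) = a" using a \<rho> by (auto simp: \<kappa>_def)
  define \<beta> where "\<beta> p = \<kappa> * (max 0 (\<rho>\<^sup>2 - (p - p0) \<bullet> (p - p0)))\<^sup>2" for p
  define \<phi> where "\<phi> y = (if y \<in> chart_dom c then \<beta> (chart_map c y) else 0)" for y
  have \<beta>_zero: "\<beta> p = 0" if "p \<notin> ball p0 \<rho>" for p
  proof -
    have "\<rho>\<^sup>2 \<le> (norm (p - p0))\<^sup>2" using that \<rho> by (intro power_mono) (auto simp: dist_norm norm_minus_commute)
    then show ?thesis by (simp add: \<beta>_def dot_square_norm)
  qed
  have d\<beta>: "(\<beta> has_derivative (\<lambda>w. \<kappa> * (2 * max 0 (\<rho>\<^sup>2 - (p - p0) \<bullet> (p - p0)) * (- 2 * ((p - p0) \<bullet> w))))) (at p)" for p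
  proof -
    have 1: "((\<lambda>p. \<rho>\<^sup>2 - (p - p0) \<bullet> (p - p0)) has_derivative (\<lambda>w. - 2 * ((p - p0) \<bullet> w))) (at p)"
      by (auto intro!: derivative_eq_intros simp: inner_commute)
    have "((\<lambda>t. (max 0 t)\<^sup>2) has_derivative (*) (2 * max 0 (\<rho>\<^sup>2 - (p - p0) \<bullet> (p - p0)))) (at (\<rho>\<^sup>2 - (p - p0) \<bullet> (p - p0)))"
      using has_real_derivative_pos_part_square unfolding has_field_derivative_def .
    from diff_chain_at[OF 1 this] show ?thesis
      unfolding \<beta>_def[abs_def] by (intro has_derivative_mult_right) (simp add: o_def)
  qed
  have d\<beta>_le: "\<bar>\<kappa> * (2 * max 0 (\<rho>\<^sup>2 - (p - p0) \<bullet> (p - p0)) * (- 2 * ((p - p0) \<bullet> w)))\<bar> \<le> lr c (p, w) - m"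
    if p: "p \<in> chart_codom c" for p w
  proof (cases "p \<in> cball p0 \<rho>")
    case True
    have n: "norm (p - p0) \<le> \<rho>" using True by (simp add: dist_norm norm_minus_commute)
    have "max 0 (\<rho>\<^sup>2 - (p - p0) \<bullet> (p - p0)) \<le> \<rho>\<^sup>2" by simp
    moreover have "\<bar>(p - p0) \<bullet> w\<bar> \<le> \<rho> * norm w"
      using Cauchy_Schwarz_ineq2[of "p - p0" w] n by (meson mult_right_mono norm_ge_zero order_trans)
    ultimately have "max 0 (\<rho>\<^sup>2 - (p - p0) \<bullet> (p - p0)) * \<bar>(p - p0) \<bullet> w\<bar> \<le> \<rho>\<^sup>2 * (\<rho> * norm w)"
      by (intro mult_mono) auto
    then have "(4 * \<kappa>) * (max 0 (\<rho>\<^sup>2 - (p - p0) \<bullet> (p - p0)) * \<bar>(p - p0) \<bullet> w\<bar>) \<le> (4 * \<kappa>) * (\<rho>\<^sup>2 * (\<rho> * norm w))"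
      using \<kappa> by (intro mult_left_mono) auto
    also have "\<dots> = (\<kappa> * (4 * \<rho> ^ 3)) * norm w" by (simp add: power3_eq_cube power2_eq_square)
    also have "\<dots> \<le> lr c (p, w) - m" unfolding \<kappa>(2) by (rule a(2)[OF True])
    finally show ?thesis using \<kappa>(1) by (simp add: abs_mult)
  next
    case False
    then have "\<rho>\<^sup>2 \<le> (norm (p - p0))\<^sup>2" using \<rho> by (intro power_mono) (auto simp: dist_norm norm_minus_commute)
    moreover have "m \<le> lr c (p, w)"
      using m[of "chart_inv c p"] lr_0[OF c(1) chart_inv_in_dom[OF c(1) p]] lr_ge[OF c(1) p, of w]
      by (simp add: chart_map_inv[OF c(1) p])
    ultimately show ?thesis by (simp add: dot_square_norm)
  qed
  let ?N = "chart_inv c ` cball p0 \<rho>"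
  \<comment> \<open>Compact, hence closed in a Hausdorff space. Its complement and the chart domain
    are open and cover the manifold, so \<open>\<phi>\<close> is continuous across the edge of the
    chart.\<close>
  have cN: "closed ?N"
    by (intro compact_imp_closed compact_continuous_image continuous_on_subset[OF continuous_on_chart_inv[OF c(1)] \<rho>c]) simp
  have \<phi>N: "\<phi> y = 0" if "y \<in> - ?N" for y
  proof (cases "y \<in> chart_dom c")
    case True
    then have "chart_map c y \<notin> cball p0 \<rho>" using that chart_inv_map[OF c(1) True] by (metis ComplD image_eqI)
    then show ?thesis using \<beta>_zero by (auto simp: \<phi>_def)
  qed (simp add: \<phi>_def)
  have cont\<phi>: "continuous_on UNIV \<phi>"
  proof -
    have "continuous_on UNIV \<beta>"
      using has_derivative_continuous[OF d\<beta>] by (simp add: continuous_on_eq_continuous_at)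
    then have "continuous_on (chart_dom c) (\<lambda>y. \<beta> (chart_map c y))"
      by (rule continuous_on_compose2[OF _ continuous_on_chart_map[OF c(1)]]) auto
    then have "continuous_on (chart_dom c) \<phi>" by (rule continuous_on_eq) (simp add: \<phi>_def)
    moreover have "continuous_on (- ?N) \<phi>" by (rule continuous_on_eq[of _ "\<lambda>_. 0"]) (use \<phi>N in auto)
    ultimately have "continuous_on (chart_dom c \<union> - ?N) \<phi>"
      using open_chart_dom[OF c(1)] cN by (intro continuous_on_open_Un) auto
    moreover have "chart_dom c \<union> - ?N = UNIV" using chart_inv_in_dom[OF c(1)] \<rho>c by auto
    ultimately show ?thesis by simp
  qed
  have \<phi>x: "\<phi> x = \<kappa> * \<rho> ^ 4" using c \<rho> by (simp add: \<phi>_def \<beta>_def p0_def flip: power_mult)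
  show ?thesis
  proof (rule that[of "min (\<kappa> * \<rho> ^ 4) c0"])
    show "0 < min (\<kappa> * \<rho> ^ 4) c0" using \<kappa> \<rho> c0 by simp
    fix T k assume T: "T \<ge> 1" and "action T x x k"
    then obtain \<gamma> where \<gamma>: "piecewise_C1_path A 0 T \<gamma>" "\<gamma> 0 = x" "\<gamma> T = x"
      "k = integral {0..T} (\<lambda>s. L (tangent_lift A \<gamma> s))" by (auto simp: action_def)
    have c\<gamma>: "continuous_on {0..T} \<gamma>" by (rule piecewise_continuous[OF \<gamma>(1)])
    have c\<phi>\<gamma>: "continuous_on {0..T} (\<lambda>s. \<phi> (\<gamma> s))"
      by (rule continuous_on_compose2[OF cont\<phi> c\<gamma>]) simp
    show "m * T + min (\<kappa> * \<rho> ^ 4) c0 \<le> k"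
    proof (cases "\<exists>s\<in>{0..T}. \<phi> (\<gamma> s) = 0")
      case True
      then obtain s1 where s1: "s1 \<in> {0..T}" "\<phi> (\<gamma> s1) = 0" by blast
      \<comment> \<open>The path is a loop, so the increment of \<open>\<phi>\<close> over all of it
        is 0. The bump is therefore used only until a time \<open>s1\<close> at which it vanishes,
        and the plain bound by \<open>m\<close> afterwards. The two parts match at
        \<open>s1\<close>, the only new kink.\<close>
      let ?r = "\<lambda>s. m * s + (if s \<le> s1 then - \<phi> (\<gamma> s) else 0)"
      have "continuous_on ({0..s1} \<union> {s1..T}) (\<lambda>s. if s \<le> s1 then - \<phi> (\<gamma> s) else 0)"
        by (rule continuous_on_If) (use s1 in \<open>auto intro!: continuous_intros continuous_on_subset[OF c\<phi>\<gamma>]\<close>)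
      moreover have "{0..s1} \<union> {s1..T} = {0..T}" using s1 by auto
      ultimately have cr: "continuous_on {0..T} ?r" by (auto intro!: continuous_intros)
      have "?r T - ?r 0 \<le> integral {0..T} (\<lambda>s. L (tangent_lift A \<gamma> s))"
      proof (rule action_ge[OF \<gamma>(1), of "{s1}", OF _ cr])
        fix s assume s: "s \<in> {0<..<T}" "s \<notin> {s1}" and cont: "isCont \<gamma> s"
          and lift: "\<And>c. c \<in> A \<Longrightarrow> \<gamma> s \<in> chart_dom c \<Longrightarrow> \<exists>w. (chart_map c \<circ> \<gamma> has_vector_derivative w) (at s) \<and>
           L (tangent_lift A \<gamma> s) = lr c (chart_map c (\<gamma> s), w)"
        have tend: "(\<gamma> \<longlongrightarrow> \<gamma> s) (nhds s)" using cont by (simp add: isCont_def tendsto_at_iff_tendsto_nhds)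
        have mL: "m \<le> L (tangent_lift A \<gamma> s)" using lagrangian_lift_ge[OF lift] m order_trans by blast
        have "\<exists>D. ((\<lambda>s. \<phi> (\<gamma> s)) has_real_derivative D) (at s) \<and> \<bar>D\<bar> \<le> L (tangent_lift A \<gamma> s) - m"
        proof (cases "\<gamma> s \<in> chart_dom c")
          case True
          obtain w where w: "(chart_map c \<circ> \<gamma> has_vector_derivative w) (at s)"
            "L (tangent_lift A \<gamma> s) = lr c (chart_map c (\<gamma> s), w)" using lift[OF c(1) True] by blast
          define D where "D = \<kappa> * (2 * max 0 (\<rho>\<^sup>2 - (chart_map c (\<gamma> s) - p0) \<bullet> (chart_map c (\<gamma> s) - p0)) * (- 2 * ((chart_map c (\<gamma> s) - p0) \<bullet> w)))"
          have "(\<beta> \<circ> (chart_map c \<circ> \<gamma>) has_vector_derivative D) (at s)"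
            using vector_derivative_diff_chain_within[OF w(1) has_derivative_at_withinI[OF d\<beta>]]
            unfolding D_def by simp
          then have 1: "((\<lambda>s. \<beta> (chart_map c (\<gamma> s))) has_real_derivative D) (at s)"
            by (simp add: has_real_derivative_iff_has_vector_derivative o_def)
          have "\<forall>\<^sub>F t in nhds s. \<gamma> t \<in> chart_dom c"
            using topological_tendstoD[OF tend open_chart_dom[OF c(1)] True] .
          then have "\<forall>\<^sub>F t in nhds s. \<phi> (\<gamma> t) = \<beta> (chart_map c (\<gamma> t))"
            by (rule eventually_mono) (simp add: \<phi>_def)
          then have "((\<lambda>s. \<phi> (\<gamma> s)) has_real_derivative D) (at s)"
            using 1 by (subst DERIV_cong_ev) auto
          moreover have "\<bar>D\<bar> \<le> L (tangent_lift A \<gamma> s) - m"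
            unfolding D_def w(2) by (rule d\<beta>_le[OF chart_map_in_codom[OF c(1) True]])
          ultimately show ?thesis by blast
        next
          case False
          then have "\<gamma> s \<in> - ?N" using chart_inv_in_dom[OF c(1)] \<rho>c by auto
          then have "\<forall>\<^sub>F t in nhds s. \<gamma> t \<in> - ?N"
            using topological_tendstoD[OF tend open_Compl[OF cN]] by blast
          then have "\<forall>\<^sub>F t in nhds s. \<phi> (\<gamma> t) = 0" by (rule eventually_mono) (rule \<phi>N)
          then have "((\<lambda>s. \<phi> (\<gamma> s)) has_real_derivative 0) (at s)" by (subst DERIV_cong_ev) auto
          then show ?thesis using mL by (intro exI[of _ 0]) simp
        qed
        then obtain D where D: "((\<lambda>s. \<phi> (\<gamma> s)) has_real_derivative D) (at s)" "\<bar>D\<bar> \<le> L (tangent_lift A \<gamma> s) - m" by blast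
        show "\<exists>D. (?r has_real_derivative D) (at s) \<and> D \<le> L (tangent_lift A \<gamma> s)"
        proof (cases "s < s1")
          case True
          have "((\<lambda>s. m * s + - \<phi> (\<gamma> s)) has_real_derivative m - D) (at s)"
            by (auto intro!: derivative_eq_intros D(1))
          then have "(?r has_real_derivative m - D) (at s)"
            by (rule has_field_derivative_transform_within_open[of _ _ _ "{..<s1}"]) (use True in auto)
          then show ?thesis using D(2) by (intro exI[of _ "m - D"]) auto
        next
          case False
          have "((\<lambda>s. m * s + 0) has_real_derivative m) (at s)" by (auto intro!: derivative_eq_intros)
          then have "(?r has_real_derivative m) (at s)"
            by (rule has_field_derivative_transform_within_open[of _ _ _ "{s1<..}"]) (use False s in auto)
          then show ?thesis using mL by blast
        qed
      qed simp
      moreover have "s1 \<noteq> T" using s1 \<gamma>(3) \<phi>x \<kappa> \<rho> by auto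
      ultimately show ?thesis using s1 \<gamma>(2-4) \<phi>x by auto
    next
      case False
      have "(\<lambda>s. (m + c0) * s) T - (\<lambda>s. (m + c0) * s) 0 \<le> integral {0..T} (\<lambda>s. L (tangent_lift A \<gamma> s))"
      proof (rule action_ge[OF \<gamma>(1), of "{}"])
        fix s assume s: "s \<in> {0<..<T}"
          and lift: "\<And>c. c \<in> A \<Longrightarrow> \<gamma> s \<in> chart_dom c \<Longrightarrow> \<exists>w. (chart_map c \<circ> \<gamma> has_vector_derivative w) (at s) \<and>
           L (tangent_lift A \<gamma> s) = lr c (chart_map c (\<gamma> s), w)"
        have nz: "\<phi> (\<gamma> s) \<noteq> 0" using False s by auto
        then have dom: "\<gamma> s \<in> chart_dom c" unfolding \<phi>_def by presburger
        then have "\<beta> (chart_map c (\<gamma> s)) \<noteq> 0" using nz by (simp add: \<phi>_def)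
        then have "chart_map c (\<gamma> s) \<in> ball p0 \<rho>" using \<beta>_zero by blast
        then have "m + c0 \<le> L (\<gamma> s, \<lambda>_. 0)"
          using \<rho>0[of "chart_map c (\<gamma> s)"] lr_0[OF c(1) dom] by simp
        then have "m + c0 \<le> L (tangent_lift A \<gamma> s)" using lagrangian_lift_ge[OF lift] order_trans by blast
        moreover have "((\<lambda>s. (m + c0) * s) has_real_derivative (m + c0)) (at s)" by (auto intro!: derivative_eq_intros)
        ultimately show "\<exists>D. ((\<lambda>s. (m + c0) * s) has_real_derivative D) (at s) \<and> D \<le> L (tangent_lift A \<gamma> s)" by blast
      qed (auto intro!: continuous_intros)
      then have "(m + c0) * T \<le> k" using \<gamma>(4) by simp
      \<comment> \<open>Here \<open>T \<ge> 1\<close> turns a cost per unit of time into a fixed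
        amount.\<close>
      moreover have "c0 * 1 \<le> c0 * T" using T c0 by (intro mult_left_mono) auto
      ultimately show ?thesis by (simp add: algebra_simps)
    qed
  qed
qed

end

section \<open>The Peierls barrier at zero cohomology\<close>

locale aubry_setting = symmetric_lagrangian A g L
  for A :: "('a::t2_space, 'e::euclidean_space) chart set" and g L +
  fixes r :: nat
  assumes compact_M: "compact (UNIV :: 'a set)" and connected_M: "connected (UNIV :: 'a set)"
    and potential_Cr: "Ck_fun A r (\<lambda>x. L (x, \<lambda>_. 0))" and r_ge: "r \<ge> 2 * DIM('e) - 2"
begin

abbreviation pot :: "'a \<Rightarrow> real" where "pot x \<equiv> L (x, \<lambda>_. 0)"

lemma continuous_pot: "continuous_on UNIV pot"
  unfolding continuous_on_eq_continuous_at[OF open_UNIV]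
proof
  fix x
  obtain c where c: "c \<in> A" "x \<in> chart_dom c" by (rule chart_exists)
  have "continuous_on (chart_codom c) (\<lambda>p. pot (chart_inv c p))"
    using potential_Cr c unfolding Ck_fun_def by (blast intro: Ck_on_imp_continuous)
  then have "continuous_on (chart_dom c) (\<lambda>y. pot (chart_inv c (chart_map c y)))"
    by (rule continuous_on_compose2[OF _ continuous_on_chart_map[OF c(1)]])
      (use chart_map_in_codom[OF c(1)] in blast)
  then have "continuous_on (chart_dom c) pot"
    by (rule continuous_on_eq) (simp add: chart_inv_map[OF c(1)])
  then show "isCont pot x" using c open_chart_dom continuous_on_eq_continuous_at by blast
qed

definition m :: real where "m = Inf (range pot)"

lemma m_minimum: "\<exists>x0. pot x0 = m \<and> (\<forall>y. m \<le> pot y)"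
proof -
  obtain x0 where x0: "\<And>y. pot x0 \<le> pot y"
    using continuous_attains_inf[OF compact_M UNIV_not_empty continuous_pot] by auto
  then have "m = pot x0" unfolding m_def by (intro cInf_eq_minimum) auto
  then show ?thesis using x0 by auto
qed

lemma m_le: "m \<le> pot x"
  using m_minimum by blast

definition \<alpha> :: real where "\<alpha> = mather_alpha A L zero_form"

definition barrier :: "'a \<Rightarrow> 'a \<Rightarrow> ereal" where "barrier = peierls_barrier A L zero_form"

lemma barrier_eq: "barrier x y = Liminf at_top (\<lambda>t. min_action A L zero_form t x y + ereal (\<alpha> * t))"
  by (simp add: barrier_def peierls_barrier_def \<alpha>_def)

lemma barrier_geI:
  assumes "\<And>t k. t \<ge> t0 \<Longrightarrow> action t x y k \<Longrightarrow> C \<le> k + \<alpha> * t"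
  shows "ereal C \<le> barrier x y"
  unfolding barrier_eq
proof (rule Liminf_bounded)
  show "\<forall>\<^sub>F t in at_top. ereal C \<le> min_action A L zero_form t x y + ereal (\<alpha> * t)"
    \<comment> \<open>The 1 keeps \<open>t\<close> positive, as \<open>min_action_eq\<close>
      requires.\<close>
    using eventually_ge_at_top[of "max t0 1"]
  proof eventually_elim
    case (elim t)
    have "ereal (C - \<alpha> * t) \<le> min_action A L zero_form t x y"
      using assms[of t] elim by (subst min_action_eq) (auto intro!: INF_greatest simp: algebra_simps)
    then have "ereal (C - \<alpha> * t) + ereal (\<alpha> * t) \<le> min_action A L zero_form t x y + ereal (\<alpha> * t)"
      by (rule add_right_mono)
    then show ?case by simp
  qed
qed

text \<open>The bound is asked for at all large \<open>t\<close>, in keeping with its use: waiting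
  lets a path be prolonged to exactly the time \<open>t\<close>.\<close>

lemma barrier_leI:
  assumes "\<And>t. t \<ge> t0 \<Longrightarrow> \<exists>k. action t x y k \<and> k + \<alpha> * t \<le> C"
  shows "barrier x y \<le> ereal C"
  unfolding barrier_eq
proof (rule Liminf_le)
  show "\<forall>\<^sub>F t in at_top. min_action A L zero_form t x y + ereal (\<alpha> * t) \<le> ereal C"
    using eventually_ge_at_top[of "max t0 1"]
  proof eventually_elim
    case (elim t)
    obtain k where k: "action t x y k" "k + \<alpha> * t \<le> C" using assms[of t] elim by auto
    have "min_action A L zero_form t x y \<le> ereal k"
      using k elim by (subst min_action_eq) (auto intro!: INF_lower)
    then have "min_action A L zero_form t x y + ereal (\<alpha> * t) \<le> ereal k + ereal (\<alpha> * t)"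
      by (rule add_right_mono)
    also have "\<dots> \<le> ereal C" using k by simp
    finally show ?case .
  qed
qed simp

text \<open>Detour through a minimum point of the potential: waiting there costs at most
  \<open>m + \<alpha> < 0\<close> per unit of time, so long waits bring the total below any
  \<open>C\<close>.\<close>

lemma barrier_neg_infinity: assumes "\<alpha> < - m" shows "barrier x y = - \<infinity>"
proof -
  obtain x0 where x0: "pot x0 = m" using m_minimum by blast
  obtain S j where j: "action S x x0 j" by (rule action_connected[OF connected_M])
  obtain T k where k: "action T x0 y k" by (rule action_connected[OF connected_M])
  have "barrier x y \<le> ereal C" for C
  proof (rule barrier_leI)
    \<comment> \<open>The first entry leaves a positive waiting time; the second makes the wait pay
      for both legs and involves a division by the negative number
      \<open>m + \<alpha>\<close>.\<close>
    fix t assume t: "max (S + T + 1) ((C - j - k + m * (S + T)) / (m + \<alpha>)) \<le> t"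
    then have "0 < t - S - T" by simp
    then obtain i where i: "action (t - S - T) x0 x0 i" "i \<le> pot x0 * (t - S - T)" by (rule action_const)
    have "action (S + (t - S - T) + T) x y (j + i + k)"
      by (rule action_concat[OF action_concat[OF j i(1)] k])
    moreover have "(m + \<alpha>) * t \<le> C - j - k + m * (S + T)"
    proof -
      have "(C - j - k + m * (S + T)) / (m + \<alpha>) \<le> t" using t by simp
      then show ?thesis using assms by (simp add: neg_divide_le_eq mult.commute)
    qed
    ultimately show "\<exists>k. action t x y k \<and> k + \<alpha> * t \<le> C"
      using i(2) x0 by (intro exI[of _ "j + i + k"]) (auto simp: algebra_simps)
  qed
  then show ?thesis using ereal_bot by blast
qed

lemma barrier_nonneg: assumes "\<alpha> \<ge> - m" shows "barrier x y \<ge> 0"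
proof -
  have "ereal 0 \<le> barrier x y"
  proof (rule barrier_geI[of 0])
    fix t k assume t: "0 \<le> t" and k: "action t x y k"
    have "m * t \<le> k" by (rule action_ge_min[OF k m_le])
    moreover have "0 \<le> (m + \<alpha>) * t" using assms t by simp
    ultimately show "0 \<le> k + \<alpha> * t" by (simp add: algebra_simps)
  qed
  then show ?thesis by (simp add: zero_ereal_def)
qed

lemma aubryD:
  assumes "x \<in> aubry_set A L zero_form"
  shows "\<alpha> = - m" "pot x = m"
proof -
  have "barrier x x + barrier x x = 0" using assms by (simp add: aubry_set_def aubry_delta_def barrier_def)
  then have b0: "barrier x x = 0" by (cases "barrier x x") auto
  have "\<not> \<alpha> < - m" using barrier_neg_infinity[of x x] b0 by auto
  moreover have "\<not> \<alpha> > - m"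
  proof
    assume \<alpha>: "\<alpha> > - m"
    \<comment> \<open>Any positive bound contradicts \<open>b0\<close>; the value 1 is reached once
      \<open>t\<close> is at least \<open>1 / (m + \<alpha>)\<close>.\<close>
    have "ereal 1 \<le> barrier x x"
    proof (rule barrier_geI)
      fix t k assume t: "1 / (m + \<alpha>) \<le> t" and k: "action t x x k"
      have "m * t \<le> k" by (rule action_ge_min[OF k m_le])
      moreover have "1 \<le> (m + \<alpha>) * t" using \<alpha> t by (simp add: pos_divide_le_eq mult.commute)
      ultimately show "1 \<le> k + \<alpha> * t" by (simp add: algebra_simps)
    qed
    then show False using b0 by (simp add: zero_ereal_def)
  qed
  ultimately show \<alpha>: "\<alpha> = - m" by simp
  show "pot x = m"
  proof (rule ccontr)
    assume "pot x \<noteq> m"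
    then have "m < pot x" using m_le[of x] by simp
    then obtain \<kappa> where \<kappa>: "\<kappa> > 0" "\<And>T k. T \<ge> 1 \<Longrightarrow> action T x x k \<Longrightarrow> m * T + \<kappa> \<le> k"
      using action_loop_ge[OF m_le] by metis
    have "ereal \<kappa> \<le> barrier x x"
      by (rule barrier_geI[of 1]) (use \<kappa>(2) \<alpha> in force)
    then show False using b0 \<kappa>(1) by (simp add: zero_ereal_def)
  qed
qed

section \<open>The action potential and its relation to the barrier\<close>

definition excess :: "'a \<Rightarrow> 'a \<Rightarrow> real set" where
  "excess x y = {k - m * T | T k. action T x y k}"

text \<open>Mane's action potential at the level \<open>- m\<close>, the infimum over all travel
  times. It is a nonnegative real for every pair of points, whatever \<open>\<alpha>\<close> is, so
  the analysis stays in the reals and returns to the barrier only on the Aubry set.\<close>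

definition D :: "'a \<Rightarrow> 'a \<Rightarrow> real" where "D x y = Inf (excess x y)"

lemma excess_nonneg: "e \<in> excess x y \<Longrightarrow> 0 \<le> e"
  using action_ge_min[OF _ m_le] unfolding excess_def by fastforce

lemma excess_nonempty: "excess x y \<noteq> {}"
proof -
  obtain T k where "action T x y k" by (rule action_connected[OF connected_M])
  then show ?thesis unfolding excess_def by blast
qed

lemma excess_add: "e \<in> excess x y \<Longrightarrow> e' \<in> excess y z \<Longrightarrow> e + e' \<in> excess x z"
proof -
  assume "e \<in> excess x y" "e' \<in> excess y z"
  then obtain S j T k where "action S x y j" "e = j - m * S" "action T y z k" "e' = k - m * T"
    unfolding excess_def by blast
  then show ?thesis
    unfolding excess_def using action_concat[of S x y j T z k]
    by (intro CollectI exI[of _ "S + T"] exI[of _ "j + k"]) (simp add: algebra_simps)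
qed

lemma D_nonneg: "0 \<le> D x y"
  unfolding D_def using excess_nonneg by (intro cInf_greatest excess_nonempty)

lemma D_le: "e \<in> excess x y \<Longrightarrow> D x y \<le> e"
  unfolding D_def using excess_nonneg by (intro cInf_lower bdd_belowI[of _ 0]) auto

lemma D_append: assumes "e \<in> excess y z" shows "D x z \<le> D x y + e"
proof -
  have "D x z - e \<le> Inf (excess x y)"
    using D_le[OF excess_add[OF _ assms]] by (intro cInf_greatest excess_nonempty) (simp add: diff_le_eq)
  then show ?thesis by (simp add: D_def)
qed

lemma D_prepend: assumes "e \<in> excess x y" shows "D x z \<le> e + D y z"
proof -
  have "D x z - e \<le> Inf (excess y z)"
    using D_le[OF excess_add[OF assms]] by (intro cInf_greatest excess_nonempty) (simp add: diff_le_eq add.commute)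
  then show ?thesis by (simp add: D_def)
qed

lemma D_triangle: "D x z \<le> D x y + D y z"
proof -
  have "D x z - D x y \<le> Inf (excess y z)"
    using D_append by (intro cInf_greatest excess_nonempty) (simp add: diff_le_eq add.commute)
  then show ?thesis by (simp add: D_def)
qed

text \<open>At a minimum point of the potential one can wait at no cost, so the lower limit in the
  barrier is an infimum over all times.\<close>

lemma barrier_eq_D:
  assumes \<alpha>: "\<alpha> = - m" and x: "pot x = m" shows "barrier x y = ereal (D x y)"
proof (rule antisym)
  have le: "barrier x y \<le> ereal e" if e: "e \<in> excess x y" for e
  proof -
    obtain T k where k: "action T x y k" "e = k - m * T" using e unfolding excess_def by blast
    show ?thesis
    proof (rule barrier_leI)
      fix t assume "T + 1 \<le> t"
      then have "0 < t - T" by simp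
      then obtain i where i: "action (t - T) x x i" "i \<le> pot x * (t - T)" by (rule action_const)
      have "action (t - T + T) x y (i + k)" by (rule action_concat[OF i(1) k(1)])
      then show "\<exists>k. action t x y k \<and> k + \<alpha> * t \<le> e"
        using i(2) x \<alpha> k(2) by (intro exI[of _ "i + k"]) (auto simp: algebra_simps)
    qed
  qed
  obtain e where e: "e \<in> excess x y" using excess_nonempty by blast
  have "0 \<le> barrier x y" using barrier_nonneg \<alpha> by simp
  then obtain b where b: "barrier x y = ereal b" using le[OF e] by (cases "barrier x y") auto
  have "b \<le> D x y" unfolding D_def using le b by (intro cInf_greatest excess_nonempty) auto
  then show "barrier x y \<le> ereal (D x y)" by (simp add: b)
  show "ereal (D x y) \<le> barrier x y"
  proof (rule barrier_geI)
    fix t k assume "action t x y k"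
    then have "k - m * t \<in> excess x y" unfolding excess_def by blast
    from D_le[OF this] show "D x y \<le> k + \<alpha> * t" by (simp add: \<alpha>)
  qed
qed

lemma Ck_on_potential:
  assumes c: "c \<in> A" shows "Ck_on (2 * DIM('e) - 2) (\<lambda>p. lr c (p, 0) - m) (chart_codom c)"
proof -
  have "Ck_on (2 * DIM('e) - 2) (\<lambda>p. pot (chart_inv c p)) (chart_codom c)"
    using potential_Cr c r_ge unfolding Ck_fun_def by (blast intro: Ck_on_mono)
  then have "Ck_on (2 * DIM('e) - 2) (\<lambda>p. pot (chart_inv c p) + (- m)) (chart_codom c)"
    by (intro Ck_on_add Ck_on_const open_chart_codom c)
  moreover have "lr c (p, 0) = pot (chart_inv c p)" if "p \<in> chart_codom c" for p
    using lr_0[OF c chart_inv_in_dom[OF c that]] by (simp add: chart_map_inv[OF c that])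
  ultimately show ?thesis
    by (subst Ck_on_cong[OF open_chart_codom[OF c], of _ "\<lambda>p. pot (chart_inv c p) + (- m)"]) auto
qed

text \<open>Compactness reduces the claim to finitely many charts. By the triangle inequality,
  \<open>D x z\<close> and \<open>D z x\<close> change along a curve by at most the cost of
  following it forwards or backwards, which \<open>action_slow_curve\<close> bounds; this is the
  hypothesis \<open>curves\<close> of \<open>negligible_image_zero_set\<close>.\<close>

lemma negligible_symmetrized_barrier_image:
  "negligible ((\<lambda>z. D x z + D z x) ` {z. pot z = m})"
proof -
  let ?u = "\<lambda>z. D x z + D z x"
  obtain \<C> where \<C>: "\<C> \<subseteq> A" "finite \<C>" "(\<Union>c\<in>\<C>. chart_dom c) = UNIV"
  proof -
    have "UNIV \<subseteq> (\<Union>c\<in>A. chart_dom c)" using chart_exists by blast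
    then show ?thesis
      using compactE_image[OF compact_M, of A chart_dom] open_chart_dom that by (metis UNIV_eq_I top.extremum_uniqueI)
  qed
  have neg: "negligible ((\<lambda>p. ?u (chart_inv c p)) ` {p \<in> chart_codom c. lr c (p, 0) - m = 0})"
    if c: "c \<in> A" for c
  proof (rule negligible_image_zero_set[OF open_chart_codom[OF c] Ck_on_potential[OF c]])
    fix Q assume Q: "compact Q" "Q \<subseteq> chart_codom c"
    obtain C where C: "C \<ge> 0" and slow: "\<And>q q' l e. 0 < l \<Longrightarrow> 0 < e \<Longrightarrow> e \<le> 1 \<Longrightarrow>
       (\<And>s. s \<in> {0..1} \<Longrightarrow> (q has_vector_derivative q' s) (at s within {0..1})) \<Longrightarrow>
       (\<And>s. s \<in> {0..1} \<Longrightarrow> q s \<in> Q \<and> norm (q' s) \<le> l \<and> lr c (q s, 0) - m \<le> e\<^sup>2) \<Longrightarrow>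
       continuous_on {0..1} q' \<Longrightarrow>
       \<exists>T k. action T (chart_inv c (q 0)) (chart_inv c (q 1)) k \<and> k - m * T \<le> C * e * l"
      using action_slow_curve[OF c Q, of m] by metis
    have "\<bar>?u (chart_inv c (q 1)) - ?u (chart_inv c (q 0))\<bar> \<le> (2 * C) * e * l"
      if le: "0 < l" "0 < e" "e \<le> 1"
        and q: "\<forall>s\<in>{0..1}. (q has_vector_derivative q' s) (at s within {0..1}) \<and> q s \<in> Q \<and>
          norm (q' s) \<le> l \<and> lr c (q s, 0) - m \<le> e\<^sup>2"
        and cont: "continuous_on {0..1} q'" for q q' l e
    proof -
      have ex1: "\<exists>e1\<in>excess (chart_inv c (q 0)) (chart_inv c (q 1)). e1 \<le> C * e * l"
        using slow[OF le, of q q'] q cont unfolding excess_def by blast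
      \<comment> \<open>The reversed curve obeys the same bounds, so the way back also costs at most
        \<open>C * e * l\<close>. Each one-sided estimate of \<open>?u\<close> uses both directions,
        hence the constant \<open>2 * C\<close>.\<close>
      let ?r = "\<lambda>s::real. 1 - s"
      have "\<exists>T k. action T (chart_inv c (q (?r 0))) (chart_inv c (q (?r 1))) k \<and> k - m * T \<le> C * e * l"
      proof (rule slow[OF le, of _ "\<lambda>s. - q' (?r s)"])
        fix s :: real assume s: "s \<in> {0..1}"
        then have rs: "?r s \<in> {0..1}" and im: "?r ` {0..1} = {0..1}" by (auto simp: image_diff_atLeastAtMost[where d=1 and a=0 and b=1, simplified])
        have "(?r has_vector_derivative - 1) (at s within {0..1})" by (auto intro!: derivative_eq_intros)
        from vector_diff_chain_within[OF this, of q "q' (?r s)"] q rs im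
        show "((\<lambda>s. q (?r s)) has_vector_derivative - q' (?r s)) (at s within {0..1})"
          by (simp add: o_def)
        show "q (?r s) \<in> Q \<and> norm (- q' (?r s)) \<le> l \<and> lr c (q (?r s), 0) - m \<le> e\<^sup>2" using q rs by simp
      next
        show "continuous_on {0..1} (\<lambda>s. - q' (?r s))"
          by (intro continuous_intros continuous_on_compose2[OF cont]) auto
      qed
      then have ex2: "\<exists>e2\<in>excess (chart_inv c (q 1)) (chart_inv c (q 0)). e2 \<le> C * e * l"
        unfolding excess_def by auto
      obtain e1 e2 where e: "e1 \<in> excess (chart_inv c (q 0)) (chart_inv c (q 1))" "e1 \<le> C * e * l"
        "e2 \<in> excess (chart_inv c (q 1)) (chart_inv c (q 0))" "e2 \<le> C * e * l" using ex1 ex2 by blast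
      show ?thesis
        using D_append[OF e(1), of x] D_append[OF e(3), of x] D_prepend[OF e(1), of x] D_prepend[OF e(3), of x] e(2,4)
        by (simp add: abs_le_iff)
    qed
    then show "\<exists>C\<ge>0. \<forall>q q' l e. 0 < l \<longrightarrow> 0 < e \<longrightarrow> e \<le> 1 \<longrightarrow>
        (\<forall>s\<in>{0..1}. (q has_vector_derivative q' s) (at s within {0..1}) \<and> q s \<in> Q \<and> norm (q' s) \<le> l \<and> lr c (q s, 0) - m \<le> e\<^sup>2) \<longrightarrow>
        continuous_on {0..1} q' \<longrightarrow> \<bar>?u (chart_inv c (q 1)) - ?u (chart_inv c (q 0))\<bar> \<le> C * e * l"
      using C by (intro exI[of _ "2 * C"] conjI allI impI) (simp, blast)
  qed
  have "?u ` {z. pot z = m} \<subseteq> (\<Union>c\<in>\<C>. (\<lambda>p. ?u (chart_inv c p)) ` {p \<in> chart_codom c. lr c (p, 0) - m = 0})"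
  proof clarify
    fix z assume z: "pot z = m"
    obtain c where c: "c \<in> \<C>" "z \<in> chart_dom c" using \<C>(3) by blast
    then have cA: "c \<in> A" using \<C>(1) by blast
    show "?u z \<in> (\<Union>c\<in>\<C>. (\<lambda>p. ?u (chart_inv c p)) ` {p \<in> chart_codom c. lr c (p, 0) - m = 0})"
      using c chart_inv_map[OF cA c(2)] chart_map_in_codom[OF cA c(2)] lr_0[OF cA c(2)] z
      by (intro UN_I[OF c(1)] image_eqI[of _ _ "chart_map c z"]) auto
  qed
  moreover have "negligible (\<Union>c\<in>\<C>. (\<lambda>p. ?u (chart_inv c p)) ` {p \<in> chart_codom c. lr c (p, 0) - m = 0})"
    using \<C> neg by (intro negligible_Union) auto
  ultimately show ?thesis using negligible_subset by blast
qed

section \<open>The quotient Aubry set\<close>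

abbreviation aubry :: "'a set" where "aubry \<equiv> aubry_set A L zero_form"
abbreviation \<delta> :: "'a \<Rightarrow> 'a \<Rightarrow> ereal" where "\<delta> \<equiv> aubry_delta A L zero_form"
abbreviation quot :: "'a set set" where "quot \<equiv> quotient_aubry_set A L zero_form"
abbreviation qdist :: "'a set \<Rightarrow> 'a set \<Rightarrow> real" where "qdist \<equiv> quotient_aubry_dist A L zero_form"

definition aubry_rel :: "('a \<times> 'a) set" where
  "aubry_rel = {(x, y) \<in> aubry \<times> aubry. \<delta> x y = 0}"

definition rep :: "'a set \<Rightarrow> 'a" where "rep X = (SOME x. x \<in> X)"

lemma delta_eq: "x \<in> aubry \<Longrightarrow> y \<in> aubry \<Longrightarrow> \<delta> x y = ereal (D x y + D y x)"
  using aubryD barrier_eq_D by (simp add: aubry_delta_def flip: barrier_def)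

lemma equiv_aubry_rel: "equiv aubry aubry_rel"
proof (rule equivI)
  show "refl_on aubry aubry_rel" by (auto simp: refl_on_def aubry_rel_def aubry_set_def)
  show "sym aubry_rel" by (auto simp: sym_def aubry_rel_def aubry_delta_def add.commute)
  show "trans aubry_rel"
  proof (rule transI)
    fix x y z assume "(x, y) \<in> aubry_rel" "(y, z) \<in> aubry_rel"
    then have A: "x \<in> aubry" "y \<in> aubry" "z \<in> aubry" and "D x y + D y x = 0" "D y z + D z y = 0"
      by (auto simp: aubry_rel_def delta_eq)
    then have "D x z + D z x = 0"
      using D_triangle[of x z y] D_triangle[of z x y] D_nonneg[of x z] D_nonneg[of z x] by linarith
    then show "(x, z) \<in> aubry_rel" using A by (simp add: aubry_rel_def delta_eq)
  qed
  show "aubry_rel \<subseteq> aubry \<times> aubry" by (auto simp: aubry_rel_def)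
qed

lemma quot_eq: "quot = aubry // aubry_rel"
  by (simp add: quotient_aubry_set_def aubry_rel_def)

lemma rep_in: assumes "X \<in> quot" shows "rep X \<in> X" "rep X \<in> aubry"
proof -
  obtain x where "x \<in> aubry" "X = aubry_rel `` {x}" using assms unfolding quot_eq by (rule quotientE)
  then have "x \<in> X" using equiv_class_self[OF equiv_aubry_rel] by simp
  then show 1: "rep X \<in> X" unfolding rep_def by (rule someI)
  show "rep X \<in> aubry" using 1 assms equiv_aubry_rel Union_quotient unfolding quot_eq by blast
qed

lemma qdist_eq_delta: "qdist X Y = real_of_ereal (\<delta> (rep X) (rep Y))"
  by (simp add: quotient_aubry_dist_def rep_def)

lemma qdist_eq: "X \<in> quot \<Longrightarrow> Y \<in> quot \<Longrightarrow> qdist X Y = D (rep X) (rep Y) + D (rep Y) (rep X)"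
  by (simp add: qdist_eq_delta delta_eq rep_in)

lemma Metric_space_quot: "Metric_space quot qdist"
proof
  show "qdist X Y = qdist Y X" for X Y by (simp add: qdist_eq_delta aubry_delta_def add.commute)
  \<comment> \<open>\<open>Metric_space\<close> demands this for all sets, also outside
    \<open>quot\<close>, where \<open>rep\<close> may pick a point with infinite barrier. Either
    both barriers are \<open>- \<infinity>\<close>, and \<open>real_of_ereal\<close> sends their sum
    to 0, or both are nonnegative.\<close>
  show "0 \<le> qdist X Y" for X Y
  proof (cases "\<alpha> < - m")
    case True
    then show ?thesis by (simp add: qdist_eq_delta aubry_delta_def barrier_neg_infinity flip: barrier_def)
  next
    case False
    then show ?thesis
      by (simp add: qdist_eq_delta aubry_delta_def barrier_nonneg real_of_ereal_pos flip: barrier_def)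
  qed
  show "qdist X Z \<le> qdist X Y + qdist Y Z" if "X \<in> quot" "Y \<in> quot" "Z \<in> quot" for X Y Z
    using D_triangle[of "rep X" "rep Z" "rep Y"] D_triangle[of "rep Z" "rep X" "rep Y"] that
    by (simp add: qdist_eq)
  show "qdist X Y = 0 \<longleftrightarrow> X = Y" if X: "X \<in> quot" and Y: "Y \<in> quot" for X Y
  proof -
    have "X = Y \<longleftrightarrow> (rep X, rep Y) \<in> aubry_rel"
      using quotient_eq_iff[OF equiv_aubry_rel] X Y rep_in unfolding quot_eq by blast
    also have "\<dots> \<longleftrightarrow> qdist X Y = 0"
      using X Y rep_in by (simp add: aubry_rel_def qdist_eq delta_eq)
    finally show ?thesis by blast
  qed
qed

theorem totally_disconnected_quotient:
  "totally_disconnected (quotient_aubry_topology A L zero_form)"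
  unfolding totally_disconnected_def
proof
  interpret Q: Metric_space quot qdist by (rule Metric_space_quot)
  have top: "quotient_aubry_topology A L zero_form = Q.mtopology" by (simp add: quotient_aubry_topology_def)
  fix C assume C: "C \<in> connected_components_of (quotient_aubry_topology A L zero_form)"
  have sub: "C \<subseteq> quot" using connected_components_of_subset[OF C] by (simp add: top)
  have conn: "connectedin Q.mtopology C" using connectedin_connected_components_of[OF C] by (simp add: top)
  obtain X where X: "X \<in> C" using nonempty_connected_components_of[OF C] by blast
  then have XQ: "X \<in> quot" using sub by blast
  have "Y = X" if Y: "Y \<in> C" for Y
  proof (rule ccontr)
    assume "Y \<noteq> X"
    have YQ: "Y \<in> quot" using Y sub by blast
    have pos: "0 < qdist X Y" using Q.mdist_pos_less \<open>Y \<noteq> X\<close> XQ YQ by metis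
    have "continuous_map Q.mtopology euclidean (\<lambda>Z. mdist (metric (quot, qdist)) X Z)"
      by (rule continuous_map_mdist) (use XQ Q.mtopology_of in \<open>auto simp: continuous_map_const\<close>)
    then have "continuous_map Q.mtopology euclideanreal (qdist X)" by (simp add: Q.mdist_metric)
    then have "connected (qdist X ` C)"
      using connectedin_continuous_map_image conn connectedin_iff_connected by metis
    moreover have "0 \<in> qdist X ` C" using X XQ by (intro image_eqI[of _ _ X]) auto
    moreover have "qdist X Y \<in> qdist X ` C" using Y by blast
    ultimately have "{0..qdist X Y} \<subseteq> qdist X ` C" using connected_contains_Icc by metis
    \<comment> \<open>Distances from \<open>X\<close> are values of the symmetrised action potential
      at representatives; these lie in the Aubry set, hence at minimum points of the
      potential.\<close>
    also have "\<dots> \<subseteq> (\<lambda>z. D (rep X) z + D z (rep X)) ` {z. pot z = m}"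
    proof clarify
      fix Z assume "Z \<in> C"
      then have ZQ: "Z \<in> quot" using sub by blast
      show "qdist X Z \<in> (\<lambda>z. D (rep X) z + D z (rep X)) ` {z. pot z = m}"
        using qdist_eq[OF XQ ZQ] aubryD(2)[OF rep_in(2)[OF ZQ]] by blast
    qed
    finally have "negligible {0..qdist X Y}"
      using negligible_symmetrized_barrier_image negligible_subset by blast
    then show False using pos negligible_interval(1)[of 0 "qdist X Y"] by simp
  qed
  then show "\<exists>a. C = {a}" using X by blast
qed

end

theorem corollary3:
  fixes A :: "('a::t2_space, 'e::euclidean_space) chart set"
    and g :: "'a \<Rightarrow> ('a, 'e) tvec \<Rightarrow> ('a, 'e) tvec \<Rightarrow> real"
    and L :: "'a \<times> ('a, 'e) tvec \<Rightarrow> real"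
    and d r :: nat
  assumes "smooth_atlas A"
    and "compact (UNIV :: 'a set)" and "connected (UNIV :: 'a set)"
    and "DIM('e) = d" and "d \<ge> 1"
    and "riemannian_metric A g"
    and "tonelli_lagrangian A g L"
    and "symmetrical_lagrangian A L"
    and "Ck_fun A r (\<lambda>x. L (x, \<lambda>_. 0))" and "r \<ge> 2 * d - 2"
  shows "totally_disconnected (quotient_aubry_topology A L zero_form)"
proof -
  interpret aubry_setting A g L r
    by unfold_locales (use assms in auto)
  show ?thesis by (rule totally_disconnected_quotient)
qed

end
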